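(* Let $0<c<1$. There is a constant $\kappa_c>0$, depending only on $c$, such that the following holds. Let $S\subset \mathbb R^2$ be a finite set that is not contained in a conic, and such that every line in $\mathbb R^2$ contains at most $c|S|$ points of $S$. Then $S$ determines at least $\kappa_c|S|^4$ ordinary conics.
   Context: A conic is the zero set in $\mathbb R^2$ of a real polynomial of degree $2$ in two variables; in particular a union of two distinct lines is a conic. A conic is an ordinary conic for a finite set $S\subset\mathbb R^2$ (and $S$ is said to determine it) if it contains exactly five points of $S$ and it is the only conic containing these five points. *)

theory Defs
  imports "HOL-Analysis.Analysis"
begin

text \<open>The polynomial is required to have degree exactly 2, so not all of the three leading
  coefficients vanish. No further nondegeneracy is imposed.\<close>

definition is_conic :: "(real \<times> real) set \<Rightarrow> bool" where
  "is_conic C \<longleftrightarrow>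
    (\<exists>a b c d e f :: real. \<not> (a = 0 \<and> b = 0 \<and> c = 0) \<and>
      C = {(x, y). a * x\<^sup>2 + b * x * y + c * y\<^sup>2 + d * x + e * y + f = 0})"

definition is_line :: "(real \<times> real) set \<Rightarrow> bool" where
  "is_line L \<longleftrightarrow> affine L \<and> aff_dim L = 1"

definition ordinary_conic :: "(real \<times> real) set \<Rightarrow> (real \<times> real) set \<Rightarrow> bool" where
  "ordinary_conic S C \<longleftrightarrow>
    is_conic C \<and> card (S \<inter> C) = 5 \<and> (\<forall>D. is_conic D \<and> S \<inter> C \<subseteq> D \<longrightarrow> D = C)"

end

theory Submission
  imports Defs
begin

text \<open>
  The quadratic Cremona transformation based at three points \<open>p\<close>, \<open>q\<close>, \<open>r\<close> of \<open>S\<close> maps the conics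
  through them to lines, so that ordinary lines of the image of \<open>S\<close> become ordinary conics
  through \<open>p\<close>, \<open>q\<close>, \<open>r\<close>. By the Kelly--Moser argument the image has linearly many ordinary lines;
  summed over the triples this gives order \<open>n\<^sup>4\<close> ordinary conics, unless for most triples the ordinary
  lines pass through the images of the sides of the triangle. In that case \<open>S\<close> spans quadratically
  many lines with exactly two points and quadratically many with exactly three, and disjoint pairs of
  these are ordinary conics. This needs cubically many triples whose sides carry few points, which
  exist when every conic misses a positive proportion of \<open>S\<close>. If all but a small proportion of \<open>S\<close>
  lies on a conic, then a fixed point off that conic and most quadruples on it lie on an
  ordinary conic. Small \<open>S\<close> are covered by the existence of one ordinary conic, which follows from
  Sylvester--Gallai and Kelly--Moser counting for the lines of \<open>S\<close> itself.
\<close>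

text \<open>The transformation contracts each side of the triangle to one coordinate point, so an
  ordinary line of the image through such a point says nothing about the points of \<open>S\<close>
  on that side. The loss stays small only if the sides carry few points, and linearly many ordinary
  lines exist only if the image is not collinear. Distance from conics supplies both: an image line
  is a conic through the base points, and two lines are a conic. An ordinary line through a
  coordinate point comes from a line through a base point. Apart from points of \<open>S\<close> on
  the opposite side, that line has three or two points of \<open>S\<close> according to whether the
  coordinate points are left out of the image set or added to it; this is why both kinds of lines
  appear together. The hypothesis on lines acts near a conic: if that conic is a pair of lines, it
  leaves many points on each of them, and two can be chosen on either. All counts end by charging
  tuples of points to the conic that contains them, with at most 5^4 or 5^5 tuples per
  conic.\<close>

unbundle cross3_syntax

section \<open>Ordinary lines of finite projective point sets\<close>

abbreviation det3 :: "real^3 \<Rightarrow> real^3 \<Rightarrow> real^3 \<Rightarrow> real" where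
  "det3 x y z \<equiv> x \<bullet> (y \<times> z)"

lemma det3_rotate: "det3 x y z = det3 y z x"
  by (simp add: cross3_def inner_vec_def sum_3 algebra_simps)

lemma det3_swap: "det3 x y z = - det3 y x z"
  by (simp add: cross3_def inner_vec_def sum_3 algebra_simps)

lemma det3_swap': "det3 x y z = - det3 x z y"
  by (simp add: cross3_def inner_vec_def sum_3 algebra_simps)

lemma det3_same [simp]: "det3 x x y = 0" "det3 x y x = 0" "det3 x y y = 0"
  by (simp_all add: dot_cross_self)

lemma orthogonal_basis_imp_0:
  assumes "det3 x y z \<noteq> 0" "d \<bullet> x = 0" "d \<bullet> y = 0" "d \<bullet> z = 0"
  shows "d = 0"
proof -
  have "det3 x y z *\<^sub>R d = (d \<bullet> x) *\<^sub>R (y \<times> z) + (d \<bullet> y) *\<^sub>R (z \<times> x) + (d \<bullet> z) *\<^sub>R (x \<times> y)"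
    by (simp add: cross3_def inner_vec_def sum_3 vec_eq_iff forall_3 algebra_simps)
  then show ?thesis using assms by simp
qed

text \<open>Since \<open>z\<close> is orthogonal to \<open>m = x \<times> y\<close>, the vector
  \<open>m \<times> (z \<times> m)\<close> is a nonzero multiple of \<open>z\<close>; Lagrange's
  identity expands it in \<open>x\<close> and \<open>y\<close>.\<close>

lemma det3_eq_0_imp_combination:
  assumes "x \<times> y \<noteq> 0" "det3 x y z = 0"
  obtains s t where "z = s *\<^sub>R x + t *\<^sub>R y"
proof -
  define m where "m = x \<times> y"
  have m: "m \<bullet> m \<noteq> 0" using assms(1) by (simp add: m_def)
  have "det3 x y z = z \<bullet> m"
    unfolding m_def by (simp add: cross3_def inner_vec_def sum_3 algebra_simps)
  then have 0: "z \<bullet> m = 0" using assms by simp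
  have mx: "m \<times> x = (x \<bullet> x) *\<^sub>R y - (x \<bullet> y) *\<^sub>R x"
    unfolding m_def using Lagrange[of x x y] cross_skew[of "x \<times> y" x] by simp
  have my: "m \<times> y = (y \<bullet> x) *\<^sub>R y - (y \<bullet> y) *\<^sub>R x"
    unfolding m_def using Lagrange[of y x y] cross_skew[of "x \<times> y" y] by simp
  have zm: "z \<times> m = (z \<bullet> y) *\<^sub>R x - (z \<bullet> x) *\<^sub>R y" unfolding m_def by (rule Lagrange)
  have "(m \<bullet> m) *\<^sub>R z = m \<times> (z \<times> m)" using Lagrange[of m z m] 0 by (simp add: inner_commute)
  also have "\<dots> = (z \<bullet> y) *\<^sub>R (m \<times> x) - (z \<bullet> x) *\<^sub>R (m \<times> y)"
    unfolding zm by (simp add: Cross3.right_diff_distrib cross_mult_right)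
  finally have "(m \<bullet> m) *\<^sub>R z = ((z \<bullet> x) * (y \<bullet> y) - (z \<bullet> y) * (x \<bullet> y)) *\<^sub>R x
      + ((z \<bullet> y) * (x \<bullet> x) - (z \<bullet> x) * (y \<bullet> x)) *\<^sub>R y" (is "_ = ?s *\<^sub>R x + ?t *\<^sub>R y")
    unfolding mx my by (simp add: algebra_simps)
  then have "(1 / (m \<bullet> m)) *\<^sub>R ((m \<bullet> m) *\<^sub>R z) = (1 / (m \<bullet> m)) *\<^sub>R (?s *\<^sub>R x + ?t *\<^sub>R y)" by (rule arg_cong)
  then have "z = (?s / (m \<bullet> m)) *\<^sub>R x + (?t / (m \<bullet> m)) *\<^sub>R y"
    using m by (simp add: scaleR_add_right)
  then show ?thesis by (rule that)
qed

text \<open>Lagrange's identity makes \<open>A \<times> B\<close> parallel to \<open>n\<close>;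
  pairing with \<open>P\<close>, where \<open>n\<close> takes the value 1, fixes the factor.\<close>

lemma cross_eq_scaled_normal:
  assumes "n \<bullet> A = 0" "n \<bullet> B = 0" "n \<bullet> P = 1"
  shows "A \<times> B = det3 P A B *\<^sub>R n"
proof -
  have "(A \<times> B) \<times> n = 0"
    using Lagrange[of n A B] assms cross_skew[of "A \<times> B" n] by simp
  then have "P \<times> ((A \<times> B) \<times> n) = 0" by simp
  then show ?thesis using Lagrange[of P "A \<times> B" n] assms(3) by (simp add: inner_commute)
qed

text \<open>The weight \<open>u = s / (s + t)\<close> puts \<open>n\<close> strictly between the two
  points. Only the sign of \<open>s * t\<close> enters, because the displacements found for three
  points on a side have unknown signs.\<close>

lemma not_extreme_between:
  fixes n a :: "real^3"
  assumes "n + s *\<^sub>R a \<in> N" "n - t *\<^sub>R a \<in> N" "s * t > 0" "a \<noteq> 0"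
  shows "\<not> n extreme_point_of (convex hull N)"
proof
  assume e: "n extreme_point_of (convex hull N)"
  define u where "u = s / (s + t)"
  have st: "s + t \<noteq> 0" "0 < u" "u < 1"
    using assms(3) unfolding u_def by (auto simp: zero_less_mult_iff field_simps)
  have "(1 - u) * s - u * t = 0" using st(1) by (simp add: u_def field_simps)
  moreover have "(1 - u) *\<^sub>R (n + s *\<^sub>R a) + u *\<^sub>R (n - t *\<^sub>R a) = n + ((1 - u) * s - u * t) *\<^sub>R a"
    by (simp add: algebra_simps)
  ultimately have "n = (1 - u) *\<^sub>R (n + s *\<^sub>R a) + u *\<^sub>R (n - t *\<^sub>R a)"
    by simp
  moreover have "n + s *\<^sub>R a \<noteq> n - t *\<^sub>R a"
  proof
    assume "n + s *\<^sub>R a = n - t *\<^sub>R a"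
    then have "(s + t) *\<^sub>R a = 0" by (simp add: algebra_simps)
    then show False using st assms by simp
  qed
  ultimately have "n \<in> open_segment (n + s *\<^sub>R a) (n - t *\<^sub>R a)"
    using st by (auto simp: in_segment)
  then show False using e assms(1,2) hull_inc unfolding extreme_point_of_def by metis
qed

text \<open>Vectors stand for points of the projective plane. The condition makes different vectors
  represent different points, so that cardinalities count projective points.\<close>

definition pairwise_indep :: "(real^3) set \<Rightarrow> bool" where
  "pairwise_indep V \<longleftrightarrow> (\<forall>x\<in>V. \<forall>y\<in>V. x \<noteq> y \<longrightarrow> x \<times> y \<noteq> 0)"

definition ordinary_pair :: "(real^3) set \<Rightarrow> real^3 \<Rightarrow> real^3 \<Rightarrow> bool" where
  "ordinary_pair V x y \<longleftrightarrow> x \<in> V \<and> y \<in> V \<and> x \<noteq> y \<and> (\<forall>z\<in>V. det3 x y z = 0 \<longrightarrow> z = x \<or> z = y)"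

definition ordinary_lines :: "(real^3) set \<Rightarrow> (real^3) set set" where
  "ordinary_lines V = {{x, y} | x y. ordinary_pair V x y}"

text \<open>Lines not through \<open>P\<close> are normalised by \<open>n \<bullet> P = 1\<close>. Vertices of the convex hull of
  these normals are the sides of the cell of \<open>P\<close> in the arrangement of connecting
  lines that avoid \<open>P\<close>.\<close>

definition normal :: "real^3 \<Rightarrow> real^3 \<Rightarrow> real^3 \<Rightarrow> real^3" where
  "normal P A B = (1 / det3 P A B) *\<^sub>R (A \<times> B)"

definition normals :: "(real^3) set \<Rightarrow> real^3 \<Rightarrow> (real^3) set" where
  "normals V P = {normal P A B | A B. A \<in> V \<and> B \<in> V \<and> det3 P A B \<noteq> 0}"

definition sides :: "(real^3) set \<Rightarrow> real^3 \<Rightarrow> (real^3) set" where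
  "sides V P = {n. n extreme_point_of (convex hull (normals V P))}"

text \<open>The incidence relation of the Kelly--Moser count: a line carrying exactly the points
  \<open>l\<close> bounds the cell of \<open>P\<close>.\<close>

definition attached :: "(real^3) set \<Rightarrow> (real^3) set \<Rightarrow> (real^3) set" where
  "attached V l = {P \<in> V - l. \<exists>n \<in> sides V P. {X \<in> V. n \<bullet> X = 0} = l}"

lemma normal_inner [simp]:
  "normal P A B \<bullet> A = 0" "normal P A B \<bullet> B = 0"
  by (simp_all add: normal_def dot_cross_self inner_commute)

lemma normal_inner_P: "det3 P A B \<noteq> 0 \<Longrightarrow> normal P A B \<bullet> P = 1"
  by (simp add: normal_def inner_commute)

lemma normal_unique:
  assumes "n \<bullet> A = 0" "n \<bullet> B = 0" "n \<bullet> P = 1" "det3 P A B \<noteq> 0"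
  shows "normal P A B = n"
proof -
  have "normal P A B = (1 / det3 P A B) *\<^sub>R (det3 P A B *\<^sub>R n)"
    unfolding normal_def using cross_eq_scaled_normal[OF assms(1-3)] by (rule arg_cong)
  then show ?thesis using assms(4) by simp
qed

lemma det3_neq_0:
  assumes "n \<bullet> A = 0" "n \<bullet> B = 0" "n \<bullet> P = 1" "A \<times> B \<noteq> 0"
  shows "det3 P A B \<noteq> 0"
  using cross_eq_scaled_normal[OF assms(1-3)] assms(4) by force

lemma finite_normals: "finite V \<Longrightarrow> finite (normals V P)"
  by (rule finite_subset[of _ "(\<lambda>(A,B). normal P A B) ` (Sigma V (\<lambda>_. V))"])
     (auto simp: normals_def)

lemma normals_inner_P: "n \<in> normals V P \<Longrightarrow> n \<bullet> P = 1"
  by (auto simp: normals_def normal_inner_P)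

lemma normalsI: "A \<in> V \<Longrightarrow> B \<in> V \<Longrightarrow> det3 P A B \<noteq> 0 \<Longrightarrow> normal P A B \<in> normals V P"
  by (auto simp: normals_def)

lemma sides_subset: "sides V P \<subseteq> normals V P"
  by (auto simp: sides_def dest: extreme_point_of_convex_hull)

lemma finite_sides: "finite V \<Longrightarrow> finite (sides V P)"
  using finite_subset[OF sides_subset finite_normals] by blast

text \<open>With \<open>R = x P + y C\<close>, the lines \<open>RA\<close> and \<open>RB\<close>
  have normals displaced from \<open>n\<close> along \<open>P \<times> A\<close> and
  \<open>P \<times> B\<close>. Weighting these directions by \<open>det3 P B C\<close> and
  \<open>det3 P C A\<close> lets one number \<open>t\<close> serve both, with opposite signs. Under
  cyclic permutation of \<open>A\<close>, \<open>B\<close>, \<open>C\<close> each weighted direction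
  then occurs once with each sign.\<close>

lemma third_point_normals:
  assumes V: "pairwise_indep V" and in_V: "P \<in> V" "A \<in> V" "B \<in> V" "C \<in> V" "R \<in> V"
    and ne: "A \<noteq> B" "B \<noteq> C" "C \<noteq> A"
    and n: "n \<bullet> A = 0" "n \<bullet> B = 0" "n \<bullet> C = 0" "n \<bullet> P = 1"
    and R: "R \<noteq> P" "R \<noteq> C" "det3 P C R = 0"
  obtains t where "t \<noteq> 0" "n + t *\<^sub>R (det3 P B C *\<^sub>R (P \<times> A)) \<in> normals V P"
     "n - t *\<^sub>R (det3 P C A *\<^sub>R (P \<times> B)) \<in> normals V P"
proof -
  have PC: "P \<noteq> C" using n by auto
  then have "P \<times> C \<noteq> 0" using V in_V by (auto simp: pairwise_indep_def)
  then obtain x y where xy: "R = x *\<^sub>R P + y *\<^sub>R C"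
    using R det3_eq_0_imp_combination by blast
  have RP: "R \<times> P \<noteq> 0" and RC: "R \<times> C \<noteq> 0" using V in_V R by (auto simp: pairwise_indep_def)
  have y: "y \<noteq> 0" using RP by (auto simp: xy cross_mult_left)
  have x: "x \<noteq> 0" using RC by (auto simp: xy cross_mult_left)
  have wa: "det3 P B C \<noteq> 0" and wb: "det3 P C A \<noteq> 0"
    using det3_neq_0[OF n(2,3,4)] det3_neq_0[OF n(3,1,4)] V in_V ne by (auto simp: pairwise_indep_def)
  have CA: "C \<times> A = det3 P C A *\<^sub>R n" and BC: "B \<times> C = det3 P B C *\<^sub>R n"
    using cross_eq_scaled_normal n by blast+
  have CB: "C \<times> B = - (det3 P B C *\<^sub>R n)" using BC cross_skew[of C B] by simp
  let ?a = "det3 P B C" and ?b = "det3 P C A"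
  define t where "t = x / (y * ?a * ?b)"
  have 1: "R \<times> A = x *\<^sub>R (P \<times> A) + (y * ?b) *\<^sub>R n"
    unfolding xy by (subst cross_add_left, simp only: cross_mult_left, subst CA, simp)
  have 2: "R \<times> B = x *\<^sub>R (P \<times> B) - (y * ?a) *\<^sub>R n"
    unfolding xy by (subst cross_add_left, simp only: cross_mult_left, subst CB, simp)
  have d1: "det3 P R A = y * ?b" unfolding 1 using n(4)
    by (simp add: inner_add_right inner_commute[of P n])
  have d2: "det3 P R B = - (y * ?a)" unfolding 2 using n(4)
    by (simp add: inner_diff_right inner_commute[of P n])
  have "normal P R A = n + (x / (y * ?b)) *\<^sub>R (P \<times> A)"
    using y wb unfolding normal_def d1 by (subst 1) (simp add: algebra_simps)
  also have "\<dots> = n + t *\<^sub>R (?a *\<^sub>R (P \<times> A))"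
    using wa by (simp add: t_def)
  finally have 3: "n + t *\<^sub>R (?a *\<^sub>R (P \<times> A)) \<in> normals V P"
    using normalsI[of R V A P] in_V d1 y wb by simp
  have "normal P R B = n - (x / (y * ?a)) *\<^sub>R (P \<times> B)"
    using y wa unfolding normal_def d2 by (subst 2) (simp add: algebra_simps)
  also have "\<dots> = n - t *\<^sub>R (?b *\<^sub>R (P \<times> B))"
    using wb by (simp add: t_def)
  finally have 4: "n - t *\<^sub>R (?b *\<^sub>R (P \<times> B)) \<in> normals V P"
    using normalsI[of R V B P] in_V d2 y wa by simp
  have "t \<noteq> 0" using x y wa wb by (simp add: t_def)
  then show ?thesis using 3 4 that by blast
qed

text \<open>The Kelly--Moser step: a side of the cell of \<open>P\<close> cannot carry three points that are joined
  to \<open>P\<close> by non-ordinary lines, since among three signs two agree.\<close>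

lemma side_with_three_points_false:
  assumes V: "pairwise_indep V" and in_V: "P \<in> V" "A \<in> V" "B \<in> V" "C \<in> V"
    and ne: "A \<noteq> B" "B \<noteq> C" "C \<noteq> A"
    and n: "n \<in> sides V P" "n \<bullet> A = 0" "n \<bullet> B = 0" "n \<bullet> C = 0"
    and ord: "\<not> ordinary_pair V P A" "\<not> ordinary_pair V P B" "\<not> ordinary_pair V P C"
  shows False
proof -
  have nP: "n \<bullet> P = 1" using n(1) sides_subset normals_inner_P by blast
  have P: "P \<noteq> A" "P \<noteq> B" "P \<noteq> C" using n nP by auto
  have ext: "n extreme_point_of (convex hull (normals V P))" using n(1) by (simp add: sides_def)
  obtain R1 where R1: "R1 \<in> V" "R1 \<noteq> P" "R1 \<noteq> A" "det3 P A R1 = 0"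
    using ord(1) in_V P by (auto simp: ordinary_pair_def)
  obtain R2 where R2: "R2 \<in> V" "R2 \<noteq> P" "R2 \<noteq> B" "det3 P B R2 = 0"
    using ord(2) in_V P by (auto simp: ordinary_pair_def)
  obtain R3 where R3: "R3 \<in> V" "R3 \<noteq> P" "R3 \<noteq> C" "det3 P C R3 = 0"
    using ord(3) in_V P by (auto simp: ordinary_pair_def)
  obtain tc where tc: "tc \<noteq> 0" "n + tc *\<^sub>R (det3 P B C *\<^sub>R (P \<times> A)) \<in> normals V P"
     "n - tc *\<^sub>R (det3 P C A *\<^sub>R (P \<times> B)) \<in> normals V P"
    using third_point_normals[OF V in_V R3(1) ne n(2,3,4) nP R3(2-4)] .
  obtain ta where ta: "ta \<noteq> 0" "n + ta *\<^sub>R (det3 P C A *\<^sub>R (P \<times> B)) \<in> normals V P"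
     "n - ta *\<^sub>R (det3 P A B *\<^sub>R (P \<times> C)) \<in> normals V P"
    using third_point_normals[OF V in_V(1,3,4,2) R1(1) ne(2,3,1) n(3,4,2) nP R1(2-4)] .
  obtain tb where tb: "tb \<noteq> 0" "n + tb *\<^sub>R (det3 P A B *\<^sub>R (P \<times> C)) \<in> normals V P"
     "n - tb *\<^sub>R (det3 P B C *\<^sub>R (P \<times> A)) \<in> normals V P"
    using third_point_normals[OF V in_V(1,4,2,3) R2(1) ne(3,1,2) n(4,2,3) nP R2(2-4)] .
  have w: "det3 P B C \<noteq> 0" "det3 P C A \<noteq> 0" "det3 P A B \<noteq> 0"
    using det3_neq_0[OF n(3,4) nP] det3_neq_0[OF n(4,2) nP] det3_neq_0[OF n(2,3) nP] V in_V ne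
    by (auto simp: pairwise_indep_def)
  have "P \<times> A \<noteq> 0" "P \<times> B \<noteq> 0" "P \<times> C \<noteq> 0" using V in_V P by (auto simp: pairwise_indep_def)
  then have nz: "det3 P B C *\<^sub>R (P \<times> A) \<noteq> 0" "det3 P C A *\<^sub>R (P \<times> B) \<noteq> 0" "det3 P A B *\<^sub>R (P \<times> C) \<noteq> 0"
    using w by auto
  have "\<not> tc * tb > 0" using not_extreme_between[OF tc(2) tb(3) _ nz(1)] ext by blast
  moreover have "\<not> ta * tc > 0" using not_extreme_between[OF ta(2) tc(3) _ nz(2)] ext by blast
  moreover have "\<not> tb * ta > 0" using not_extreme_between[OF tb(2) ta(3) _ nz(3)] ext by blast
  ultimately show False using tc(1) ta(1) tb(1)
    by (auto simp: zero_less_mult_iff not_less dest: order_antisym)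
qed

text \<open>\<open>u\<close> is an affine coordinate on the pencil of lines at \<open>A\<close>,
  with the line \<open>AB\<close> at infinity. Points with larger and with smaller coordinate than
  \<open>P\<close>, joined to \<open>A\<close>, would give normals on both sides of the normal of
  \<open>AB\<close>, which then could not be a vertex.\<close>

lemma attached_extremal:
  assumes V: "pairwise_indep V" and ord: "ordinary_pair V A B"
    and P: "P \<in> V" "P \<noteq> A" "P \<noteq> B" and n: "normal P A B \<in> sides V P"
  defines "u \<equiv> \<lambda>X. (((A \<times> B) \<times> A) \<bullet> X) / ((A \<times> B) \<bullet> X)"
  shows "(\<forall>X \<in> V - {A, B}. u X \<le> u P) \<or> (\<forall>X \<in> V - {A, B}. u P \<le> u X)"
proof (rule ccontr)
  assume "\<not> ?thesis"
  then obtain X Y where X: "X \<in> V" "X \<noteq> A" "X \<noteq> B" "u P < u X"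
    and Y: "Y \<in> V" "Y \<noteq> A" "Y \<noteq> B" "u Y < u P" by (auto simp: not_le)
  define m where "m = A \<times> B"
  define g where "g = m \<times> A"
  have AB: "A \<in> V" "B \<in> V" "A \<noteq> B" using ord by (auto simp: ordinary_pair_def)
  have m0: "m \<noteq> 0" using AB V by (simp add: m_def pairwise_indep_def)
  have mz: "m \<bullet> Z \<noteq> 0" if "Z \<in> V" "Z \<noteq> A" "Z \<noteq> B" for Z
  proof -
    have "m \<bullet> Z = det3 A B Z" unfolding m_def by (simp add: cross3_def inner_vec_def sum_3 algebra_simps)
    then show ?thesis using that ord by (auto simp: ordinary_pair_def)
  qed
  have gB: "g \<bullet> B = m \<bullet> m" unfolding g_def cross_triple[of m A B] by (simp add: m_def)
  have mm: "m \<bullet> m \<noteq> 0" using m0 by simp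
  have mB: "m \<bullet> B = 0" by (simp add: m_def dot_cross_self)
  have key: "(m \<bullet> m) *\<^sub>R (Z \<times> A) = (Z \<bullet> m) *\<^sub>R g - (Z \<bullet> g) *\<^sub>R m" for Z
  proof -
    have "g \<times> m = (m \<bullet> m) *\<^sub>R A - (A \<bullet> m) *\<^sub>R m"
      unfolding g_def using Lagrange[of m m A] cross_skew[of "m \<times> A" m] by (simp add: inner_commute)
    moreover have "A \<bullet> m = 0" by (simp add: m_def)
    ultimately have "g \<times> m = (m \<bullet> m) *\<^sub>R A" by simp
    then have "(m \<bullet> m) *\<^sub>R (Z \<times> A) = Z \<times> (g \<times> m)" by (simp add: cross_mult_right)
    then show ?thesis using Lagrange[of Z g m] by simp
  qed
  define a where "a = (P \<bullet> m) *\<^sub>R g - (P \<bullet> g) *\<^sub>R m"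
  have Pm: "P \<bullet> m \<noteq> 0" using mz[OF P] by (simp add: inner_commute)
  have "a \<bullet> B = (P \<bullet> m) * (m \<bullet> m)" by (simp add: a_def inner_diff_left gB mB)
  then have a0: "a \<noteq> 0" using Pm mm by auto
  have u: "u Z = (Z \<bullet> g) / (Z \<bullet> m)" for Z by (simp add: u_def g_def m_def inner_commute)
  \<comment> \<open>The normal of \<open>ZA\<close> differs from that of \<open>AB\<close> by a
    multiple of the fixed vector \<open>a\<close>, with the sign of
    \<open>u P - u Z\<close>.\<close>
  have pt: "normal P A B + (1 / ((P \<bullet> m)^2 * (u P - u Z))) *\<^sub>R a \<in> normals V P"
    if Z: "Z \<in> V" "Z \<noteq> A" "Z \<noteq> B" "u Z \<noteq> u P" for Z
  proof -
    have Zm: "Z \<bullet> m \<noteq> 0" using mz Z by (simp add: inner_commute)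
    define D where "D = (P \<bullet> g) * (Z \<bullet> m) - (P \<bullet> m) * (Z \<bullet> g)"
    have D: "D = (P \<bullet> m) * (Z \<bullet> m) * (u P - u Z)"
      unfolding D_def u using Pm Zm by (simp add: field_simps)
    have D0: "D \<noteq> 0" using D Pm Zm Z by simp
    have "(m \<bullet> m) * det3 P Z A = P \<bullet> ((m \<bullet> m) *\<^sub>R (Z \<times> A))" by simp
    also have "\<dots> = D" unfolding key D_def by (simp add: inner_diff_right algebra_simps)
    finally have det: "(m \<bullet> m) * det3 P Z A = D" .
    then have dz: "det3 P Z A \<noteq> 0" using D0 by auto
    have "normal P Z A = (1 / ((m \<bullet> m) * det3 P Z A)) *\<^sub>R ((m \<bullet> m) *\<^sub>R (Z \<times> A))"
      using mm by (simp add: normal_def)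
    also have "\<dots> = (1 / D) *\<^sub>R ((Z \<bullet> m) *\<^sub>R g - (Z \<bullet> g) *\<^sub>R m)" by (simp only: det key)
    also have "\<dots> = (1 / (P \<bullet> m)) *\<^sub>R m + ((Z \<bullet> m) / (D * (P \<bullet> m))) *\<^sub>R a"
    proof -
      have "(Z \<bullet> g) / D + 1 / (P \<bullet> m) = (Z \<bullet> m) * (P \<bullet> g) / (D * (P \<bullet> m))"
        using D0 Pm by (simp add: field_simps) (simp add: D_def algebra_simps)
      then have "(1 / (P \<bullet> m)) - (Z \<bullet> m) * (P \<bullet> g) / (D * (P \<bullet> m)) = - (Z \<bullet> g) / D"
        by (simp add: algebra_simps)
      then have "(1 / D) *\<^sub>R ((Z \<bullet> m) *\<^sub>R g - (Z \<bullet> g) *\<^sub>R m)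
         = ((Z \<bullet> m) / D) *\<^sub>R g + ((1 / (P \<bullet> m)) - (Z \<bullet> m) * (P \<bullet> g) / (D * (P \<bullet> m))) *\<^sub>R m"
        by (simp add: scaleR_diff_right)
      moreover have "(1 / (P \<bullet> m)) *\<^sub>R m + ((Z \<bullet> m) / (D * (P \<bullet> m))) *\<^sub>R a
         = ((Z \<bullet> m) / D) *\<^sub>R g + ((1 / (P \<bullet> m)) - (Z \<bullet> m) * (P \<bullet> g) / (D * (P \<bullet> m))) *\<^sub>R m"
        using Pm by (simp add: a_def algebra_simps)
      ultimately show ?thesis by (rule trans[OF _ sym])
    qed
    also have "(Z \<bullet> m) / (D * (P \<bullet> m)) = 1 / ((P \<bullet> m)^2 * (u P - u Z))"
      unfolding D using Zm Pm by (simp add: power2_eq_square)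
    also have "(1 / (P \<bullet> m)) *\<^sub>R m = normal P A B" by (simp add: normal_def m_def)
    finally show ?thesis using normalsI[OF Z(1) AB(1) dz] by simp
  qed
  define s where "s = 1 / ((P \<bullet> m)^2 * (u P - u Y))"
  define t where "t = 1 / ((P \<bullet> m)^2 * (u X - u P))"
  have "s > 0" "t > 0" using Pm X Y by (auto simp: s_def t_def)
  moreover have "normal P A B + s *\<^sub>R a \<in> normals V P" using pt[of Y] Y by (simp add: s_def)
  moreover have "normal P A B - t *\<^sub>R a \<in> normals V P"
  proof -
    have "1 / ((P \<bullet> m)^2 * (u P - u X)) = - t" unfolding t_def
      by (metis minus_diff_eq minus_divide_right mult_minus_right)
    then show ?thesis using pt[of X] X by simp
  qed
  ultimately show False using not_extreme_between[of _ s a _ t] a0 n by (auto simp: sides_def)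
qed

text \<open>\<open>u\<close> and \<open>v\<close> are coordinates on the pencils at \<open>A\<close>
  and \<open>B\<close>; together they form a chart of the plane off \<open>AB\<close>. An attached
  point is extremal for both, hence one of at most 2 times 2 corners.\<close>

lemma card_attached_le:
  assumes fin: "finite V" and V: "pairwise_indep V" and l: "l \<in> ordinary_lines V"
  shows "card (attached V l) \<le> 4"
proof -
  obtain A B where l: "l = {A, B}" and ord: "ordinary_pair V A B"
    using l by (auto simp: ordinary_lines_def)
  have ord': "ordinary_pair V B A" using ord det3_swap[of A B] by (auto simp: ordinary_pair_def)
  define W where "W = V - {A, B}"
  define m where "m = A \<times> B"
  define u where "u = (\<lambda>X. (((A \<times> B) \<times> A) \<bullet> X) / ((A \<times> B) \<bullet> X))"
  define v where "v = (\<lambda>X. (((B \<times> A) \<times> B) \<bullet> X) / ((B \<times> A) \<bullet> X))"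
  have AB: "A \<in> V" "B \<in> V" "A \<noteq> B" using ord by (auto simp: ordinary_pair_def)
  have m0: "m \<noteq> 0" using AB V by (simp add: m_def pairwise_indep_def)
  have mz: "m \<bullet> Z \<noteq> 0" if "Z \<in> W" for Z
  proof -
    have "m \<bullet> Z = det3 A B Z" unfolding m_def by (simp add: cross3_def inner_vec_def sum_3 algebra_simps)
    then show ?thesis using that ord by (auto simp: ordinary_pair_def W_def)
  qed
  have v: "v X = ((m \<times> B) \<bullet> X) / (m \<bullet> X)" for X
    unfolding v_def m_def cross_skew[of B A] by simp
  have u: "u X = ((m \<times> A) \<bullet> X) / (m \<bullet> X)" for X
    unfolding u_def m_def by simp
  have finW: "finite W" using fin by (simp add: W_def)
  have inj: "inj_on (\<lambda>X. (u X, v X)) W"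
  proof (rule inj_onI)
    fix X Y assume XY: "X \<in> W" "Y \<in> W" "(u X, v X) = (u Y, v Y)"
    define d where "d = (1 / (m \<bullet> X)) *\<^sub>R X - (1 / (m \<bullet> Y)) *\<^sub>R Y"
    have "(m \<times> A) \<times> (m \<times> B) = (m \<bullet> (A \<times> B)) *\<^sub>R m"
      by (simp add: cross3_def inner_vec_def sum_3 vec_eq_iff forall_3 algebra_simps)
    then have "det3 m (m \<times> A) (m \<times> B) = (m \<bullet> m) * (m \<bullet> m)"
      by (simp add: m_def)
    then have "det3 m (m \<times> A) (m \<times> B) \<noteq> 0" using m0 by simp
    moreover have "d \<bullet> m = 0" using mz[OF XY(1)] mz[OF XY(2)]
      by (simp add: d_def inner_commute[of _ m] inner_diff_right)
    moreover have "d \<bullet> (m \<times> A) = 0" using XY(3)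
      by (simp add: d_def inner_diff_left u) (simp add: inner_commute)
    moreover have "d \<bullet> (m \<times> B) = 0" using XY(3)
      by (simp add: d_def inner_diff_left v) (simp add: inner_commute)
    ultimately have "d = 0" by (rule orthogonal_basis_imp_0)
    then have "X \<times> ((1 / (m \<bullet> X)) *\<^sub>R X) = X \<times> ((1 / (m \<bullet> Y)) *\<^sub>R Y)" by (simp add: d_def)
    then have "X \<times> Y = 0" using mz[OF XY(2)] by (simp add: cross_mult_right)
    then show "X = Y" using V XY by (auto simp: pairwise_indep_def W_def)
  qed
  have sub: "attached V l \<subseteq> W" by (auto simp: attached_def W_def l)
  have "(\<lambda>X. (u X, v X)) ` attached V l \<subseteq> Sigma {Min (u ` W), Max (u ` W)} (\<lambda>_. {Min (v ` W), Max (v ` W)})"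
  proof (rule image_subsetI)
    fix P assume P: "P \<in> attached V l"
    then obtain n where n: "n \<in> sides V P" "{X \<in> V. n \<bullet> X = 0} = l" and PV: "P \<in> V" "P \<noteq> A" "P \<noteq> B"
      by (auto simp: attached_def l)
    have nP: "n \<bullet> P = 1" using n(1) sides_subset normals_inner_P by blast
    have nA: "n \<bullet> A = 0" "n \<bullet> B = 0" using n(2) by (auto simp: l)
    have d: "det3 P A B \<noteq> 0" "det3 P B A \<noteq> 0"
      using det3_neq_0[OF nA nP] det3_neq_0[OF nA(2,1) nP] AB V by (auto simp: pairwise_indep_def)
    have "normal P A B = n" "normal P B A = n"
      using normal_unique[OF nA nP d(1)] normal_unique[OF nA(2,1) nP d(2)] by auto
    then have 1: "(\<forall>X \<in> W. u X \<le> u P) \<or> (\<forall>X \<in> W. u P \<le> u X)"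
      and 2: "(\<forall>X \<in> W. v X \<le> v P) \<or> (\<forall>X \<in> W. v P \<le> v X)"
      using attached_extremal[OF V ord PV] attached_extremal[OF V ord' PV(1,3,2)] n(1)
      by (auto simp: u_def v_def W_def insert_commute)
    have PW: "P \<in> W" using P sub by blast
    have "f P \<in> {Min (f ` W), Max (f ` W)}"
      if "(\<forall>X \<in> W. f X \<le> f P) \<or> (\<forall>X \<in> W. f P \<le> f X)" for f :: "real^3 \<Rightarrow> real"
      using that
    proof
      assume "\<forall>X \<in> W. f X \<le> f P"
      then have "Max (f ` W) = f P" using finW PW by (intro Max_eqI) auto
      then show ?thesis by simp
    next
      assume "\<forall>X \<in> W. f P \<le> f X"
      then have "Min (f ` W) = f P" using finW PW by (intro Min_eqI) auto
      then show ?thesis by simp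
    qed
    then show "(u P, v P) \<in> Sigma {Min (u ` W), Max (u ` W)} (\<lambda>_. {Min (v ` W), Max (v ` W)})"
      using 1 2 by blast
  qed
  then have "card ((\<lambda>X. (u X, v X)) ` attached V l) \<le> card (Sigma {Min (u ` W), Max (u ` W)} (\<lambda>_. {Min (v ` W), Max (v ` W)}))"
    by (intro card_mono) auto
  also have "\<dots> \<le> 2 * 2"
    by (subst card_SigmaI) (auto simp: card_insert_if)
  finally show ?thesis using card_image[OF inj_on_subset[OF inj sub]] by simp
qed

lemma finite_ordinary_lines: "finite V \<Longrightarrow> finite (ordinary_lines V)"
  by (rule finite_subset[of _ "Pow V"]) (auto simp: ordinary_lines_def ordinary_pair_def)

lemma sides_nonempty:
  assumes "finite V" "A \<in> V" "B \<in> V" "det3 P A B \<noteq> 0"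
  shows "sides V P \<noteq> {}"
proof -
  have "normals V P \<noteq> {}" using normalsI[OF assms(2-4)] by blast
  then have "convex hull (normals V P) \<noteq> {}" by simp
  moreover have "compact (convex hull (normals V P))"
    using finite_normals[OF assms(1)] by (simp add: compact_convex_hull finite_imp_compact)
  ultimately show ?thesis using extreme_point_exists_convex[of "convex hull (normals V P)"]
    by (auto simp: sides_def)
qed

lemma side_two_points:
  assumes "pairwise_indep V" "n \<in> sides V P"
  obtains A B where "A \<in> V" "B \<in> V" "A \<noteq> B" "n \<bullet> A = 0" "n \<bullet> B = 0"
proof -
  obtain A B where AB: "A \<in> V" "B \<in> V" "det3 P A B \<noteq> 0" "n = normal P A B"
    using assms(2) sides_subset unfolding normals_def by blast
  then have "A \<noteq> B" by auto
  then show ?thesis using that AB by simp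
qed

lemma side_ordinary_or_third:
  assumes V: "pairwise_indep V" and P: "P \<in> V" and n: "n \<in> sides V P"
    and no: "{X \<in> V. n \<bullet> X = 0} \<notin> ordinary_lines V"
  obtains A B C where "A \<in> V" "B \<in> V" "C \<in> V" "A \<noteq> B" "B \<noteq> C" "C \<noteq> A"
    "n \<bullet> A = 0" "n \<bullet> B = 0" "n \<bullet> C = 0"
proof -
  obtain A B where AB: "A \<in> V" "B \<in> V" "A \<noteq> B" "n \<bullet> A = 0" "n \<bullet> B = 0"
    using side_two_points[OF V n] .
  have nP: "n \<bullet> P = 1" using n sides_subset normals_inner_P by blast
  have ABn: "A \<times> B = det3 P A B *\<^sub>R n" using cross_eq_scaled_normal[OF AB(4,5) nP] .
  have d: "det3 P A B \<noteq> 0" using det3_neq_0[OF AB(4,5) nP] V AB by (auto simp: pairwise_indep_def)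
  have iff: "n \<bullet> X = 0 \<longleftrightarrow> det3 A B X = 0" for X
  proof -
    have "det3 A B X = X \<bullet> (A \<times> B)" by (simp add: cross3_def inner_vec_def sum_3 algebra_simps)
    also have "\<dots> = det3 P A B * (X \<bullet> n)" by (subst ABn) simp
    finally show ?thesis using d by (simp add: inner_commute)
  qed
  show ?thesis
  proof (cases "ordinary_pair V A B")
    case True
    then have "{X \<in> V. n \<bullet> X = 0} = {A, B}" using AB by (auto simp: iff ordinary_pair_def)
    then show ?thesis using no True by (auto simp: ordinary_lines_def)
  next
    case False
    then obtain C where "C \<in> V" "C \<noteq> A" "C \<noteq> B" "det3 A B C = 0" using AB by (auto simp: ordinary_pair_def)
    then show ?thesis using that[of A B C] AB iff by auto
  qed
qed

text \<open>A point on an ordinary line is one of the 2 points there. Any other point has a cell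
  with only ordinary sides, so it is one of the at most 4 points attached to such a line. This gives
  6 = 2 + 4; \<open>span\<close> guarantees that the cell has a side.\<close>

theorem card_le_6_ordinary_lines:
  assumes fin: "finite V" and V: "pairwise_indep V"
    and span: "\<And>w. w \<noteq> 0 \<Longrightarrow> \<exists>x\<in>V. w \<bullet> x \<noteq> 0"
  shows "card V \<le> 6 * card (ordinary_lines V)"
proof -
  have "V \<subseteq> (\<Union>l \<in> ordinary_lines V. l \<union> attached V l)"
  proof
    fix P assume P: "P \<in> V"
    show "P \<in> (\<Union>l \<in> ordinary_lines V. l \<union> attached V l)"
    proof (cases "\<exists>A. ordinary_pair V P A")
      case True
      then show ?thesis by (auto simp: ordinary_lines_def)
    next
      case False
      obtain A where A: "A \<in> V" "A \<noteq> P"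
      proof (rule ccontr)
        assume "\<not> thesis"
        then have *: "V \<subseteq> {P}" using that by blast
        \<comment> \<open>A nonzero vector orthogonal to \<open>P\<close> would be orthogonal to all
          of \<open>V\<close>. Unless \<open>P = 0\<close>, the product of \<open>P\<close> with
          some axis is such a vector.\<close>
        define w where "w = (if P \<times> axis 1 1 = 0 then P \<times> axis 2 1 else P \<times> axis 1 1)"
        have "w \<bullet> P = 0" by (simp add: w_def dot_cross_self inner_commute)
        moreover have "w \<noteq> 0 \<or> P = 0 \<or> P \<times> axis 3 1 \<noteq> 0"
          using cross_basis_nonzero[of P] by (auto simp: w_def)
        moreover have "(P \<times> axis 3 1) \<bullet> P = 0" by (simp add: dot_cross_self inner_commute)
        ultimately show False using span[of w] span[of "P \<times> axis 3 1"] span[of "axis 1 1"] *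
          by (auto simp: axis_eq_0_iff)
      qed
      have "P \<times> A \<noteq> 0" using V P A by (auto simp: pairwise_indep_def)
      then obtain B where B: "B \<in> V" "(P \<times> A) \<bullet> B \<noteq> 0" using span by blast
      then have "det3 P A B \<noteq> 0" using cross_triple[of P A B] by (simp add: inner_commute)
      then obtain n where n: "n \<in> sides V P" using sides_nonempty[OF fin A(1) B(1)] by blast
      have "{X \<in> V. n \<bullet> X = 0} \<in> ordinary_lines V"
      proof (rule ccontr)
        assume "\<not> ?thesis"
        then obtain A B C where "A \<in> V" "B \<in> V" "C \<in> V" "A \<noteq> B" "B \<noteq> C" "C \<noteq> A"
          "n \<bullet> A = 0" "n \<bullet> B = 0" "n \<bullet> C = 0"
          using side_ordinary_or_third[OF V P n] by blast
        then show False using side_with_three_points_false[OF V P _ _ _ _ _ _ n] False by blast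
      qed
      moreover have "n \<bullet> P = 1" using n sides_subset normals_inner_P by blast
      ultimately have "P \<in> attached V {X \<in> V. n \<bullet> X = 0}" using n P by (auto simp: attached_def)
      then show ?thesis using \<open>{X \<in> V. n \<bullet> X = 0} \<in> ordinary_lines V\<close> by blast
    qed
  qed
  moreover have fa: "finite (l \<union> attached V l)" if "l \<in> ordinary_lines V" for l
    using that fin by (auto simp: ordinary_lines_def attached_def)
  ultimately have "card V \<le> card (\<Union>l \<in> ordinary_lines V. l \<union> attached V l)"
    using finite_ordinary_lines[OF fin] by (intro card_mono) auto
  also have "\<dots> \<le> (\<Sum>l \<in> ordinary_lines V. card (l \<union> attached V l))"
    by (rule card_UN_le[OF finite_ordinary_lines[OF fin]])
  also have "\<dots> \<le> (\<Sum>l \<in> ordinary_lines V. 6)"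
  proof (rule sum_mono)
    fix l assume l: "l \<in> ordinary_lines V"
    have "card l \<le> 2" using l by (auto simp: ordinary_lines_def card_insert_if)
    then show "card (l \<union> attached V l) \<le> 6"
      using card_Un_le[of l "attached V l"] card_attached_le[OF fin V l] by linarith
  qed
  finally show ?thesis by simp
qed

section \<open>Lower bounds for the number of sides and of ordinary sides of a cell\<close>

lemma det3_combinations_eq_0:
  assumes "\<And>i. i \<in> {x, y, z} \<Longrightarrow> \<exists>s t. i = s *\<^sub>R a + t *\<^sub>R b"
  shows "det3 x y z = 0"
proof -
  obtain s1 t1 s2 t2 s3 t3 where "x = s1 *\<^sub>R a + t1 *\<^sub>R b" "y = s2 *\<^sub>R a + t2 *\<^sub>R b" "z = s3 *\<^sub>R a + t3 *\<^sub>R b"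
    using assms by (metis insertI1 insertI2)
  then show ?thesis
    by (simp add: cross3_def inner_vec_def sum_3 algebra_simps)
qed

text \<open>Further points \<open>R\<close> on \<open>PA\<close> and \<open>R'\<close> on
  \<open>PB\<close> make \<open>AB\<close>, \<open>RB\<close> and \<open>RR'\<close> three lines
  avoiding \<open>P\<close> with linearly independent normals. If the hull had at most two extreme
  points, all normals would lie in the span of two vectors.\<close>

lemma card_sides_ge_3:
  assumes fin: "finite V" and V: "pairwise_indep V" and PAB: "P \<in> V" "A \<in> V" "B \<in> V" "det3 P A B \<noteq> 0"
    and no: "\<not> ordinary_pair V P A" "\<not> ordinary_pair V P B"
  shows "card (sides V P) \<ge> 3"
proof (rule ccontr)
  assume "\<not> ?thesis"
  then have c: "card (sides V P) \<le> 2" by simp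
  have ne: "P \<noteq> A" "P \<noteq> B" using PAB(4) by auto
  then have PA: "P \<times> A \<noteq> 0" and PB: "P \<times> B \<noteq> 0" using V PAB by (auto simp: pairwise_indep_def)
  obtain R where R: "R \<in> V" "R \<noteq> P" "R \<noteq> A" "det3 P A R = 0"
    using no(1) PAB ne by (auto simp: ordinary_pair_def)
  obtain R' where R': "R' \<in> V" "R' \<noteq> P" "R' \<noteq> B" "det3 P B R' = 0"
    using no(2) PAB ne by (auto simp: ordinary_pair_def)
  obtain x y where xy: "R = x *\<^sub>R P + y *\<^sub>R A" using det3_eq_0_imp_combination[OF PA R(4)] .
  obtain x' y' where xy': "R' = x' *\<^sub>R P + y' *\<^sub>R B" using det3_eq_0_imp_combination[OF PB R'(4)] .
  have "R \<times> P \<noteq> 0" "R \<times> A \<noteq> 0" "R' \<times> P \<noteq> 0" "R' \<times> B \<noteq> 0" using V PAB R R' by (auto simp: pairwise_indep_def)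
  then have nz: "x \<noteq> 0" "y \<noteq> 0" "x' \<noteq> 0" "y' \<noteq> 0" by (auto simp: xy xy' cross_mult_left)
  have e2: "R \<times> B = x *\<^sub>R (P \<times> B) + y *\<^sub>R (A \<times> B)"
    by (simp add: xy cross_add_left cross_mult_left)
  have e3: "R \<times> R' = (x * y') *\<^sub>R (P \<times> B) - (y * x') *\<^sub>R (P \<times> A) + (y * y') *\<^sub>R (A \<times> B)"
    using cross_skew[of A P] by (simp add: xy xy' cross_add_left cross_mult_left cross_add_right cross_mult_right scaleR_add_right mult.commute)
  have d2: "det3 P R B = y * det3 P A B" by (simp add: e2 inner_add_right)
  have d3: "det3 P R R' = y * y' * det3 P A B" by (simp add: e3 inner_add_right inner_diff_right)
  have "(P \<times> B) \<times> (P \<times> A) = (P \<bullet> (B \<times> A)) *\<^sub>R P"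
    by (simp add: cross3_def inner_vec_def sum_3 vec_eq_iff forall_3 algebra_simps)
  then have base: "det3 (A \<times> B) (P \<times> B) (P \<times> A) = - ((det3 P A B)\<^sup>2)"
    using cross_skew[of A B] by (simp add: inner_commute power2_eq_square)
  have "det3 (A \<times> B) (R \<times> B) (R \<times> R') = - (x * y * x') * det3 (A \<times> B) (P \<times> B) (P \<times> A)"
    unfolding e2 e3
    by (simp add: cross_add_left cross_add_right Cross3.right_diff_distrib cross_mult_left cross_mult_right
        inner_add_right inner_diff_right dot_cross_self)
  then have "det3 (A \<times> B) (R \<times> B) (R \<times> R') \<noteq> 0" using base nz PAB by simp
  then have indep: "det3 (normal P A B) (normal P R B) (normal P R R') \<noteq> 0"
    using PAB(4) d2 d3 nz by (simp add: normal_def cross_mult_left cross_mult_right)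
  have mem: "normal P A B \<in> normals V P" "normal P R B \<in> normals V P" "normal P R R' \<in> normals V P"
    using PAB R R' d2 d3 nz by (auto intro!: normalsI)
  have "\<exists>a b. sides V P \<subseteq> {a, b}"
  proof -
    consider "card (sides V P) = 0" | "card (sides V P) = 1" | "card (sides V P) = 2" using c by linarith
    then show ?thesis
    proof cases
      case 1 then show ?thesis using finite_sides[OF fin] by auto
    next
      case 2 then show ?thesis by (auto simp: card_1_singleton_iff)
    next
      case 3 then show ?thesis by (auto simp: card_2_iff)
    qed
  qed
  then obtain a b where ab: "sides V P \<subseteq> {a, b}" by blast
  have "compact (convex hull (normals V P))"
    using finite_normals[OF fin] by (simp add: compact_convex_hull finite_imp_compact)
  then have "convex hull (normals V P) = convex hull (sides V P)"
    unfolding sides_def by (intro Krein_Milman_Minkowski) auto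
  also have "\<dots> \<subseteq> convex hull {a, b}" by (rule hull_mono[OF ab])
  finally have "normals V P \<subseteq> convex hull {a, b}" using hull_subset[of "normals V P" convex] by blast
  then have "\<exists>s t. i = s *\<^sub>R a + t *\<^sub>R b" if "i \<in> normals V P" for i
    using that unfolding convex_hull_2 by blast
  then have "det3 (normal P A B) (normal P R B) (normal P R R') = 0"
    using mem by (intro det3_combinations_eq_0[where a=a and b=b]) blast
  then show False using indep by contradiction
qed

text \<open>The conditions \<open>n \<bullet> P = 1\<close> and \<open>n \<bullet> Q = 0\<close> put
  these normals on a line with direction \<open>P \<times> Q\<close>; of three points on a line the
  middle one is not extreme. \<open>f\<close> is the coordinate along that line.\<close>

lemma card_sides_through_le_2:
  assumes fin: "finite V" and PQ: "P \<times> Q \<noteq> 0"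
  shows "card {n \<in> sides V P. n \<bullet> Q = 0} \<le> 2"
proof (rule ccontr)
  define M where "M = {n \<in> sides V P. n \<bullet> Q = 0}"
  assume "\<not> ?thesis"
  then have c: "card M > 2" by (simp add: M_def)
  have finM: "finite M" using finite_sides[OF fin] by (simp add: M_def)
  define k where "k = P \<times> Q"
  define f where "f = (\<lambda>n. (n \<bullet> k) / (k \<bullet> k))"
  have kk: "k \<bullet> k \<noteq> 0" using PQ by (simp add: k_def)
  have diff: "n = n' + (f n - f n') *\<^sub>R k" if "n \<in> M" "n' \<in> M" for n n'
  proof -
    define d where "d = n - n' - (f n - f n') *\<^sub>R k"
    have P1: "n \<bullet> P = 1" "n' \<bullet> P = 1" using that sides_subset[of V P] normals_inner_P[of _ V P] by (auto simp: M_def)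
    have Q0: "n \<bullet> Q = 0" "n' \<bullet> Q = 0" using that by (auto simp: M_def)
    have kP: "k \<bullet> P = 0" "k \<bullet> Q = 0" by (simp_all add: k_def dot_cross_self inner_commute)
    have "d \<bullet> P = 0" "d \<bullet> Q = 0" using P1 Q0 kP by (simp_all add: d_def inner_diff_left)
    moreover have "d \<bullet> k = 0" using kk by (simp add: d_def inner_diff_left f_def diff_divide_distrib[symmetric])
    moreover have "det3 k P Q \<noteq> 0" using kk by (simp add: k_def)
    ultimately have "d = 0" using orthogonal_basis_imp_0 by blast
    then show ?thesis by (simp add: d_def algebra_simps)
  qed
  have "M \<noteq> {}" using c by auto
  then have "Min (f ` M) \<in> f ` M" "Max (f ` M) \<in> f ` M" using finM by auto
  then obtain n1 n2 where n12: "n1 \<in> M" "n2 \<in> M" "f n1 = Min (f ` M)" "f n2 = Max (f ` M)" by force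
  have "\<not> M \<subseteq> {n1, n2}"
    using c card_mono[of "{n1, n2}" M] by (auto simp: card_insert_if split: if_splits)
  then obtain n where n: "n \<in> M" "n \<noteq> n1" "n \<noteq> n2" by blast
  have "f n1 \<le> f n" "f n \<le> f n2" using n n12 finM by auto
  moreover have "f n1 \<noteq> f n" "f n \<noteq> f n2" using diff[OF n(1) n12(1)] diff[OF n(1) n12(2)] n by auto
  ultimately have lt: "f n1 < f n" "f n < f n2" by auto
  have "n + (f n2 - f n) *\<^sub>R k \<in> normals V P" "n - (f n - f n1) *\<^sub>R k \<in> normals V P"
  proof -
    have "n + (f n2 - f n) *\<^sub>R k = n2" using diff[OF n12(2) n(1)] by simp
    moreover have "n - (f n - f n1) *\<^sub>R k = n1" using diff[OF n12(1) n(1)] by (metis add_uminus_conv_diff minus_diff_eq scaleR_minus_left)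
    ultimately show "n + (f n2 - f n) *\<^sub>R k \<in> normals V P" "n - (f n - f n1) *\<^sub>R k \<in> normals V P"
      using n12(1,2) sides_subset[of V P] by (auto simp: M_def)
  qed
  then have "\<not> n extreme_point_of (convex hull (normals V P))"
    using not_extreme_between[of n "f n2 - f n" k _ "f n - f n1"] lt kk by auto
  then show False using n(1) by (simp add: M_def sides_def)
qed

text \<open>\<open>Q\<close> is the only possible partner of \<open>P\<close> on an ordinary line,
  so by the Kelly--Moser step every three points of the side include \<open>Q\<close>. A fourth
  point would leave three without it. Taking \<open>Q = P\<close> encodes that \<open>P\<close> is
  on no ordinary line; the conclusion then contradicts \<open>n \<bullet> P = 1\<close>.\<close>

lemma nonordinary_side:
  assumes fin: "finite V" and V: "pairwise_indep V" and P: "P \<in> V"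
    and no: "\<And>A. A \<in> V \<Longrightarrow> A \<noteq> Q \<Longrightarrow> \<not> ordinary_pair V P A"
    and n: "n \<in> sides V P" "{X \<in> V. n \<bullet> X = 0} \<notin> ordinary_lines V"
  shows "Q \<in> V \<and> n \<bullet> Q = 0 \<and> card {X \<in> V. n \<bullet> X = 0} = 3"
proof -
  obtain A B C where ABC: "A \<in> V" "B \<in> V" "C \<in> V" "A \<noteq> B" "B \<noteq> C" "C \<noteq> A"
    "n \<bullet> A = 0" "n \<bullet> B = 0" "n \<bullet> C = 0"
    using side_ordinary_or_third[OF V P n] .
  have K: "Q \<in> {x, y, z}"
    if "x \<in> V" "y \<in> V" "z \<in> V" "x \<noteq> y" "y \<noteq> z" "z \<noteq> x" "n \<bullet> x = 0" "n \<bullet> y = 0" "n \<bullet> z = 0" for x y z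
    using side_with_three_points_false[OF V P that(1-6) n(1) that(7-9)] no[of x] no[of y] no[of z] that by blast
  have Q: "Q \<in> V" "n \<bullet> Q = 0" using K[OF ABC] ABC by auto
  have "{X \<in> V. n \<bullet> X = 0} = {A, B, C}"
  proof
    show "{X \<in> V. n \<bullet> X = 0} \<subseteq> {A, B, C}"
    proof
      fix D assume D: "D \<in> {X \<in> V. n \<bullet> X = 0}"
      show "D \<in> {A, B, C}"
      proof (rule ccontr)
        assume "D \<notin> {A, B, C}"
        then show False using K[OF ABC] K[of A B D] K[of B C D] K[of A C D] ABC D by auto
      qed
    qed
  qed (use ABC in auto)
  then show ?thesis using Q ABC by simp
qed

text \<open>A side is recovered from the points on it: two of them together with the normalisation
  at \<open>P\<close> determine the normal.\<close>

lemma card_sides_le_card_attached: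
  assumes fin: "finite V" and V: "pairwise_indep V" and P: "P \<in> V"
  shows "card {n \<in> sides V P. {X \<in> V. n \<bullet> X = 0} \<in> ordinary_lines V}
     \<le> card {l \<in> ordinary_lines V. P \<in> attached V l}"
proof (rule card_inj_on_le)
  show "inj_on (\<lambda>n. {X \<in> V. n \<bullet> X = 0}) {n \<in> sides V P. {X \<in> V. n \<bullet> X = 0} \<in> ordinary_lines V}"
  proof (rule inj_onI)
    fix n n' assume a: "n \<in> {n \<in> sides V P. {X \<in> V. n \<bullet> X = 0} \<in> ordinary_lines V}"
      "n' \<in> {n \<in> sides V P. {X \<in> V. n \<bullet> X = 0} \<in> ordinary_lines V}"
      "{X \<in> V. n \<bullet> X = 0} = {X \<in> V. n' \<bullet> X = 0}"
    then have s: "n \<in> sides V P" "n' \<in> sides V P" by auto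
    have nP: "n \<bullet> P = 1" "n' \<bullet> P = 1" using s sides_subset normals_inner_P by blast+
    obtain A B where AB: "A \<in> V" "B \<in> V" "A \<noteq> B" "n \<bullet> A = 0" "n \<bullet> B = 0"
      using side_two_points[OF V s(1)] .
    then have n': "n' \<bullet> A = 0" "n' \<bullet> B = 0" using a(3) by auto
    have "det3 P A B \<noteq> 0" using det3_neq_0[OF AB(4,5) nP(1)] V AB by (auto simp: pairwise_indep_def)
    then show "n = n'" using normal_unique[OF AB(4,5) nP(1)] normal_unique[OF n' nP(2)] by simp
  qed
  show "(\<lambda>n. {X \<in> V. n \<bullet> X = 0}) ` {n \<in> sides V P. {X \<in> V. n \<bullet> X = 0} \<in> ordinary_lines V}
    \<subseteq> {l \<in> ordinary_lines V. P \<in> attached V l}"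
  proof -
    have "n \<bullet> P = 1" if "n \<in> sides V P" for n using that sides_subset normals_inner_P by blast
    then show ?thesis using P by (auto simp: attached_def)
  qed
  show "finite {l \<in> ordinary_lines V. P \<in> attached V l}" using finite_ordinary_lines[OF fin] by simp
qed

lemma sum_attached_le:
  assumes fin: "finite V" and V: "pairwise_indep V"
  shows "(\<Sum>P\<in>V. card {l \<in> ordinary_lines V. P \<in> attached V l}) \<le> 4 * card (ordinary_lines V)"
proof -
  have "(\<Sum>P\<in>V. card {l \<in> ordinary_lines V. P \<in> attached V l}) = (\<Sum>l\<in>ordinary_lines V. card (attached V l))"
  proof (rule sum_multicount_gen)
    have "{P \<in> V. P \<in> attached V l} = attached V l" for l by (auto simp: attached_def)
    then show "\<forall>l\<in>ordinary_lines V. card {P \<in> V. P \<in> attached V l} = card (attached V l)" by simp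
  qed (use fin finite_ordinary_lines in auto)
  also have "\<dots> \<le> (\<Sum>l\<in>ordinary_lines V. 4)" by (intro sum_mono card_attached_le[OF fin V])
  finally show ?thesis by simp
qed

lemma card_attached_ge_3:
  assumes fin: "finite V" and V: "pairwise_indep V" and P: "P \<in> V"
    and no: "\<And>A. A \<in> V \<Longrightarrow> A \<noteq> Q \<Longrightarrow> \<not> ordinary_pair V P A"
    and AB: "A \<in> V" "B \<in> V" "A \<noteq> Q" "B \<noteq> Q" "det3 P A B \<noteq> 0"
    and ord: "\<And>n. n \<in> sides V P \<Longrightarrow> {X \<in> V. n \<bullet> X = 0} \<in> ordinary_lines V"
  shows "card {l \<in> ordinary_lines V. P \<in> attached V l} \<ge> 3"
proof -
  have "{n \<in> sides V P. {X \<in> V. n \<bullet> X = 0} \<in> ordinary_lines V} = sides V P" using ord by auto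
  then show ?thesis using card_sides_le_card_attached[OF fin V P] card_sides_ge_3[OF fin V P AB(1,2,5)] no AB
    by fastforce
qed

text \<open>Of at least three sides at most two pass through \<open>Q\<close>, and a side that
  avoids \<open>Q\<close> is ordinary.\<close>

lemma card_attached_ge_1:
  assumes fin: "finite V" and V: "pairwise_indep V" and P: "P \<in> V"
    and Q: "Q \<in> V" "Q \<noteq> P"
    and no: "\<And>A. A \<in> V \<Longrightarrow> A \<noteq> Q \<Longrightarrow> \<not> ordinary_pair V P A"
    and AB: "A \<in> V" "B \<in> V" "A \<noteq> Q" "B \<noteq> Q" "det3 P A B \<noteq> 0"
  shows "card {l \<in> ordinary_lines V. P \<in> attached V l} \<ge> 1"
proof -
  have "P \<times> Q \<noteq> 0" using V P Q by (auto simp: pairwise_indep_def)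
  then have "card {n \<in> sides V P. n \<bullet> Q = 0} \<le> 2" by (rule card_sides_through_le_2[OF fin])
  moreover have "sides V P \<subseteq> {n \<in> sides V P. n \<bullet> Q = 0} \<union> {n \<in> sides V P. {X \<in> V. n \<bullet> X = 0} \<in> ordinary_lines V}"
    using nonordinary_side[OF fin V P no] by blast
  then have "card (sides V P) \<le> card {n \<in> sides V P. n \<bullet> Q = 0} + card {n \<in> sides V P. {X \<in> V. n \<bullet> X = 0} \<in> ordinary_lines V}"
    using finite_sides[OF fin, of P] by (intro order_trans[OF card_mono card_Un_le]) auto
  moreover have "card (sides V P) \<ge> 3" using card_sides_ge_3[OF fin V P AB(1,2,5)] no AB by auto
  ultimately show ?thesis using card_sides_le_card_attached[OF fin V P] by linarith
qed

text \<open>Sylvester--Gallai with one forbidden point, placed at infinity in the vertical direction.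
  The pair minimising the vertical distance leaves only one tie: a vertical pair \<open>P\<close>, \<open>A\<close> such
  that every other connecting line through \<open>P\<close> or \<open>A\<close> has exactly one further point on each
  side. Comparing sums of slopes on the two sides excludes it.\<close>

definition vdist :: "real \<times> real \<Rightarrow> real \<times> real \<Rightarrow> real \<times> real \<Rightarrow> real" where
  "vdist P A B = snd P - snd A - (snd B - snd A) / (fst B - fst A) * (fst P - fst A)"

lemma vdist_eq_0_iff:
  assumes "fst A \<noteq> fst B"
  shows "vdist P A B = 0 \<longleftrightarrow>
    (fst B - fst A) * (snd P - snd A) = (snd B - snd A) * (fst P - fst A)"
  using assms by (simp add: vdist_def field_simps)

lemma ordinary_nonvertical_line:
  fixes W :: "(real \<times> real) set"
  assumes fin: "finite W" and A0: "A0 \<in> W" "B0 \<in> W" "fst A0 \<noteq> fst B0" "P0 \<in> W" "vdist P0 A0 B0 \<noteq> 0"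
  obtains A B where "A \<in> W" "B \<in> W" "fst A \<noteq> fst B"
    "\<And>C. C \<in> W \<Longrightarrow> vdist C A B = 0 \<Longrightarrow> C = A \<or> C = B"
proof (rule ccontr)
  note wit = that
  assume neg: "\<not> thesis"
  have third: "\<exists>C\<in>W. vdist C A B = 0 \<and> C \<noteq> A \<and> C \<noteq> B" if "A \<in> W" "B \<in> W" "fst A \<noteq> fst B" for A B
    using that neg wit by blast
  define T where "T = {(P, A, B). P \<in> W \<and> A \<in> W \<and> B \<in> W \<and> fst A \<noteq> fst B \<and> vdist P A B \<noteq> 0}"
  have finT: "finite T"
    by (rule finite_subset[of _ "Sigma W (\<lambda>_. Sigma W (\<lambda>_. W))"]) (auto simp: T_def fin)
  have "(P0, A0, B0) \<in> T" using A0 by (auto simp: T_def)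
  then have neT: "T \<noteq> {}" by blast
  define d where "d = Min ((\<lambda>(P, A, B). \<bar>vdist P A B\<bar>) ` T)"
  have dmin: "d \<le> \<bar>vdist P A B\<bar>" if "P \<in> W" "A \<in> W" "B \<in> W" "fst A \<noteq> fst B" "vdist P A B \<noteq> 0" for P A B
  proof -
    have "(P, A, B) \<in> T" using that by (auto simp: T_def)
    then have "(\<lambda>(P, A, B). \<bar>vdist P A B\<bar>) (P, A, B) \<in> (\<lambda>(P, A, B). \<bar>vdist P A B\<bar>) ` T" by (rule imageI)
    then show ?thesis unfolding d_def using finT by (intro Min_le) auto
  qed
  have "d \<in> (\<lambda>(P, A, B). \<bar>vdist P A B\<bar>) ` T" unfolding d_def using finT neT by (intro Min_in) auto
  then obtain P1 A1 B1 where m1: "P1 \<in> W" "A1 \<in> W" "B1 \<in> W" "fst A1 \<noteq> fst B1" "vdist P1 A1 B1 \<noteq> 0"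
    "\<bar>vdist P1 A1 B1\<bar> = d" by (auto simp: T_def)
  \<comment> \<open>A point \<open>A\<close> of a minimal line is at vertical distance \<open>d |a - b| / |b|\<close> from the line \<open>PB\<close>.\<close>
  have gap: "\<bar>fst X - fst Y\<bar> \<ge> \<bar>fst Y - fst P\<bar>"
    if h: "P \<in> W" "A \<in> W" "B \<in> W" "fst A \<noteq> fst B" "vdist P A B \<noteq> 0" "\<bar>vdist P A B\<bar> = d"
      and XY: "X \<in> W" "Y \<in> W" "vdist X A B = 0" "vdist Y A B = 0" "X \<noteq> Y" "fst Y \<noteq> fst P" for P A B X Y
  proof -
    define s where "s = (snd B - snd A) / (fst B - fst A)"
    define v where "v = vdist P A B"
    have P: "snd P = snd A + s * (fst P - fst A) + v" by (simp add: vdist_def s_def v_def)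
    have X: "snd X = snd A + s * (fst X - fst A)" using XY(3) by (simp add: vdist_def s_def)
    have Y: "snd Y = snd A + s * (fst Y - fst A)" using XY(4) by (simp add: vdist_def s_def)
    have ne: "fst X \<noteq> fst Y" using X Y XY(5) by (auto simp: prod_eq_iff)
    have *: "vdist X P Y = v * (fst X - fst Y) / (fst Y - fst P)"
      using XY(6) unfolding vdist_def P X Y by (simp add: field_simps)
    then have "vdist X P Y \<noteq> 0" using ne h(5) XY(6) by (simp add: v_def)
    then have "d \<le> \<bar>vdist X P Y\<bar>" using dmin[of X P Y] XY h by auto
    then have "d \<le> d * \<bar>fst X - fst Y\<bar> / \<bar>fst Y - fst P\<bar>" using h(6) by (simp add: * abs_mult v_def)
    moreover have "d > 0" using h(5,6) by auto
    ultimately show ?thesis using XY(6) by (simp add: field_simps)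
  qed
  have line_inj: "X = Y" if "vdist X A B = 0" "vdist Y A B = 0" "fst X = fst Y" for X Y A B :: "real \<times> real"
    using that by (auto simp: vdist_def prod_eq_iff)
  \<comment> \<open>For two points on the same side of \<open>P\<close>, the larger horizontal
    distance to \<open>P\<close> exceeds their mutual distance, contrary to
    \<open>gap\<close>.\<close>
  have sidesgn: "X = Y"
    if h: "P \<in> W" "A \<in> W" "B \<in> W" "fst A \<noteq> fst B" "vdist P A B \<noteq> 0" "\<bar>vdist P A B\<bar> = d"
      and XY: "X \<in> W" "Y \<in> W" "vdist X A B = 0" "vdist Y A B = 0" "(fst X - fst P) * (fst Y - fst P) > 0" for P A B X Y
  proof (rule ccontr)
    assume "X \<noteq> Y"
    moreover then have "fst X \<noteq> fst Y" using line_inj XY by blast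
    moreover have "fst X \<noteq> fst P" "fst Y \<noteq> fst P" using XY(5) by auto
    ultimately show False
      using gap[OF h XY(1-4)] gap[OF h XY(2,1,4,3)] XY(5) by (auto simp: zero_less_mult_iff abs_if split: if_splits)
  qed
  \<comment> \<open>Three points of a minimal line have distinct abscissas and at most one of them
    lies strictly on each side of \<open>P\<close>. Hence one is on the vertical through
    \<open>P\<close> and one on either side.\<close>
  have three: "\<exists>F\<in>W. fst F = fst P \<and> vdist F A B = 0"
    and left: "\<exists>X\<in>W. fst X < fst P \<and> vdist X A B = 0"
    and right: "\<exists>X\<in>W. fst X > fst P \<and> vdist X A B = 0"
    if h: "P \<in> W" "A \<in> W" "B \<in> W" "fst A \<noteq> fst B" "vdist P A B \<noteq> 0" "\<bar>vdist P A B\<bar> = d" for P A B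
  proof -
    obtain C where C: "C \<in> W" "vdist C A B = 0" "C \<noteq> A" "C \<noteq> B" using third h by blast
    have AB: "vdist A A B = 0" "vdist B A B = 0" using h(4) by (auto simp: vdist_def)
    have ne: "fst A \<noteq> fst B" "fst C \<noteq> fst A" "fst C \<noteq> fst B" using h(4) line_inj C AB by blast+
    have "\<not> (fst A - fst P) * (fst B - fst P) > 0" using sidesgn[OF h h(2,3) AB] h(4) by auto
    moreover have "\<not> (fst A - fst P) * (fst C - fst P) > 0" using sidesgn[OF h h(2) C(1) AB(1) C(2)] C by auto
    moreover have "\<not> (fst B - fst P) * (fst C - fst P) > 0" using sidesgn[OF h h(3) C(1) AB(2) C(2)] C by auto
    ultimately have "\<exists>F\<in>{A,B,C}. fst F = fst P" "\<exists>F\<in>{A,B,C}. fst F < fst P" "\<exists>F\<in>{A,B,C}. fst F > fst P"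
      using ne by (auto simp: zero_less_mult_iff not_less)
    then show "\<exists>F\<in>W. fst F = fst P \<and> vdist F A B = 0"
      "\<exists>X\<in>W. fst X < fst P \<and> vdist X A B = 0" "\<exists>X\<in>W. fst X > fst P \<and> vdist X A B = 0"
      using h C AB by blast+
  qed
  obtain F1 where F1: "F1 \<in> W" "fst F1 = fst P1" "vdist F1 A1 B1 = 0" using three[OF m1] by blast
  have hd: "\<bar>snd P1 - snd F1\<bar> = d" "snd P1 \<noteq> snd F1"
    using m1(5,6) F1(2,3) by (auto simp: vdist_def)
  define R where "R = {X \<in> W. fst X > fst P1}"
  define L where "L = {X \<in> W. fst X < fst P1}"
  have RL: "finite R" "finite L" using fin by (auto simp: R_def L_def)
  have Rne: "R \<noteq> {}" using right[OF m1] by (auto simp: R_def)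
  define slope where "slope = (\<lambda>(F :: real \<times> real) (X :: real \<times> real). (snd X - snd F) / (fst X - fst P1))"
  \<comment> \<open>When \<open>F\<close> and \<open>G\<close> on the vertical are at distance
    \<open>d\<close>, every line from \<open>F\<close> to a point off the vertical is minimal for
    \<open>G\<close>. It has exactly one point of \<open>W\<close> on each side, so both sides
    produce the same set of slopes at \<open>F\<close>.\<close>
  have slope_sum: "sum (slope F) R = sum (slope F) L"
    if F: "F \<in> W" "G \<in> W" "fst F = fst P1" "fst G = fst P1" "\<bar>snd G - snd F\<bar> = d" "snd G \<noteq> snd F" for F G
  proof -
    have h: "G \<in> W" "F \<in> W" "X \<in> W" "fst F \<noteq> fst X" "vdist G F X \<noteq> 0" "\<bar>vdist G F X\<bar> = d"
      if "X \<in> W" "fst X \<noteq> fst P1" for X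
      using that F by (auto simp: vdist_def)
    have on: "vdist Y F X = 0 \<longleftrightarrow> slope F Y = slope F X" if "fst X \<noteq> fst P1" "fst Y \<noteq> fst P1" for X Y
      using that F(3) by (auto simp: vdist_def slope_def field_simps)
    have self: "vdist X F X = 0" if "fst X \<noteq> fst P1" for X using that F(3) by (simp add: vdist_def)
    have inj: "X = Y" if "X \<in> W" "Y \<in> W" "(fst X - fst P1) * (fst Y - fst P1) > 0" "slope F X = slope F Y" for X Y
    proof -
      have ne: "fst X \<noteq> fst P1" "fst Y \<noteq> fst P1" using that(3) by auto
      show ?thesis using sidesgn[OF h[OF that(1) ne(1)] that(1,2) self[OF ne(1)]] on[OF ne] that F(4) by simp
    qed
    have iR: "inj_on (slope F) R" "inj_on (slope F) L"
      unfolding inj_on_def using inj by (simp_all add: R_def L_def mult_neg_neg)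
    have "slope F ` R = slope F ` L"
    proof (intro equalityI image_subsetI)
      fix X assume X: "X \<in> R"
      then have X': "X \<in> W" "fst X \<noteq> fst P1" by (auto simp: R_def)
      obtain Y where Y: "Y \<in> W" "fst Y < fst P1" "vdist Y F X = 0" using left[OF h[OF X']] F by auto
      then show "slope F X \<in> slope F ` L" using on[OF X'(2), of Y] by (intro image_eqI[of _ _ Y]) (simp_all add: L_def)
    next
      fix X assume X: "X \<in> L"
      then have X': "X \<in> W" "fst X \<noteq> fst P1" by (auto simp: L_def)
      obtain Y where Y: "Y \<in> W" "fst Y > fst P1" "vdist Y F X = 0" using right[OF h[OF X']] F by auto
      then show "slope F X \<in> slope F ` R" using on[OF X'(2), of Y] by (intro image_eqI[of _ _ Y]) (simp_all add: R_def)
    qed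
    then have "sum (\<lambda>x. x) (slope F ` R) = sum (\<lambda>x. x) (slope F ` L)" by simp
    then show ?thesis using iR by (simp add: sum.reindex)
  qed
  have e1: "sum (slope P1) R = sum (slope P1) L"
    using slope_sum[OF m1(1) F1(1) refl F1(2)] hd by (simp add: abs_minus_commute)
  have e2: "sum (slope F1) R = sum (slope F1) L"
    using slope_sum[OF F1(1) m1(1) F1(2) refl] hd by simp
  define k where "k = snd P1 - snd F1"
  \<comment> \<open>Moving the centre from \<open>P1\<close> to \<open>F1\<close> changes a slope by
    \<open>k\<close> over the signed horizontal displacement. So the sums of the reciprocal
    displacements agree on the two sides, although the right one is positive and the left one is
    not.\<close>
  have sd: "slope F1 X - slope P1 X = k * (1 / (fst X - fst P1))" for X
    by (simp add: slope_def k_def diff_divide_distrib)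
  have "k * (\<Sum>X\<in>R. 1 / (fst X - fst P1)) = k * (\<Sum>X\<in>L. 1 / (fst X - fst P1))"
    using e1 e2 unfolding sum_distrib_left sd[symmetric] by (simp add: sum_subtractf)
  then have "(\<Sum>X\<in>R. 1 / (fst X - fst P1)) = (\<Sum>X\<in>L. 1 / (fst X - fst P1))"
    using hd by (simp add: k_def)
  moreover have "(\<Sum>X\<in>R. 1 / (fst X - fst P1)) > 0"
    using Rne RL by (intro sum_pos) (auto simp: R_def)
  moreover have "(\<Sum>X\<in>L. 1 / (fst X - fst P1)) \<le> 0"
    by (intro sum_nonpos) (auto simp: L_def)
  ultimately show False by linarith
qed

section \<open>Conics through three points\<close>

definition tri :: "real \<times> real \<Rightarrow> real \<times> real \<Rightarrow> real \<times> real \<Rightarrow> real" where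
  "tri p q r = (fst q - fst p) * (snd r - snd p) - (snd q - snd p) * (fst r - fst p)"

lemma tri_same [simp]: "tri p p q = 0" "tri p q p = 0" "tri p q q = 0"
  by (simp_all add: tri_def)

lemma tri_permute_0:
  "tri q p r = 0 \<longleftrightarrow> tri p q r = 0" "tri p r q = 0 \<longleftrightarrow> tri p q r = 0" "tri q r p = 0 \<longleftrightarrow> tri p q r = 0"
  "tri r p q = 0 \<longleftrightarrow> tri p q r = 0" "tri r q p = 0 \<longleftrightarrow> tri p q r = 0"
  by (simp_all add: tri_def algebra_simps)
     (auto simp: algebra_simps)

lemma tri_eq_0_imp_on_line:
  assumes "a \<noteq> b" "tri a b z = 0"
  obtains t where "z = (fst a + t * (fst b - fst a), snd a + t * (snd b - snd a))"
proof (cases "fst a = fst b")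
  case True
  then have "snd b \<noteq> snd a" using assms(1) by (auto simp: prod_eq_iff)
  then show ?thesis using that[of "(snd z - snd a) / (snd b - snd a)"] assms(2) True
    by (auto simp: prod_eq_iff tri_def)
next
  case False
  then show ?thesis using that[of "(fst z - fst a) / (fst b - fst a)"] assms(2)
    by (auto simp: prod_eq_iff tri_def field_simps)
qed

lemma tri_on_line: "tri a (fst b + s * (fst c - fst b), snd b + s * (snd c - snd b)) d
   = (1 - s) * tri a b d + s * tri a c d"
  by (simp add: tri_def algebra_simps)

lemma tri_trans:
  assumes "s \<noteq> t" "tri s t a = 0" "tri s t b = 0"
  shows "tri s a b = 0"
proof -
  obtain u where a: "a = (fst s + u * (fst t - fst s), snd s + u * (snd t - snd s))"
    using tri_eq_0_imp_on_line[OF assms(1,2)] .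
  show ?thesis unfolding a tri_on_line using assms(3) by simp
qed

lemma tri_trans':
  assumes "s \<noteq> t" "tri s t a = 0" "tri s t b = 0" "tri s t c = 0"
  shows "tri a b c = 0"
proof (cases "a = s")
  case True then show ?thesis using tri_trans assms by blast
next
  case False
  have "tri s a b = 0" "tri s a c = 0" using tri_trans assms by blast+
  then have "tri a s b = 0" "tri a s c = 0" by (simp_all add: tri_permute_0)
  then show ?thesis using tri_trans False by blast
qed

definition lft :: "real \<times> real \<Rightarrow> real^3" where
  "lft X = vector [fst X, snd X, 1]"

lemma det3_lft: "det3 (lft p) (lft q) (lft r) = tri p q r"
  by (simp add: lft_def tri_def cross3_def inner_vec_def sum_3 algebra_simps)

lemma lft_indep: "p \<noteq> q \<Longrightarrow> lft p \<times> lft q \<noteq> 0"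
  by (auto simp: lft_def cross3_def vec_eq_iff forall_3 prod_eq_iff)

lemma inj_lft: "inj lft"
  by (auto simp: inj_on_def lft_def vec_eq_iff forall_3 prod_eq_iff)

lemma lft_eq_iff [simp]: "lft p = lft q \<longleftrightarrow> p = q"
  by (metis inj_lft injD)

text \<open>The quadratic Cremona transformation based at \<open>p\<close>, \<open>q\<close>, \<open>r\<close>, in barycentric coordinates. It
  turns the conics through the three base points into lines, and contracts the side opposite to a
  base point to a coordinate axis.\<close>

definition tau :: "real \<times> real \<Rightarrow> real \<times> real \<Rightarrow> real \<times> real \<Rightarrow> real \<times> real \<Rightarrow> real^3" where
  "tau p q r X = vector [tri p X r * tri p q X, tri X q r * tri p q X, tri X q r * tri p X r]"

lemma tau_nth [simp]:
  "tau p q r X $ 1 = tri p X r * tri p q X" "tau p q r X $ 2 = tri X q r * tri p q X"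
  "tau p q r X $ 3 = tri X q r * tri p X r"
  by (simp_all add: tau_def)

lemma inner_tau: "w \<bullet> tau p q r X = w$1 * (tri p X r * tri p q X) + w$2 * (tri X q r * tri p q X)
   + w$3 * (tri X q r * tri p X r)"
  by (simp add: inner_vec_def sum_3)

lemma tau_vertex [simp]: "tau p q r p = 0" "tau p q r q = 0" "tau p q r r = 0"
  by (simp_all add: vec_eq_iff forall_3)

text \<open>The three areas are barycentric coordinates of \<open>X\<close>, not normalised: their
  sum is \<open>tri p q r\<close>.\<close>

lemma bary:
  "tri X q r + tri p X r + tri p q X = tri p q r"
  "tri X q r * fst p + tri p X r * fst q + tri p q X * fst r = tri p q r * fst X"
  "tri X q r * snd p + tri p X r * snd q + tri p q X * snd r = tri p q r * snd X"
  by (simp_all add: tri_def algebra_simps)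

lemma bary_inj:
  assumes "tri p q r \<noteq> 0" "tri X q r = tri Y q r" "tri p X r = tri p Y r" "tri p q X = tri p q Y"
  shows "X = Y"
proof -
  have "tri p q r * fst X = tri p q r * fst Y" "tri p q r * snd X = tri p q r * snd Y"
    using bary(2)[of X q r p] bary(2)[of Y q r p] bary(3)[of X q r p] bary(3)[of Y q r p] assms by simp_all
  then show ?thesis using assms(1) by (simp add: prod_eq_iff)
qed

lemma bary_vertex:
  assumes "tri p q r \<noteq> 0"
  shows "tri p X r = 0 \<Longrightarrow> tri p q X = 0 \<Longrightarrow> X = p"
    "tri X q r = 0 \<Longrightarrow> tri p q X = 0 \<Longrightarrow> X = q"
    "tri X q r = 0 \<Longrightarrow> tri p X r = 0 \<Longrightarrow> X = r"
  using bary(1)[of X q r p] bary_inj[OF assms, of X p] bary_inj[OF assms, of X q] bary_inj[OF assms, of X r]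
  by auto

lemma tau_eq_0:
  assumes "tri p q r \<noteq> 0" "tau p q r X = 0"
  shows "X \<in> {p, q, r}"
proof -
  have "tri p X r * tri p q X = 0" "tri X q r * tri p q X = 0" "tri X q r * tri p X r = 0"
    using assms(2) tau_nth[of p q r X] by simp_all
  then show ?thesis using bary_vertex[OF assms(1), of X] by auto
qed

text \<open>Off the sides the transformation inverts the barycentric coordinates up to a common
  factor. Parallel images therefore come from proportional coordinates, and the fixed sum makes
  these equal.\<close>

lemma tau_inj:
  assumes D: "tri p q r \<noteq> 0" and X: "tri X q r \<noteq> 0" "tri p X r \<noteq> 0" "tri p q X \<noteq> 0"
    and Y: "tri Y q r \<noteq> 0" "tri p Y r \<noteq> 0" "tri p q Y \<noteq> 0"
    and par: "tau p q r X \<times> tau p q r Y = 0"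
  shows "X = Y"
proof -
  let ?a = "tri X q r" and ?b = "tri p X r" and ?c = "tri p q X"
  let ?a' = "tri Y q r" and ?b' = "tri p Y r" and ?c' = "tri p q Y"
  have 1: "(?a * ?c) * (?a' * ?b') = (?a' * ?c') * (?a * ?b)"
    using arg_cong[OF par, of "\<lambda>v. v$1"] by (simp add: cross_components)
  have 2: "(?a * ?b) * (?b' * ?c') = (?a' * ?b') * (?b * ?c)"
    using arg_cong[OF par, of "\<lambda>v. v$2"] by (simp add: cross_components)
  have bc: "?c * ?b' = ?c' * ?b" using 1 X Y by (simp add: mult.commute mult.left_commute)
  have ac: "?a * ?c' = ?a' * ?c" using 2 X Y by (simp add: mult.commute mult.left_commute)
  have "?c' * tri p q r = ?c' * (?a + ?b + ?c)" by (simp only: bary)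
  also have "\<dots> = ?c * (?a' + ?b' + ?c')" using bc ac by (simp add: algebra_simps)
  also have "\<dots> = ?c * tri p q r" by (simp only: bary)
  finally have c: "?c = ?c'" using D by simp
  then have "?b = ?b'" "?a = ?a'" using bc ac Y by auto
  then show ?thesis using bary_inj[OF D] c by blast
qed

text \<open>\<open>B\<close> is twice the polar form of \<open>Q\<close>. When \<open>Q\<close> is
  expanded in barycentric coordinates, the squares carry its values at \<open>p\<close>,
  \<open>q\<close>, \<open>r\<close>, which vanish; the mixed products are the coordinates of
  \<open>tau\<close>.\<close>

lemma conic_through_three_points:
  assumes D: "tri p q r \<noteq> 0" and C: "is_conic C" "p \<in> C" "q \<in> C" "r \<in> C"
  obtains w where "w \<noteq> 0" "C = {X. w \<bullet> tau p q r X = 0}"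
proof -
  obtain a b c d e f where abc: "\<not> (a = 0 \<and> b = 0 \<and> c = 0)"
    and C': "C = {(x, y). a * x\<^sup>2 + b * x * y + c * y\<^sup>2 + d * x + e * y + f = 0}"
    using C(1) unfolding is_conic_def by blast
  define B where "B = (\<lambda>X Y :: real \<times> real. 2 * a * fst X * fst Y + b * (fst X * snd Y + fst Y * snd X)
     + 2 * c * snd X * snd Y + d * (fst X + fst Y) + e * (snd X + snd Y) + 2 * f)"
  define Q where "Q = (\<lambda>X. a * (fst X)\<^sup>2 + b * fst X * snd X + c * (snd X)\<^sup>2 + d * fst X + e * snd X + f)"
  have CQ: "C = {X. Q X = 0}" by (auto simp: C' Q_def)
  define w :: "real^3" where "w = vector [B q r, B p r, B p q]"
  have 0: "Q p = 0" "Q q = 0" "Q r = 0" using C(2-4) by (auto simp: CQ)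
  have main: "(tri p q r)\<^sup>2 * Q X = w \<bullet> tau p q r X" for X
  proof -
    define \<alpha> \<beta> \<gamma> where abg: "\<alpha> = tri X q r" "\<beta> = tri p X r" "\<gamma> = tri p q X"
    have D1: "tri p q r = \<alpha> + \<beta> + \<gamma>" unfolding abg by (simp only: bary)
    have D2: "tri p q r * fst X = \<alpha> * fst p + \<beta> * fst q + \<gamma> * fst r"
      unfolding abg by (simp only: bary)
    have D3: "tri p q r * snd X = \<alpha> * snd p + \<beta> * snd q + \<gamma> * snd r"
      unfolding abg by (simp only: bary)
    have "(tri p q r)\<^sup>2 * Q X = a * (tri p q r * fst X)\<^sup>2 + b * (tri p q r * fst X) * (tri p q r * snd X)
        + c * (tri p q r * snd X)\<^sup>2 + d * tri p q r * (tri p q r * fst X)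
        + e * tri p q r * (tri p q r * snd X) + f * (tri p q r)\<^sup>2"
      by (simp add: Q_def algebra_simps power2_eq_square)
    also have "\<dots> = \<alpha>\<^sup>2 * Q p + \<beta>\<^sup>2 * Q q + \<gamma>\<^sup>2 * Q r + \<beta> * \<gamma> * B q r + \<alpha> * \<gamma> * B p r + \<alpha> * \<beta> * B p q"
      unfolding D2 D3 unfolding D1 by (simp add: Q_def B_def algebra_simps power2_eq_square)
    finally show ?thesis using 0 by (simp add: w_def inner_tau abg algebra_simps)
  qed
  have "w \<noteq> 0"
  proof
    assume "w = 0"
    then have Q0: "Q X = 0" for X using main[of X] D by simp
    have "a = 0" "c = 0" "b = 0"
      using Q0[of "(0,0)"] Q0[of "(1,0)"] Q0[of "(-1,0)"] Q0[of "(0,1)"] Q0[of "(0,-1)"] Q0[of "(1,1)"]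
      by (auto simp: Q_def)
    then show False using abc by simp
  qed
  moreover have "C = {X. w \<bullet> tau p q r X = 0}"
    unfolding CQ main[symmetric] using D by simp
  ultimately show ?thesis by (rule that)
qed

lemma is_conic_product_form:
  assumes nz: "\<not> (a * a' = 0 \<and> a * b' + b * a' = 0 \<and> b * b' = 0)"
  shows "is_conic {X. (a * fst X + b * snd X + c) * (a' * fst X + b' * snd X + c') = (0::real)}"
  unfolding is_conic_def
proof (intro exI conjI)
  show "\<not> (a * a' = 0 \<and> a * b' + b * a' = 0 \<and> b * b' = 0)" by fact
  show "{X. (a * fst X + b * snd X + c) * (a' * fst X + b' * snd X + c') = 0} =
    {(x, y). (a * a') * x\<^sup>2 + (a * b' + b * a') * x * y + (b * b') * y\<^sup>2 + (a * c' + c * a') * x + (b * c' + c * b') * y + c * c' = 0}"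
    by (auto simp: algebra_simps power2_eq_square)
qed

text \<open>The two lines may coincide. A double line is thus a conic, and a set on no conic is not
  collinear.\<close>

lemma is_conic_two_lines:
  assumes "a \<noteq> b" "c \<noteq> d"
  shows "is_conic {X. tri a b X = 0 \<or> tri c d X = 0}"
proof -
  have l: "tri a b X = (snd a - snd b) * fst X + (fst b - fst a) * snd X + (fst a * snd b - snd a * fst b)" for a b X
    by (simp add: tri_def algebra_simps)
  have eq: "{X. tri a b X = 0 \<or> tri c d X = 0} = {X. tri a b X * tri c d X = 0}" by auto
  show ?thesis unfolding eq unfolding l
    by (rule is_conic_product_form) (use assms in \<open>auto simp: prod_eq_iff\<close>)
qed

text \<open>If the quadratic part vanished, the remaining affine form would vanish at the
  noncollinear points \<open>p\<close>, \<open>q\<close>, \<open>r\<close>, hence identically.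
  Evaluating at the midpoints of the three sides would then give \<open>w = 0\<close>.\<close>

lemma is_conic_tau:
  assumes D: "tri p q r \<noteq> 0" and w: "w \<noteq> 0"
  shows "is_conic {X. w \<bullet> tau p q r X = 0}"
proof -
  define a1 a2 a3 where A': "a1 = snd q - snd r" "a2 = fst r - fst q" "a3 = fst q * snd r - snd q * fst r"
  define b1 b2 b3 where B': "b1 = snd r - snd p" "b2 = fst p - fst r" "b3 = fst r * snd p - snd r * fst p"
  define g1 g2 g3 where G': "g1 = snd p - snd q" "g2 = fst q - fst p" "g3 = fst p * snd q - snd p * fst q"
  have A: "tri X q r = a1 * fst X + a2 * snd X + a3" for X
    by (simp add: A' tri_def algebra_simps)
  have B: "tri p X r = b1 * fst X + b2 * snd X + b3" for X
    by (simp add: B' tri_def algebra_simps)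
  have G: "tri p q X = g1 * fst X + g2 * snd X + g3" for X
    by (simp add: G' tri_def algebra_simps)
  define a where "a = w$1 * b1 * g1 + w$2 * a1 * g1 + w$3 * a1 * b1"
  define b where "b = w$1 * (b1 * g2 + b2 * g1) + w$2 * (a1 * g2 + a2 * g1) + w$3 * (a1 * b2 + a2 * b1)"
  define c where "c = w$1 * b2 * g2 + w$2 * a2 * g2 + w$3 * a2 * b2"
  define d where "d = w$1 * (b1 * g3 + b3 * g1) + w$2 * (a1 * g3 + a3 * g1) + w$3 * (a1 * b3 + a3 * b1)"
  define e where "e = w$1 * (b2 * g3 + b3 * g2) + w$2 * (a2 * g3 + a3 * g2) + w$3 * (a2 * b3 + a3 * b2)"
  define f where "f = w$1 * b3 * g3 + w$2 * a3 * g3 + w$3 * a3 * b3"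
  have Q: "w \<bullet> tau p q r X = a * (fst X)\<^sup>2 + b * fst X * snd X + c * (snd X)\<^sup>2 + d * fst X + e * snd X + f" for X
    unfolding inner_tau A B G a_def b_def c_def d_def e_def f_def by algebra
  have "\<not> (a = 0 \<and> b = 0 \<and> c = 0)"
  proof
    assume z: "a = 0 \<and> b = 0 \<and> c = 0"
    have Q': "w \<bullet> tau p q r X = d * fst X + e * snd X + f" for X using z Q[of X] by simp
    have v: "d * fst p + e * snd p + f = 0" "d * fst q + e * snd q + f = 0" "d * fst r + e * snd r + f = 0"
      unfolding Q'[symmetric] by simp_all
    have v': "d * (fst q - fst p) + e * (snd q - snd p) = 0" "d * (fst r - fst p) + e * (snd r - snd p) = 0"
      using v by (simp_all add: algebra_simps)
    have "d * tri p q r = (d * (fst q - fst p) + e * (snd q - snd p)) * (snd r - snd p)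
        - (d * (fst r - fst p) + e * (snd r - snd p)) * (snd q - snd p)"
      "e * tri p q r = (d * (fst r - fst p) + e * (snd r - snd p)) * (fst q - fst p)
        - (d * (fst q - fst p) + e * (snd q - snd p)) * (fst r - fst p)"
      by (simp_all add: tri_def algebra_simps)
    then have "d * tri p q r = 0" "e * tri p q r = 0" unfolding v' by simp_all
    then have "d = 0" "e = 0" using D by simp_all
    then have Q0: "w \<bullet> tau p q r X = 0" for X using v(1) Q'[of X] by simp
    have mid: "tri ((fst q + fst r) / 2, (snd q + snd r) / 2) q r = 0" "tri p ((fst q + fst r) / 2, (snd q + snd r) / 2) r = tri p q r / 2"
      "tri p q ((fst q + fst r) / 2, (snd q + snd r) / 2) = tri p q r / 2"
      "tri ((fst p + fst r) / 2, (snd p + snd r) / 2) q r = tri p q r / 2" "tri p ((fst p + fst r) / 2, (snd p + snd r) / 2) r = 0"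
      "tri p q ((fst p + fst r) / 2, (snd p + snd r) / 2) = tri p q r / 2"
      "tri ((fst q + fst p) / 2, (snd q + snd p) / 2) q r = tri p q r / 2" "tri p ((fst q + fst p) / 2, (snd q + snd p) / 2) r = tri p q r / 2"
      "tri p q ((fst q + fst p) / 2, (snd q + snd p) / 2) = 0"
      by (simp_all add: tri_def field_simps)
    have "w$1 = 0" using Q0[of "((fst q + fst r) / 2, (snd q + snd r) / 2)"] D unfolding inner_tau mid by simp
    moreover have "w$2 = 0" using Q0[of "((fst p + fst r) / 2, (snd p + snd r) / 2)"] D unfolding inner_tau mid by simp
    moreover have "w$3 = 0" using Q0[of "((fst q + fst p) / 2, (snd q + snd p) / 2)"] D unfolding inner_tau mid by simp
    ultimately show False using w by (simp add: vec_eq_iff forall_3)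
  qed
  moreover have "{X. w \<bullet> tau p q r X = 0} = {(x, y). a * x\<^sup>2 + b * x * y + c * y\<^sup>2 + d * x + e * y + f = 0}"
    by (auto simp: Q)
  ultimately show ?thesis unfolding is_conic_def by blast
qed

section \<open>Criteria for ordinary conics\<close>

lemma orthogonal_imp_parallel_cross:
  assumes "w \<bullet> a = 0" "w \<bullet> b = 0" "a \<times> b \<noteq> 0"
  obtains k where "w = k *\<^sub>R (a \<times> b)"
proof -
  define m where "m = a \<times> b"
  have "w \<times> m = 0" unfolding m_def using Lagrange[of w a b] assms by simp
  then have "m \<times> (w \<times> m) = 0" by simp
  then have *: "(m \<bullet> m) *\<^sub>R w = (m \<bullet> w) *\<^sub>R m" using Lagrange[of m w m] by simp
  have "m \<bullet> m \<noteq> 0" using assms by (simp add: m_def)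
  then have "w = ((m \<bullet> w) / (m \<bullet> m)) *\<^sub>R m"
    using arg_cong[OF *, of "\<lambda>v. (1 / (m \<bullet> m)) *\<^sub>R v"] by simp
  then show ?thesis using that unfolding m_def by blast
qed

text \<open>Conics through \<open>p\<close>, \<open>q\<close>, \<open>r\<close> are lines of the
  image, and only one line joins two independent image points. Uniqueness is thereby settled, and
  only other points of \<open>S\<close> on the conic have to be excluded.\<close>

lemma ordinary_conicI:
  assumes D: "tri p q r \<noteq> 0" and S: "{p, q, r, x, y} \<subseteq> S" and dist: "card {p, q, r, x, y} = 5"
    and w: "tau p q r x \<times> tau p q r y \<noteq> 0"
    and only: "\<And>z. z \<in> S \<Longrightarrow> (tau p q r x \<times> tau p q r y) \<bullet> tau p q r z = 0 \<Longrightarrow> z \<in> {p, q, r, x, y}"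
  defines "C \<equiv> {X. (tau p q r x \<times> tau p q r y) \<bullet> tau p q r X = 0}"
  shows "ordinary_conic S C" "S \<inter> C = {p, q, r, x, y}"
proof -
  have xy: "x \<in> C" "y \<in> C" by (simp_all add: C_def dot_cross_self inner_commute)
  have "{p, q, r} \<subseteq> C" by (simp add: C_def)
  then show SC: "S \<inter> C = {p, q, r, x, y}" using S only xy by (auto simp: C_def)
  have "E = C" if E: "is_conic E" "S \<inter> C \<subseteq> E" for E
  proof -
    have "p \<in> E" "q \<in> E" "r \<in> E" "x \<in> E" "y \<in> E" using E(2) SC by auto
    then obtain w' where w': "w' \<noteq> 0" "E = {X. w' \<bullet> tau p q r X = 0}"
      using conic_through_three_points[OF D E(1)] by blast
    then have "w' \<bullet> tau p q r x = 0" "w' \<bullet> tau p q r y = 0" using \<open>x \<in> E\<close> \<open>y \<in> E\<close> by auto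
    then obtain k where "w' = k *\<^sub>R (tau p q r x \<times> tau p q r y)" using orthogonal_imp_parallel_cross w by blast
    then show ?thesis using w' by (auto simp: C_def)
  qed
  then show "ordinary_conic S C"
    unfolding ordinary_conic_def using is_conic_tau[OF D w, folded C_def] SC dist by metis
qed

text \<open>Along the line the equation is a quadratic polynomial in the parameter, with zeros at 0,
  at 1 and at the parameter of \<open>z\<close>; so it vanishes identically.\<close>

lemma conic_contains_line:
  assumes C: "is_conic C" and xyz: "x \<in> C" "y \<in> C" "z \<in> C" "x \<noteq> y" "y \<noteq> z" "z \<noteq> x"
    and col: "tri x y z = 0" "tri x y u = 0"
  shows "u \<in> C"
proof -
  obtain a b c d e f where C': "C = {(x, y). a * x\<^sup>2 + b * x * y + c * y\<^sup>2 + d * x + e * y + f = 0}"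
    using C unfolding is_conic_def by blast
  define Q where "Q = (\<lambda>X. a * (fst X)\<^sup>2 + b * fst X * snd X + c * (snd X)\<^sup>2 + d * fst X + e * snd X + f)"
  have CQ: "C = {X. Q X = 0}" by (auto simp: C' Q_def)
  obtain s where s: "z = (fst x + s * (fst y - fst x), snd x + s * (snd y - snd x))"
    using tri_eq_0_imp_on_line[OF xyz(4) col(1)] .
  obtain t where t: "u = (fst x + t * (fst y - fst x), snd x + t * (snd y - snd x))"
    using tri_eq_0_imp_on_line[OF xyz(4) col(2)] .
  define m n where "m = fst y - fst x" "n = snd y - snd x"
  define A where "A = a * m\<^sup>2 + b * m * n + c * n\<^sup>2"
  define B where "B = 2 * a * fst x * m + b * (fst x * n + m * snd x) + 2 * c * snd x * n + d * m + e * n"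
  have Q: "Q (fst x + k * m, snd x + k * n) = A * k\<^sup>2 + B * k + Q x" for k
    unfolding Q_def A_def B_def fst_conv snd_conv by algebra
  have x: "Q x = 0" using xyz by (simp add: CQ)
  have "Q y = A * 1\<^sup>2 + B * 1 + Q x" using Q[of 1] by (simp add: m_n_def)
  then have "B = - A" using xyz x by (simp add: CQ)
  moreover have "A * s\<^sup>2 + B * s = 0" using Q[of s] xyz x by (simp add: CQ s m_n_def)
  ultimately have "A * s * (s - 1) = 0" by (simp add: algebra_simps power2_eq_square)
  moreover have "s \<noteq> 0" using xyz s by (auto simp: prod_eq_iff)
  moreover have "s \<noteq> 1" using xyz s by (auto simp: prod_eq_iff)
  ultimately have "A = 0" by simp
  then have "Q u = 0" using Q[of t] x \<open>B = - A\<close> by (simp add: t m_n_def)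
  then show ?thesis by (simp add: CQ)
qed

text \<open>In the image the two conics are different lines, and these meet only in the point
  \<open>tau a b c d\<close>. A common point that is not a base point has this image, and since
  \<open>d\<close> is off the sides it must be \<open>d\<close> itself.\<close>

lemma conics_meet:
  assumes D: "tri a b c \<noteq> 0" and d: "tri d b c \<noteq> 0" "tri a d c \<noteq> 0" "tri a b d \<noteq> 0"
    and w0: "w0 \<bullet> tau a b c d = 0" "w0 \<bullet> tau a b c x \<noteq> 0"
  shows "tau a b c d \<times> tau a b c x \<noteq> 0"
    "(tau a b c d \<times> tau a b c x) \<bullet> tau a b c z = 0 \<Longrightarrow> w0 \<bullet> tau a b c z = 0 \<Longrightarrow> z \<in> {a, b, c, d}"
proof -
  let ?t = "tau a b c"
  have d1: "?t d $ 1 \<noteq> 0" using d by simp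
  then have td: "?t d \<noteq> 0" by (metis zero_index)
  have "w0 \<bullet> ?t x = 0" if "?t d \<times> ?t x = 0"
  proof -
    have "?t d \<times> (?t x \<times> ?t d) = 0" using that cross_skew[of "?t x"] by simp
    then have "(?t d \<bullet> ?t d) *\<^sub>R ?t x = (?t d \<bullet> ?t x) *\<^sub>R ?t d" using Lagrange[of "?t d" "?t x" "?t d"] by simp
    then have "(?t d \<bullet> ?t d) * (w0 \<bullet> ?t x) = 0" using w0(1) by (metis inner_scaleR_right mult_zero_right)
    then show ?thesis using td by simp
  qed
  then show w: "?t d \<times> ?t x \<noteq> 0" using w0(2) by blast
  assume z: "(?t d \<times> ?t x) \<bullet> ?t z = 0" "w0 \<bullet> ?t z = 0"
  define w where "w = ?t d \<times> ?t x"
  have wx: "w \<bullet> ?t x = 0" "w \<bullet> ?t d = 0" by (simp_all add: w_def dot_cross_self inner_commute)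
  have "w0 \<times> w \<noteq> 0"
  proof
    assume "w0 \<times> w = 0"
    then have "w \<times> (w0 \<times> w) = 0" by simp
    then have "(w \<bullet> w) *\<^sub>R w0 = (w \<bullet> w0) *\<^sub>R w" using Lagrange[of w w0 w] by simp
    then have "(w \<bullet> w) * (w0 \<bullet> ?t x) = (w \<bullet> w0) * (w \<bullet> ?t x)" by (metis inner_scaleR_left)
    then show False using wx w w0(2) by (simp add: w_def)
  qed
  moreover have "?t z \<bullet> w0 = 0" "?t z \<bullet> w = 0" using z by (simp_all add: w_def inner_commute)
  moreover have "?t d \<bullet> w0 = 0" "?t d \<bullet> w = 0" using w0 wx by (simp_all add: inner_commute)
  ultimately obtain k k' where k: "?t z = k *\<^sub>R (w0 \<times> w)" "?t d = k' *\<^sub>R (w0 \<times> w)"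
    using orthogonal_imp_parallel_cross by metis
  have k': "k' \<noteq> 0" using td k by auto
  show "z \<in> {a, b, c, d}"
  proof (cases "k = 0")
    case True
    then show ?thesis using k tau_eq_0[OF D, of z] by auto
  next
    case False
    have "?t z = (k / k') *\<^sub>R ?t d" using k k' by simp
    then have "?t z $ i = (k / k') * ?t d $ i" for i by simp
    from this[of 1] this[of 2] this[of 3] have "tri z b c \<noteq> 0" "tri a z c \<noteq> 0" "tri a b z \<noteq> 0"
      using False k' d by auto
    moreover have "?t z \<times> ?t d = 0" unfolding k by (simp add: cross_mult_left cross_mult_right)
    ultimately show ?thesis using tau_inj[OF D _ _ _ d] by blast
  qed
qed

text \<open>Points of \<open>C0\<close> are taken care of by \<open>conics_meet\<close>, so only the
  points of \<open>S\<close> off \<open>C0\<close> have to be tested.\<close>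

lemma ordinary_conic_from_conic:
  assumes C0: "is_conic C0" and abcd: "{a, b, c, d} \<subseteq> S \<inter> C0"
    and gp: "tri a b c \<noteq> 0" "tri d b c \<noteq> 0" "tri a d c \<noteq> 0" "tri a b d \<noteq> 0"
    and x: "x \<in> S" "x \<notin> C0"
  defines "C \<equiv> {X. (tau a b c d \<times> tau a b c x) \<bullet> tau a b c X = 0}"
  assumes only: "\<And>y. y \<in> S - C0 \<Longrightarrow> y \<noteq> x \<Longrightarrow> y \<notin> C"
  shows "ordinary_conic S C" "S \<inter> C = {a, b, c, d, x}"
proof -
  obtain w0 where w0: "w0 \<noteq> 0" "C0 = {X. w0 \<bullet> tau a b c X = 0}"
    using conic_through_three_points[OF gp(1) C0] abcd by auto
  have d: "w0 \<bullet> tau a b c d = 0" "w0 \<bullet> tau a b c x \<noteq> 0" using abcd x w0 by auto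
  note meet = conics_meet[OF gp d]
  have ne: "a \<noteq> b" "b \<noteq> c" "a \<noteq> c" "a \<noteq> d" "b \<noteq> d" "c \<noteq> d" using gp by auto
  have x': "x \<noteq> a" "x \<noteq> b" "x \<noteq> c" "x \<noteq> d" using abcd x by auto
  have card: "card {a, b, c, d, x} = 5" using ne x' by auto
  have only': "z \<in> {a, b, c, d, x}" if "z \<in> S" "(tau a b c d \<times> tau a b c x) \<bullet> tau a b c z = 0" for z
  proof (cases "z \<in> C0")
    case True then show ?thesis using meet(2)[of z] that w0 by auto
  next
    case False then show ?thesis using only[of z] that by (auto simp: C_def)
  qed
  show "ordinary_conic S C" "S \<inter> C = {a, b, c, d, x}"
    unfolding C_def using ordinary_conicI[OF gp(1) _ card meet(1) only'] abcd x by auto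
qed

text \<open>With base triangle \<open>a\<close>, \<open>c\<close>, \<open>d\<close> the point
  \<open>e\<close> lies on a side and its image is on the first axis. The image line through it and
  the image of \<open>b\<close> then factors into the equations of the lines \<open>cd\<close> and
  \<open>ab\<close>.\<close>

lemma ordinary_conic_two_lines:
  assumes S: "{a, b, c, d, e} \<subseteq> S" and dist: "card {a, b, c, d, e} = 5"
    and ab: "\<And>z. z \<in> S \<Longrightarrow> tri a b z = 0 \<Longrightarrow> z \<in> {a, b}"
    and cde: "\<And>z. z \<in> S \<Longrightarrow> tri c d z = 0 \<longleftrightarrow> z \<in> {c, d, e}"
  shows "\<exists>C. ordinary_conic S C \<and> S \<inter> C = {a, b, c, d, e}"
proof -
  have ne: "a \<noteq> b" "c \<noteq> d" "c \<noteq> e" "d \<noteq> e" "a \<noteq> c" "a \<noteq> d" "a \<noteq> e" "b \<noteq> c" "b \<noteq> d" "b \<noteq> e"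
    using dist by (auto simp: card_insert_if split: if_splits)
  let ?t = "tau a c d"
  have D: "tri a c d \<noteq> 0" using cde[of a] S ne by (auto simp: tri_permute_0)
  have eb: "tri e c d = 0" "tri b c d \<noteq> 0" using cde[of e] cde[of b] S ne by (auto simp: tri_permute_0)
  define k where "k = tri a e d * tri a c e"
  have k: "k \<noteq> 0" unfolding k_def using bary_vertex[OF D, of e] eb ne by auto
  have w: "?t b \<times> ?t e = k *\<^sub>R vector [0, ?t b $ 3, - (?t b $ 2)]"
    using eb by (simp add: vec_eq_iff forall_3 cross_components k_def)
  have id: "tri a b d * tri a c z - tri a c b * tri a z d = tri a c d * tri a b z" for z
    by (simp add: tri_def algebra_simps)
  have wz: "(?t b \<times> ?t e) \<bullet> ?t z = k * tri b c d * tri z c d * (tri a c d * tri a b z)" for z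
    unfolding w id[symmetric] by (simp add: inner_vec_def sum_3 algebra_simps)
  have "tri a b d \<noteq> 0 \<or> tri a c b \<noteq> 0" using bary_vertex(1)[OF D, of b] ne by auto
  then have "vector [0, ?t b $ 3, - (?t b $ 2)] \<noteq> (0 :: real^3)" using eb by (auto simp: vec_eq_iff forall_3)
  then have nz: "?t b \<times> ?t e \<noteq> 0" unfolding w using k by simp
  have perm: "{a, c, d, b, e} = {a, b, c, d, e}" by auto
  have "z \<in> {a, c, d, b, e}" if "z \<in> S" "(?t b \<times> ?t e) \<bullet> ?t z = 0" for z
    using that(2) k eb(2) D ab[OF that(1)] cde[OF that(1)] unfolding wz by (auto simp: tri_permute_0)
  then show ?thesis using ordinary_conicI[OF D, of b e S] S dist nz unfolding perm by blast
qed

section \<open>Existence of an ordinary conic\<close>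

text \<open>The chart \<open>g\<close> puts the first axis at infinity in the vertical direction, so
  lines through it become vertical. Nonzero third coordinates keep \<open>V\<close> inside the
  chart, where Sylvester--Gallai with one forbidden point applies.\<close>

lemma ordinary_pair_avoiding_first_axis:
  assumes fin: "finite V" and V: "pairwise_indep V" and 3: "\<And>x. x \<in> V \<Longrightarrow> x$3 \<noteq> 0"
    and span: "\<And>w. w \<noteq> 0 \<Longrightarrow> \<exists>x\<in>V. w \<bullet> x \<noteq> 0"
  obtains x y where "ordinary_pair V x y" "(x \<times> y)$1 \<noteq> 0"
proof -
  define g where "g = (\<lambda>x::real^3. (x$2 / x$3, x$1 / x$3))"
  have fst_g: "fst (g x) = fst (g y) \<longleftrightarrow> (x \<times> y)$1 = 0" if "x \<in> V" "y \<in> V" for x y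
    using 3[OF that(1)] 3[OF that(2)] by (simp add: g_def cross_components field_simps)
  have v: "vdist (g z) (g x) (g y) = 0 \<longleftrightarrow> det3 x y z = 0"
    if h: "x \<in> V" "y \<in> V" "z \<in> V" "(x \<times> y)$1 \<noteq> 0" for x y z
  proof -
    have ne: "fst (g x) \<noteq> fst (g y)" using fst_g h by simp
    have "det3 x y z = x$3 * y$3 * z$3 * ((snd (g y) - snd (g x)) * (fst (g z) - fst (g x)) - (fst (g y) - fst (g x)) * (snd (g z) - snd (g x)))"
      using 3[OF h(1)] 3[OF h(2)] 3[OF h(3)]
      by (simp add: g_def inner_vec_def sum_3 cross_components field_simps)
    then show ?thesis unfolding vdist_eq_0_iff[OF ne] using 3[OF h(1)] 3[OF h(2)] 3[OF h(3)] by auto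
  qed
  have inj: "x = y" if "x \<in> V" "y \<in> V" "g x = g y" for x y
  proof (rule ccontr)
    assume "x \<noteq> y"
    then have "x \<times> y \<noteq> 0" using V that by (auto simp: pairwise_indep_def)
    moreover have "x$2 * y$3 = y$2 * x$3" "x$1 * y$3 = y$1 * x$3"
      using that(3) 3[OF that(1)] 3[OF that(2)] by (simp_all add: g_def field_simps)
    moreover then have "x$1 * y$2 * (x$3 * y$3) = y$1 * x$2 * (x$3 * y$3)" by algebra
    then have "x$1 * y$2 = y$1 * x$2" using 3[OF that(1)] 3[OF that(2)] by simp
    ultimately show False by (simp add: vec_eq_iff forall_3 cross_components mult.commute)
  qed
  obtain x0 where x0: "x0 \<in> V" using span[of "axis 1 1"] by (auto simp: axis_eq_0_iff)
  have "\<exists>y0\<in>V. (x0 \<times> y0)$1 \<noteq> 0"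
  proof (rule ccontr)
    assume a: "\<not> ?thesis"
    define w :: "real^3" where "w = vector [0, x0$3, - (x0$2)]"
    have "w \<noteq> 0" using 3[OF x0] by (auto simp: w_def vec_eq_iff forall_3)
    then obtain z where z: "z \<in> V" "w \<bullet> z \<noteq> 0" using span by blast
    have "w \<bullet> z = - ((x0 \<times> z)$1)" by (simp add: w_def inner_vec_def sum_3 cross_components)
    then show False using a z by auto
  qed
  then obtain y0 where y0: "y0 \<in> V" "(x0 \<times> y0)$1 \<noteq> 0" by blast
  then have "x0 \<times> y0 \<noteq> 0" by auto
  then obtain z0 where z0: "z0 \<in> V" "(x0 \<times> y0) \<bullet> z0 \<noteq> 0" using span by blast
  then have "det3 x0 y0 z0 \<noteq> 0" using cross_triple[of x0 y0 z0] by (simp add: inner_commute)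
  then have vz: "vdist (g z0) (g x0) (g y0) \<noteq> 0" using v x0 y0 z0 by blast
  have f0: "fst (g x0) \<noteq> fst (g y0)" using fst_g[OF x0 y0(1)] y0(2) by simp
  obtain A B where AB: "A \<in> g ` V" "B \<in> g ` V" "fst A \<noteq> fst B"
    "\<And>C. C \<in> g ` V \<Longrightarrow> vdist C A B = 0 \<Longrightarrow> C = A \<or> C = B"
    using ordinary_nonvertical_line[of "g ` V" "g x0" "g y0" "g z0"] fin x0 y0(1) z0(1) f0 vz by blast
  then obtain x y where xy: "x \<in> V" "y \<in> V" "A = g x" "B = g y" by blast
  then have 1: "(x \<times> y)$1 \<noteq> 0" using AB(3) fst_g by simp
  have "ordinary_pair V x y"
    unfolding ordinary_pair_def
  proof (intro conjI ballI impI)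
    show "x \<noteq> y" using 1 by auto
    fix z assume "z \<in> V" "det3 x y z = 0"
    then show "z = x \<or> z = y" using AB(4)[of "g z"] v[OF xy(1,2) _ 1] xy inj by blast
  qed (use xy in auto)
  then show ?thesis using that 1 by blast
qed

lemma no_conic_imp_noncollinear:
  assumes "\<not> (\<exists>C. is_conic C \<and> S \<subseteq> C)" "a \<noteq> b"
  obtains z where "z \<in> S" "tri a b z \<noteq> 0"
proof -
  have "\<not> S \<subseteq> {X. tri a b X = 0 \<or> tri a b X = 0}" using assms is_conic_two_lines by blast
  then show ?thesis using that by blast
qed

text \<open>Suppose the conic through \<open>p\<close>, \<open>q\<close>, \<open>s\<close>,
  \<open>t\<close>, \<open>x\<close> contained another point \<open>y\<close> of \<open>S\<close>
  off \<open>C0\<close>. It would contain three points \<open>q\<close>, \<open>x\<close>,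
  \<open>y\<close> of the line \<open>qr\<close>, hence also \<open>r\<close>. But \<open>r\<close>
  lies on \<open>C0\<close> and is not among the four common points.\<close>

lemma ordinary_conic_extra_line:
  assumes C0: "is_conic C0" "\<And>z. z \<in> S \<Longrightarrow> z \<notin> C0 \<Longrightarrow> tri q r z = 0"
    and S: "{p, q, s, t, x} \<subseteq> S" "{p, q, r, s, t} \<subseteq> C0" "x \<notin> C0"
    and gp: "tri p q s \<noteq> 0" "tri p q t \<noteq> 0" "tri p s t \<noteq> 0" "tri q s t \<noteq> 0"
    and r: "r \<notin> {p, q, s, t}"
  shows "\<exists>C. ordinary_conic S C"
proof -
  let ?C = "{X. (tau p q s t \<times> tau p q s x) \<bullet> tau p q s X = 0}"
  have gp': "tri p q s \<noteq> 0" "tri t q s \<noteq> 0" "tri p t s \<noteq> 0" "tri p q t \<noteq> 0"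
    using gp by (auto simp: tri_permute_0)
  obtain w0 where w0: "w0 \<noteq> 0" "C0 = {X. w0 \<bullet> tau p q s X = 0}"
    using conic_through_three_points[OF gp(1) C0(1)] S by auto
  have d: "w0 \<bullet> tau p q s t = 0" "w0 \<bullet> tau p q s x \<noteq> 0" using S w0 by auto
  note meet = conics_meet[OF gp' d]
  have conC: "is_conic ?C" by (rule is_conic_tau[OF gp(1) meet(1)])
  have "y \<notin> ?C" if y: "y \<in> S - C0" "y \<noteq> x" for y
  proof
    assume yC: "y \<in> ?C"
    have xC: "x \<in> ?C" by (simp add: dot_cross_self inner_commute)
    have qC: "q \<in> ?C" by simp
    have qr: "q \<noteq> r" using r by auto
    have col: "tri q r x = 0" "tri q r y = 0" using C0(2) S y by auto
    have xq: "x \<noteq> q" "y \<noteq> q" using S y by auto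
    have "tri q x y = 0" using tri_trans[OF qr col] .
    moreover have "tri q x r = 0" using col by (simp add: tri_permute_0)
    ultimately have "r \<in> ?C" using conic_contains_line[OF conC qC xC yC] xq y by auto
    then show False using meet(2)[of r] S r w0 by auto
  qed
  then show ?thesis using ordinary_conic_from_conic(1)[OF C0(1) _ gp' _ S(3)] S by blast
qed

text \<open>Besides the base points, \<open>S'\<close> leaves out only points of \<open>S\<close> on
  the side \<open>qr\<close>, whose images lie on the first axis. An ordinary line of the image that
  avoids this axis is therefore an ordinary conic. If the image of \<open>S'\<close> is collinear,
  \<open>S'\<close> lies on a conic through \<open>p\<close>, \<open>q\<close>, \<open>r\<close> and
  the other points of \<open>S\<close> off it lie on \<open>qr\<close>.\<close>

lemma ordinary_conic_if_two_ordinary_lines_meet: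
  assumes fin: "finite S" and nc: "\<not> (\<exists>C. is_conic C \<and> S \<subseteq> C)"
    and S: "{p, q, r} \<subseteq> S" and D: "tri p q r \<noteq> 0"
    and pq: "\<And>z. z \<in> S \<Longrightarrow> tri p q z = 0 \<Longrightarrow> z \<in> {p, q}"
    and pr: "\<And>z. z \<in> S \<Longrightarrow> tri p r z = 0 \<Longrightarrow> z \<in> {p, r}"
  shows "\<exists>C. ordinary_conic S C"
proof -
  define S' where "S' = {x \<in> S. tri x q r \<noteq> 0 \<and> x \<noteq> p}"
  have S': "tri x q r \<noteq> 0" "tri p x r \<noteq> 0" "tri p q x \<noteq> 0" "x \<in> S" if "x \<in> S'" for x
    using that pq[of x] pr[of x] by (auto simp: S'_def tri_permute_0)
  define V where "V = tau p q r ` S'"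
  have neq: "p \<noteq> q" "q \<noteq> r" "p \<noteq> r" using D by auto
  have finV: "finite V" using fin by (simp add: V_def S'_def)
  have indep: "tau p q r x \<times> tau p q r y \<noteq> 0" if "x \<in> S'" "y \<in> S'" "x \<noteq> y" for x y
    using tau_inj[OF D S'(1-3)[OF that(1)] S'(1-3)[OF that(2)]] that by blast
  then have V: "pairwise_indep V" unfolding pairwise_indep_def V_def by blast
  show ?thesis
  proof (cases "\<forall>w. w \<noteq> 0 \<longrightarrow> (\<exists>x\<in>V. w \<bullet> x \<noteq> 0)")
    case True
    have 3: "v$3 \<noteq> 0" if "v \<in> V" for v using that S' by (auto simp: V_def)
    obtain v1 v2 where v12: "ordinary_pair V v1 v2" "(v1 \<times> v2)$1 \<noteq> 0"
      using ordinary_pair_avoiding_first_axis[OF finV V 3] True by metis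
    then obtain x y where xy: "x \<in> S'" "y \<in> S'" "v1 = tau p q r x" "v2 = tau p q r y"
      by (auto simp: ordinary_pair_def V_def)
    have only: "z \<in> {p, q, r, x, y}" if z: "z \<in> S" "(tau p q r x \<times> tau p q r y) \<bullet> tau p q r z = 0" for z
    proof (cases "z \<in> S'")
      case True
      then have "tau p q r z \<in> V" by (simp add: V_def)
      moreover have "det3 v1 v2 (tau p q r z) = 0"
        using z(2) cross_triple[of v1 v2 "tau p q r z"] by (simp add: xy inner_commute)
      ultimately have "tau p q r z = tau p q r x \<or> tau p q r z = tau p q r y"
        using v12(1) xy by (auto simp: ordinary_pair_def)
      then have "tau p q r z \<times> tau p q r x = 0 \<or> tau p q r z \<times> tau p q r y = 0" by auto
      then have "z = x \<or> z = y" using indep[OF True xy(1)] indep[OF True xy(2)] by blast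
      then show ?thesis by blast
    next
      case False
      show ?thesis
      proof (cases "z = p")
        case False
        with \<open>z \<notin> S'\<close> z have a: "tri z q r = 0" by (simp add: S'_def)
        then have "(v1 \<times> v2)$1 * (tri p z r * tri p q z) = 0" using z(2) by (simp add: inner_tau xy)
        then have "tri p z r = 0 \<or> tri p q z = 0" using v12(2) by simp
        then show ?thesis using a bary_vertex[OF D, of z] by auto
      qed simp
    qed
    have "x \<noteq> y" using v12 xy by (auto simp: ordinary_pair_def)
    moreover have "x \<notin> {p, q, r}" "y \<notin> {p, q, r}" using S'(1-3)[OF xy(1)] S'(1-3)[OF xy(2)] by auto
    ultimately have "card {p, q, r, x, y} = 5" using neq by auto
    moreover have "tau p q r x \<times> tau p q r y \<noteq> 0" using v12(2) xy by auto
    ultimately show ?thesis using ordinary_conicI(1)[OF D _ _ _ only] S xy S'(4) by blast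
  next
    case False
    then obtain w where w: "w \<noteq> 0" "\<And>x. x \<in> S' \<Longrightarrow> w \<bullet> tau p q r x = 0" by (auto simp: V_def)
    let ?C = "{X. w \<bullet> tau p q r X = 0}"
    have con: "is_conic ?C" by (rule is_conic_tau[OF D w(1)])
    then obtain x where x: "x \<in> S" "x \<notin> ?C" using nc by blast
    have off: "tri q r z = 0" if "z \<in> S" "z \<notin> ?C" for z
    proof -
      have "z \<notin> S'" "z \<noteq> p" using that w(2)[of z] by auto
      then show ?thesis using that by (auto simp: S'_def tri_permute_0)
    qed
    \<comment> \<open>Otherwise \<open>S'\<close> lies on a line through \<open>p\<close>, and
      \<open>S\<close> on the conic formed by that line and \<open>qr\<close>.\<close>
    have "\<exists>s\<in>S'. \<exists>t\<in>S'. tri p s t \<noteq> 0"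
    proof (rule ccontr)
      assume a: "\<not> ?thesis"
      have "\<exists>b. p \<noteq> b \<and> S' \<subseteq> {X. tri p b X = 0}"
      proof (cases "S' = {}")
        case False
        then obtain b where b: "b \<in> S'" by blast
        then have "b \<noteq> p" by (simp add: S'_def)
        moreover have "S' \<subseteq> {X. tri p b X = 0}" using a b by auto
        ultimately show ?thesis by (intro exI[of _ b] conjI) auto
      next
        case True
        then show ?thesis using neq by (intro exI[of _ q]) auto
      qed
      then obtain b where b: "p \<noteq> b" "S' \<subseteq> {X. tri p b X = 0}" by blast
      have "S \<subseteq> {X. tri q r X = 0 \<or> tri p b X = 0}"
      proof
        fix z assume "z \<in> S"
        then show "z \<in> {X. tri q r X = 0 \<or> tri p b X = 0}"
          using b(2) by (cases "z \<in> S'"; cases "z = p") (auto simp: S'_def tri_permute_0)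
      qed
      then show False using nc is_conic_two_lines[OF neq(2) b(1)] by blast
    qed
    then obtain s t where st: "s \<in> S'" "t \<in> S'" "tri p s t \<noteq> 0" by blast
    have inC: "{p, q, r, s, t} \<subseteq> ?C" using w(2) st by simp
    have notin: "r \<notin> {p, q, s, t}" "q \<notin> {p, r, s, t}" using neq S'(1-3)[OF st(1)] S'(1-3)[OF st(2)] by auto
    have gp: "tri p q s \<noteq> 0" "tri p q t \<noteq> 0" "tri p r s \<noteq> 0" "tri p r t \<noteq> 0"
      using S'(2,3)[OF st(1)] S'(2,3)[OF st(2)] by (auto simp: tri_permute_0)
    have ins: "{p, q, r, s, t, x} \<subseteq> S" using S S'(4) st x by auto
    show ?thesis
    proof (cases "tri q s t = 0")
      case False
      show ?thesis
        by (rule ordinary_conic_extra_line[OF con off, where p = p and s = s and t = t and x = x])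
           (use ins inC x gp st False notin in auto)
    next
      \<comment> \<open>Here \<open>q\<close>, \<open>s\<close>, \<open>t\<close> are collinear, so
        \<open>r\<close>, \<open>s\<close>, \<open>t\<close> are not, and \<open>q\<close> and
        \<open>r\<close> exchange roles.\<close>
      case True
      have "tri r s t \<noteq> 0"
      proof
        assume "tri r s t = 0"
        then have "tri s t q = 0" "tri s t r = 0" using True by (auto simp: tri_permute_0)
        moreover have "s \<noteq> t" using st by auto
        ultimately have "tri s q r = 0" using tri_trans by blast
        then show False using S' st by blast
      qed
      moreover have off': "tri r q z = 0" if "z \<in> S" "z \<notin> ?C" for z
        using off[OF that] by (simp add: tri_permute_0)
      ultimately show ?thesis
        by (intro ordinary_conic_extra_line[OF con off', where p = p and s = s and t = t and x = x])
           (use ins inC x gp st notin in auto)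
    qed
  qed
qed

text \<open>Outside a triangle \<open>p\<close>, \<open>q\<close>, \<open>r\<close> there must be
  three points with independent images, since otherwise \<open>S\<close> lies on a conic. So
  \<open>S\<close> has exactly six points, and the conic through five of them misses the
  sixth.\<close>

lemma ordinary_conic_if_card_le_6:
  assumes fin: "finite S" and nc: "\<not> (\<exists>C. is_conic C \<and> S \<subseteq> C)" and card: "card S \<le> 6"
  shows "\<exists>C. ordinary_conic S C"
proof -
  obtain p where p: "p \<in> S"
    using no_conic_imp_noncollinear[OF nc, of "(0,0)" "(1,0)"] by fastforce
  have "p \<noteq> (fst p + 1, snd p)" by (simp add: prod_eq_iff)
  then obtain q where q: "q \<in> S" "tri p (fst p + 1, snd p) q \<noteq> 0"
    using no_conic_imp_noncollinear[OF nc] by blast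
  then have "q \<noteq> p" by auto
  obtain r where r: "r \<in> S" "tri p q r \<noteq> 0"
    using no_conic_imp_noncollinear[OF nc, of p q] \<open>q \<noteq> p\<close> by metis
  have neq: "p \<noteq> q" "q \<noteq> r" "p \<noteq> r" using r by auto
  let ?t = "tau p q r"
  define R where "R = S - {p, q, r}"
  have "card R = card S - 3" using p q r neq fin by (simp add: R_def card_Diff_subset)
  then have cR: "card R \<le> 3" using card by simp
  have span: "\<exists>x\<in>R. w \<bullet> ?t x \<noteq> 0" if "w \<noteq> 0" for w
  proof (rule ccontr)
    assume "\<not> ?thesis"
    then have "S \<subseteq> {X. w \<bullet> ?t X = 0}" by (auto simp: R_def)
    then show False using nc is_conic_tau[OF r(2) that] by blast
  qed
  have axis: "axis 1 1 \<noteq> (0::real^3)" by (simp add: axis_eq_0_iff)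
  obtain x where x: "x \<in> R" "?t x \<noteq> 0" using span[OF axis] by (metis inner_zero_right)
  obtain i where "?t x \<times> i \<noteq> 0" using cross_basis_nonzero[OF x(2)] by blast
  then obtain y where y: "y \<in> R" "(?t x \<times> i) \<bullet> ?t y \<noteq> 0" using span by blast
  have w: "?t x \<times> ?t y \<noteq> 0"
  proof
    assume "?t x \<times> ?t y = 0"
    moreover have "(?t x \<times> i) \<bullet> ?t y = - (i \<bullet> (?t x \<times> ?t y))"
      by (simp add: cross3_def inner_vec_def sum_3 algebra_simps)
    ultimately show False using y by simp
  qed
  then obtain z where z: "z \<in> R" "(?t x \<times> ?t y) \<bullet> ?t z \<noteq> 0" using span by blast
  have d: "x \<noteq> y" "x \<noteq> z" "y \<noteq> z" using w z by (auto simp: dot_cross_self inner_commute)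
  then have "{x, y, z} \<subseteq> R" "card {x, y, z} = 3" using x y z by auto
  then have "R = {x, y, z}" using cR fin by (metis R_def card_seteq finite_Diff)
  then have S: "S = {p, q, r, x, y, z}" using p q r by (auto simp: R_def)
  have R: "x \<notin> {p, q, r}" "y \<notin> {p, q, r}" using x y by (auto simp: R_def)
  show ?thesis
    by (rule exI, rule ordinary_conicI(1)[OF r(2), of x y])
       (use S d R neq w z in auto)
qed

lemma pairwise_indep_lft: "pairwise_indep (lft ` S)"
  by (auto simp: pairwise_indep_def lft_indep)

lemma ordinary_pair_lft:
  "ordinary_pair (lft ` S) (lft p) (lft q) \<longleftrightarrow>
    p \<in> S \<and> q \<in> S \<and> p \<noteq> q \<and> (\<forall>z\<in>S. tri p q z = 0 \<longrightarrow> z = p \<or> z = q)"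
  using inj_lft by (auto simp: ordinary_pair_def det3_lft inj_image_mem_iff)

text \<open>Without an ordinary conic the \<open>t\<close> ordinary lines are pairwise disjoint, and
  every line with exactly three points meets all of them. Each point off the ordinary lines is
  attached to at least three of them, and each line has at most four attached points. This leaves
  only \<open>t = 3\<close> with at most 8 points, where the lines through a point off the ordinary
  lines would need too many points.\<close>

theorem exists_ordinary_conic:
  assumes fin: "finite S" and nc: "\<not> (\<exists>C. is_conic C \<and> S \<subseteq> C)"
  shows "\<exists>C. ordinary_conic S C"
proof (rule ccontr)
  assume no: "\<not> ?thesis"
  define V where "V = lft ` S"
  define OL where "OL = ordinary_lines V"
  define n where "n = card V"
  define t where "t = card OL"
  have finV: "finite V" using fin by (simp add: V_def)
  have V: "pairwise_indep V" unfolding V_def by (rule pairwise_indep_lft)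
  have finO: "finite OL" unfolding OL_def by (rule finite_ordinary_lines[OF finV])
  have n: "n = card S" unfolding n_def V_def by (simp add: card_image inj_on_subset[OF inj_lft])
  have n7: "n \<ge> 7" using ordinary_conic_if_card_le_6[OF fin nc] no n by (cases "card S \<le> 6") auto
  have uniq: "A = B" if AB: "ordinary_pair V P A" "ordinary_pair V P B" for P A B
  proof (rule ccontr)
    assume "A \<noteq> B"
    obtain p a b where pab: "p \<in> S" "a \<in> S" "b \<in> S" "P = lft p" "A = lft a" "B = lft b"
      using AB by (auto simp: ordinary_pair_def V_def)
    have pa: "\<forall>z\<in>S. tri p a z = 0 \<longrightarrow> z = p \<or> z = a" and pb: "\<forall>z\<in>S. tri p b z = 0 \<longrightarrow> z = p \<or> z = b"
      and ne: "p \<noteq> a" "p \<noteq> b"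
      using AB by (auto simp: V_def pab ordinary_pair_lft)
    have "a \<noteq> b" using \<open>A \<noteq> B\<close> pab by auto
    then have "tri p a b \<noteq> 0" using pa pab ne by auto
    then show False using ordinary_conic_if_two_ordinary_lines_meet[OF fin nc, of p a b] pa pb pab no by auto
  qed
  have sym: "ordinary_pair V A B \<Longrightarrow> ordinary_pair V B A" for A B
    using det3_swap[of A B] by (auto simp: ordinary_pair_def)
  have disj: "l \<inter> l' = {}" if ll: "l \<in> OL" "l' \<in> OL" "l \<noteq> l'" for l l'
  proof (rule ccontr)
    assume "l \<inter> l' \<noteq> {}"
    then obtain P where P: "P \<in> l" "P \<in> l'" by blast
    obtain A where A: "ordinary_pair V P A" "l = {P, A}"
      using ll(1) P(1) sym by (auto simp: OL_def ordinary_lines_def insert_commute)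
    obtain B where B: "ordinary_pair V P B" "l' = {P, B}"
      using ll(2) P(2) sym by (auto simp: OL_def ordinary_lines_def insert_commute)
    show False using uniq[OF A(1) B(1)] A B ll by simp
  qed
  have card2: "card l = 2" if "l \<in> OL" for l using that by (auto simp: OL_def ordinary_lines_def ordinary_pair_def)
  define U where "U = \<Union>OL"
  have U: "U \<subseteq> V" by (auto simp: U_def OL_def ordinary_lines_def ordinary_pair_def)
  have cU: "card U = 2 * t"
  proof -
    have "card U = (\<Sum>l\<in>OL. card l)" unfolding U_def
      by (rule card_Union_disjoint) (use disj card2 in \<open>auto simp: pairwise_def disjnt_def intro!: card_ge_0_finite\<close>)
    then show ?thesis using card2 by (simp add: t_def)
  qed
  have tn: "2 * t \<le> n" using card_mono[OF finV U] cU by (simp add: n_def)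
  have inU: "P \<in> U \<longleftrightarrow> (\<exists>A. ordinary_pair V P A)" for P
    using sym by (auto simp: U_def OL_def ordinary_lines_def)
  \<comment> \<open>A line with exactly three points together with a disjoint ordinary line is an ordinary conic.\<close>
  have meets3: "l \<inter> M \<noteq> {}"
    if l: "l \<in> OL" and M: "card M = 3" "A \<in> V" "B \<in> V" "A \<noteq> B" "M = {X \<in> V. det3 A B X = 0}" for l M A B
  proof
    assume dj: "l \<inter> M = {}"
    obtain P Q where PQ: "l = {P, Q}" "ordinary_pair V P Q" using l by (auto simp: OL_def ordinary_lines_def)
    obtain a b where ab: "a \<in> S" "b \<in> S" "P = lft a" "Q = lft b"
      using PQ by (auto simp: ordinary_pair_def V_def)
    obtain c d where cd: "c \<in> S" "d \<in> S" "A = lft c" "B = lft d" using M by (auto simp: V_def)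
    have AB: "A \<in> M" "B \<in> M" using M by auto
    have "card (M - {A, B}) = 1" using M AB by (simp add: card_Diff_subset)
    then obtain E where E: "M - {A, B} = {E}" by (auto simp: card_1_singleton_iff)
    then have M': "M = {A, B, E}" "E \<noteq> A" "E \<noteq> B" using AB by auto
    then obtain e where e: "e \<in> S" "E = lft e" using M(5) by (auto simp: V_def)
    have abo: "a \<noteq> b" "\<forall>z\<in>S. tri a b z = 0 \<longrightarrow> z = a \<or> z = b"
      using PQ by (auto simp: V_def ab ordinary_pair_lft)
    have cde: "tri c d z = 0 \<longleftrightarrow> z \<in> {c, d, e}" if "z \<in> S" for z
    proof -
      have "tri c d z = 0 \<longleftrightarrow> lft z \<in> M" using that unfolding M(5) by (simp add: cd det3_lft V_def)
      then show ?thesis unfolding M'(1) by (simp add: cd e)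
    qed
    have "c \<noteq> d" "e \<noteq> c" "e \<noteq> d" using M(4) M' cd e by auto
    moreover have "a \<notin> {c, d, e}" "b \<notin> {c, d, e}" using dj unfolding PQ(1) M'(1) ab cd e by auto
    ultimately have "card {a, b, c, d, e} = 5" using abo by auto
    then show False using ordinary_conic_two_lines[of a b c d e S] ab cd e abo cde no by auto
  qed
  have t3: "t \<le> 3" if M: "card M = 3" "A \<in> V" "B \<in> V" "A \<noteq> B" "M = {X \<in> V. det3 A B X = 0}" for M A B
  proof -
    define f where "f = (\<lambda>l. SOME X. X \<in> l \<inter> M)"
    have f: "f l \<in> l \<inter> M" if "l \<in> OL" for l
      unfolding f_def using meets3[OF that M] by (metis some_in_eq)
    have "inj_on f OL"
    proof (rule inj_onI, rule ccontr)
      fix l l' assume "l \<in> OL" "l' \<in> OL" "f l = f l'" "l \<noteq> l'"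
      then show False using f[of l] f[of l'] disj[of l l'] by auto
    qed
    moreover have "f ` OL \<subseteq> M" using f by blast
    moreover have "finite M" using M(1) by (metis card.infinite zero_neq_numeral)
    ultimately show ?thesis using card_inj_on_le[of f OL M] M(1) by (simp add: t_def)
  qed
  \<comment> \<open>The horizontal line through \<open>q\<close> completes the line
    \<open>pa\<close> to a conic; a point off that conic is automatically different from
    \<open>q\<close>.\<close>
  have span: "\<exists>A\<in>V. \<exists>B\<in>V. A \<noteq> Q \<and> B \<noteq> Q \<and> det3 P A B \<noteq> 0" if P: "P \<in> V" and Q: "Q \<in> V" for P Q
  proof -
    obtain p q where pq: "p \<in> S" "q \<in> S" "P = lft p" "Q = lft q" using P Q by (auto simp: V_def)
    have "card (S - {p, q}) > 0" using n7 n card_Diff_subset[of "{p,q}" S] pq fin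
      by (cases "p = q") auto
    then obtain a where a: "a \<in> S" "a \<noteq> p" "a \<noteq> q" by (auto simp: card_gt_0_iff)
    have u: "q \<noteq> (fst q + 1, snd q)" by (simp add: prod_eq_iff)
    have "\<not> S \<subseteq> {X. tri p a X = 0 \<or> tri q (fst q + 1, snd q) X = 0}"
      using nc is_conic_two_lines[of p a q "(fst q + 1, snd q)"] a u by blast
    then obtain b where b: "b \<in> S" "tri p a b \<noteq> 0" "tri q (fst q + 1, snd q) b \<noteq> 0" by blast
    have "b \<noteq> q" using b by auto
    then show ?thesis using a b by (intro bexI[of _ "lft a"] bexI[of _ "lft b"]) (auto simp: V_def pq det3_lft)
  qed
  \<comment> \<open>A side that is not ordinary is a three-point line through the ordinary partner
    \<open>Q\<close> of \<open>P\<close>; then all ordinary lines meet it in different points. If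
    \<open>P\<close> has no partner, \<open>Q = P\<close> leads to a contradiction.\<close>
  have three: "{X \<in> V. n \<bullet> X = 0} \<in> OL \<or> t \<le> 3 \<and> P \<in> U" if P: "P \<in> V" and sd: "n \<in> sides V P" for P n
  proof (rule ccontr)
    assume a: "\<not> ?thesis"
    obtain Q where Q: "\<And>A. A \<in> V \<Longrightarrow> A \<noteq> Q \<Longrightarrow> \<not> ordinary_pair V P A" "P \<in> U \<or> Q = P"
    proof (cases "P \<in> U")
      case True
      then obtain Q where "ordinary_pair V P Q" using inU by blast
      then show ?thesis using that uniq True by blast
    next
      case False then show ?thesis using that inU by blast
    qed
    have ns: "Q \<in> V \<and> n \<bullet> Q = 0 \<and> card {X \<in> V. n \<bullet> X = 0} = 3"
      using nonordinary_side[OF finV V P Q(1) sd] a by (auto simp: OL_def)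
    have nP: "n \<bullet> P = 1" using sd sides_subset normals_inner_P by blast
    then have "P \<in> U" using ns Q(2) by auto
    moreover obtain A B where AB: "A \<in> V" "B \<in> V" "A \<noteq> B" "n \<bullet> A = 0" "n \<bullet> B = 0"
      using side_two_points[OF V sd] .
    moreover have "{X \<in> V. n \<bullet> X = 0} = {X \<in> V. det3 A B X = 0}"
    proof -
      have ABn: "A \<times> B = det3 P A B *\<^sub>R n" using cross_eq_scaled_normal[OF AB(4,5) nP] .
      have d: "det3 P A B \<noteq> 0" using det3_neq_0[OF AB(4,5) nP] V AB by (auto simp: pairwise_indep_def)
      have "det3 A B X = det3 P A B * (X \<bullet> n)" for X
      proof -
        have "det3 A B X = X \<bullet> (A \<times> B)" by (simp add: cross3_def inner_vec_def sum_3 algebra_simps)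
        also have "\<dots> = det3 P A B * (X \<bullet> n)" by (subst ABn) simp
        finally show ?thesis .
      qed
      then show ?thesis using d by (auto simp: inner_commute)
    qed
    ultimately have "t \<le> 3" using t3[of "{X \<in> V. n \<bullet> X = 0}" A B] ns by simp
    then show False using a \<open>P \<in> U\<close> by blast
  qed
  define i where "i = (\<lambda>P. card {l \<in> OL. P \<in> attached V l})"
  have i3: "i P \<ge> 3" if P: "P \<in> V" and c: "P \<notin> U \<or> t \<ge> 4" for P
  proof -
    obtain Q where Q: "Q \<in> V" "\<And>A. A \<in> V \<Longrightarrow> A \<noteq> Q \<Longrightarrow> \<not> ordinary_pair V P A"
    proof (cases "P \<in> U")
      case True
      then obtain Q where Q: "ordinary_pair V P Q" using inU by blast
      then have "Q \<in> V" by (simp add: ordinary_pair_def)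
      then show ?thesis using that[of Q] uniq Q by blast
    next
      case False then show ?thesis using that[of P] inU P by blast
    qed
    obtain A B where AB: "A \<in> V" "B \<in> V" "A \<noteq> Q" "B \<noteq> Q" "det3 P A B \<noteq> 0" using span[OF P Q(1)] by blast
    show ?thesis unfolding i_def OL_def
      by (rule card_attached_ge_3[OF finV V P Q(2) AB]) (use three[OF P] c in \<open>auto simp: OL_def\<close>)
  qed
  have i1: "i P \<ge> 1" if P: "P \<in> U" for P
  proof -
    obtain Q where Q: "ordinary_pair V P Q" using inU P by blast
    have PV: "P \<in> V" "Q \<in> V" "Q \<noteq> P" using Q by (auto simp: ordinary_pair_def)
    obtain A B where AB: "A \<in> V" "B \<in> V" "A \<noteq> Q" "B \<noteq> Q" "det3 P A B \<noteq> 0" using span[OF PV(1,2)] by blast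
    show ?thesis unfolding i_def OL_def
      by (rule card_attached_ge_1[OF finV V PV _ AB]) (use uniq Q in blast)
  qed
  have sum4: "sum i V \<le> 4 * t" unfolding i_def OL_def t_def by (rule sum_attached_le[OF finV V])
  \<comment> \<open>With four or more ordinary lines every point is attached to at least three, so
    \<open>3 * n\<close> is at most \<open>4 * t\<close>. Disjointness of the ordinary lines bounds
    this by \<open>2 * n\<close>.\<close>
  have t_le: "t \<le> 3"
  proof (rule ccontr)
    assume "\<not> t \<le> 3"
    then have "(\<Sum>P\<in>V. 3) \<le> sum i V" by (intro sum_mono i3) auto
    then have "3 * n \<le> 4 * t" using sum4 by (simp add: n_def)
    then show False using tn n7 by linarith
  qed
  have "3 * card (V - U) + card U \<le> 4 * t"
  proof -
    have "sum i V = sum i (V - U) + sum i U" by (rule sum.subset_diff[OF U finV])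
    moreover have "(\<Sum>P\<in>V - U. 3) \<le> sum i (V - U)" by (intro sum_mono i3) auto
    moreover have "(\<Sum>P\<in>U. 1) \<le> sum i U" by (intro sum_mono i1) auto
    ultimately show ?thesis using sum4 by simp
  qed
  moreover have "card (V - U) = n - 2 * t" using card_Diff_subset[OF _ U] cU finV finite_subset[OF U]
    by (simp add: n_def)
  \<comment> \<open>This is \<open>3 * (n - 2 * t) + 2 * t \<le> 4 * t\<close>. Together with
    \<open>t \<le> 3\<close> and \<open>n \<ge> 7\<close> it forces \<open>t = 3\<close>.\<close>
  ultimately have "3 * n \<le> 8 * t" using cU tn by simp
  then have t: "t = 3" and n8: "n \<le> 8" using n7 t_le by auto
  have "card (V - U) \<noteq> 0" using \<open>card (V - U) = n - 2 * t\<close> t n7 by linarith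
  then have "V - U \<noteq> {}" by (metis card.empty)
  then obtain P where P: "P \<in> V" "P \<notin> U" by blast
  \<comment> \<open>Three-point lines are transversals of the three ordinary lines, so they miss \<open>P\<close>.\<close>
  have four: "card {X \<in> V. det3 P A X = 0} \<ge> 4" if A: "A \<in> V" "A \<noteq> P" for A
  proof (rule ccontr)
    define M where "M = {X \<in> V. det3 P A X = 0}"
    assume "\<not> ?thesis"
    then have c: "card M \<le> 3" by (simp add: M_def)
    have finM: "finite M" using finV by (simp add: M_def)
    have PA: "P \<in> M" "A \<in> M" using P A by (auto simp: M_def)
    have "\<not> ordinary_pair V P A" using P inU by blast
    then obtain X where X: "X \<in> V" "det3 P A X = 0" "X \<noteq> P" "X \<noteq> A" using P A by (auto simp: ordinary_pair_def)
    then have "{P, A, X} \<subseteq> M" using PA by (auto simp: M_def)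
    moreover have "card {P, A, X} = 3" using X A by auto
    ultimately have "M = {P, A, X}" using c finM by (metis card_seteq)
    then have c3: "card M = 3" using \<open>card {P, A, X} = 3\<close> by simp
    have "card ((\<Union>l\<in>OL. l \<inter> M)) = (\<Sum>l\<in>OL. card (l \<inter> M))"
      by (rule card_UN_disjoint) (use finO finM disj in auto)
    moreover have "(\<Sum>l\<in>OL. 1) \<le> (\<Sum>l\<in>OL. card (l \<inter> M))"
    proof (rule sum_mono)
      fix l assume "l \<in> OL"
      then have "l \<inter> M \<noteq> {}" using meets3[OF _ c3 P(1) A(1) A(2)[symmetric] M_def] by blast
      then show "1 \<le> card (l \<inter> M)" using finM by (simp add: Suc_le_eq card_gt_0_iff)
    qed
    moreover have "(\<Union>l\<in>OL. l \<inter> M) \<subseteq> M - {P}" using P(2) by (auto simp: U_def)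
    then have "card (\<Union>l\<in>OL. l \<inter> M) \<le> card (M - {P})" using finM by (intro card_mono) auto
    moreover have "card (M - {P}) = 2" using c3 PA by simp
    ultimately show False using t by (simp add: t_def)
  qed
  obtain p where p: "p \<in> S" "P = lft p" using P by (auto simp: V_def)
  define L where "L = (\<lambda>a. {z \<in> S. tri p a z = 0})"
  have finL: "finite (L a)" for a using fin by (simp add: L_def)
  have fourL: "card (L a - {p}) \<ge> 3" if "a \<in> S" "a \<noteq> p" for a
  proof -
    have "{X \<in> V. det3 P (lft a) X = 0} = lft ` L a" by (auto simp: V_def L_def p det3_lft)
    then have "card (L a) \<ge> 4" using four[of "lft a"] that by (simp add: V_def p card_image inj_on_subset[OF inj_lft])
    moreover have "p \<in> L a" using p by (simp add: L_def)
    ultimately show ?thesis using finL[of a] by simp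
  qed
  have Ldisj: "(L a - {p}) \<inter> (L b - {p}) = {}" if "a \<in> S" "b \<in> S" "b \<notin> L a" for a b
  proof (rule ccontr)
    assume "\<not> ?thesis"
    then obtain z where z: "z \<in> L a" "z \<in> L b" "z \<noteq> p" by auto
    then have "tri p z a = 0" "tri p z b = 0" by (auto simp: L_def tri_permute_0)
    then have "tri p a b = 0" using tri_trans z(3) by metis
    then show False using that by (auto simp: L_def)
  qed
  have "card (S - {p}) > 0" using n7 n p fin by simp
  then obtain a where a: "a \<in> S" "a \<noteq> p" by (auto simp: card_gt_0_iff)
  obtain b where b: "b \<in> S" "tri p a b \<noteq> 0" using no_conic_imp_noncollinear[OF nc, of p a] a by metis
  have bp: "b \<noteq> p" using b by auto
  \<comment> \<open>Two lines through \<open>P\<close> form a conic, so a third one exists. Three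
    points besides \<open>P\<close> on each give nine, more than the eight available.\<close>
  obtain c where c: "c \<in> S" "tri p a c \<noteq> 0" "tri p b c \<noteq> 0"
    using nc is_conic_two_lines[of p a p b] a bp by blast
  have cp: "c \<noteq> p" using c by auto
  have dj: "(L a - {p}) \<inter> (L b - {p}) = {}" "((L a - {p}) \<union> (L b - {p})) \<inter> (L c - {p}) = {}"
    using Ldisj[OF a(1) b(1)] Ldisj[OF a(1) c(1)] Ldisj[OF b(1) c(1)] b c unfolding L_def by blast+
  have "card ((L a - {p}) \<union> (L b - {p}) \<union> (L c - {p})) = card (L a - {p}) + card (L b - {p}) + card (L c - {p})"
    using card_Un_disjoint[OF _ _ dj(1)] card_Un_disjoint[OF _ _ dj(2)] finL by simp
  moreover have "card ((L a - {p}) \<union> (L b - {p}) \<union> (L c - {p})) \<le> card S"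
    using fin by (intro card_mono) (auto simp: L_def)
  ultimately show False using fourL[OF a] fourL[OF b(1) bp] fourL[OF c(1) cp] n8 n by linarith
qed

section \<open>Point sets close to a conic\<close>

lemma finite_ordinary_conics:
  assumes "finite S"
  shows "finite {C. ordinary_conic S C}"
proof (rule inj_on_finite)
  show "inj_on (\<lambda>C. S \<inter> C) {C. ordinary_conic S C}"
    by (rule inj_onI) (auto simp: ordinary_conic_def)
  show "(\<lambda>C. S \<inter> C) ` {C. ordinary_conic S C} \<subseteq> Pow S" by auto
qed (use assms in simp)

text \<open>Each configuration in \<open>F\<close> is charged to an ordinary conic through its
  points. \<open>K\<close> lists the configurations that five given points can produce, so a conic
  receives at most \<open>m\<close> charges.\<close>

lemma card_le_ordinary_conics:
  assumes fin: "finite S" and sub: "F \<subseteq> (\<Union>C\<in>{C. ordinary_conic S C}. K (S \<inter> C))"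
    and K: "\<And>A. finite A \<Longrightarrow> card A = 5 \<Longrightarrow> finite (K A) \<and> card (K A) \<le> m"
  shows "card F \<le> m * card {C. ordinary_conic S C}"
proof -
  let ?O = "{C. ordinary_conic S C}"
  have KC: "finite (K (S \<inter> C)) \<and> card (K (S \<inter> C)) \<le> m" if "C \<in> ?O" for C
    using K[of "S \<inter> C"] that fin by (auto simp: ordinary_conic_def)
  have "card F \<le> card (\<Union>C\<in>?O. K (S \<inter> C))"
    using KC finite_ordinary_conics[OF fin] by (intro card_mono[OF _ sub]) auto
  also have "\<dots> \<le> (\<Sum>C\<in>?O. card (K (S \<inter> C)))" by (rule card_UN_le[OF finite_ordinary_conics[OF fin]])
  also have "\<dots> \<le> (\<Sum>C\<in>?O. m)" using KC by (intro sum_mono) auto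
  finally show ?thesis by (simp add: mult.commute)
qed

lemma card_Sigma_ge:
  assumes "finite A" "\<And>a. a \<in> A \<Longrightarrow> finite (B a)" "\<And>a. a \<in> A \<Longrightarrow> k \<le> real (card (B a))" "l \<le> real (card A)" "0 \<le> k"
  shows "l * k \<le> real (card (Sigma A B))"
proof -
  have "l * k \<le> real (card A) * k" using assms by (intro mult_right_mono) auto
  also have "\<dots> = (\<Sum>a\<in>A. k)" by simp
  also have "\<dots> \<le> (\<Sum>a\<in>A. real (card (B a)))" using assms by (intro sum_mono) auto
  also have "\<dots> = real (card (Sigma A B))" using assms by (subst card_SigmaI) auto
  finally show ?thesis .
qed

text \<open>With \<open>cross3_syntax\<close> the symbol \<open>\<times>\<close> on terms is the cross product.\<close>

abbreviation prod_set :: "'a set \<Rightarrow> 'b set \<Rightarrow> ('a \<times> 'b) set"  (infixr "\<otimes>" 80) where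
  "A \<otimes> B \<equiv> Sigma A (\<lambda>_. B)"

definition line_pts :: "(real \<times> real) set \<Rightarrow> real \<times> real \<Rightarrow> real \<times> real \<Rightarrow> (real \<times> real) set" where
  "line_pts S a b = {z \<in> S. tri a b z = 0}"

lemma finite_line_pts [simp]: "finite S \<Longrightarrow> finite (line_pts S a b)"
  by (simp add: line_pts_def)

definition gen_pos :: "real \<times> real \<Rightarrow> real \<times> real \<Rightarrow> real \<times> real \<Rightarrow> real \<times> real \<Rightarrow> bool" where
  "gen_pos a b c d \<longleftrightarrow> tri a b c \<noteq> 0 \<and> tri d b c \<noteq> 0 \<and> tri a d c \<noteq> 0 \<and> tri a b d \<noteq> 0"

lemma card_Diff_ge: "finite B \<Longrightarrow> real (card A) - real (card B) \<le> real (card (A - B))"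
  using diff_card_le_card_Diff[of B A] by linarith

text \<open>If no three points of \<open>A\<close> are collinear, any four distinct points qualify.
  Otherwise the conic contains a line and \<open>A\<close> lies on two lines; two points from each,
  off the other line, qualify. Each line has at most \<open>l\<close> points, so the other keeps at
  least \<open>m + 3\<close>.\<close>

lemma many_quadruples_in_general_position:
  assumes fin: "finite A" and con: "is_conic C0" "A \<subseteq> C0"
    and lines: "\<And>a b. a \<noteq> b \<Longrightarrow> real (card (line_pts A a b)) \<le> l" and l0: "0 \<le> l"
    and m: "m = real (card A) - l - 3" "0 \<le> m"
  shows "m ^ 4 \<le> real (card {(a, b, c, d). a \<in> A \<and> b \<in> A \<and> c \<in> A \<and> d \<in> A \<and> gen_pos a b c d})"
    (is "_ \<le> real (card ?G)")
proof -
  have finG: "finite ?G"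
    by (rule finite_subset[of _ "A \<otimes> A \<otimes> A \<otimes> A"]) (auto simp: fin)
  have c3: "real (card {a, b, c}) \<le> 3" for a b c :: "real \<times> real"
    using card_insert_le_m1[of 3 "{b, c}" a] card_insert_le_m1[of 2 "{c}" b] by simp
  show ?thesis
  proof (cases "\<exists>u\<in>A. \<exists>v\<in>A. \<exists>w\<in>A. u \<noteq> v \<and> v \<noteq> w \<and> w \<noteq> u \<and> tri u v w = 0")
    case False
    let ?F = "Sigma A (\<lambda>a. Sigma (A - {a}) (\<lambda>b. Sigma (A - {a, b}) (\<lambda>c. A - {a, b, c})))"
    have sub: "?F \<subseteq> ?G"
    proof
      fix t assume t: "t \<in> ?F"
      obtain a b c d where t': "t = (a, b, c, d)" by (cases t) auto
      have col: "tri u v w \<noteq> 0" if "u \<in> A" "v \<in> A" "w \<in> A" "u \<noteq> v" "v \<noteq> w" "w \<noteq> u" for u v w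
        using False that by blast
      have h: "a \<in> A" "b \<in> A" "c \<in> A" "d \<in> A" "a \<noteq> b" "a \<noteq> c" "a \<noteq> d" "b \<noteq> c" "b \<noteq> d" "c \<noteq> d"
        using t by (auto simp: t')
      then have "gen_pos a b c d" unfolding gen_pos_def using col[of a b c] col[of d b c] col[of a d c] col[of a b d] by blast
      then show "t \<in> ?G" using t by (simp add: t')
    qed
    have ge: "m \<le> real (card (A - {a, b, c}))" for a b c
      using card_Diff_ge[of "{a, b, c}" A] c3[of a b c] m l0 by simp
    have "m * (m * (m * m)) \<le> real (card ?F)"
      using ge[of _ _ _] ge[of a a a for a] ge[of a b b for a b] fin m l0
      by (intro card_Sigma_ge) auto
    then have "m ^ 4 \<le> real (card ?F)" by (simp add: power4_eq_xxxx mult.assoc)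
    also have "\<dots> \<le> real (card ?G)" using card_mono[OF finG sub] by simp
    finally show ?thesis .
  next
    case True
    then obtain u v w where uvw: "u \<in> A" "v \<in> A" "w \<in> A" "u \<noteq> v" "v \<noteq> w" "w \<noteq> u" "tri u v w = 0" by blast
    define A2 where "A2 = A - line_pts A u v"
    have A2: "real (card A2) \<ge> m + 3" unfolding A2_def
      using card_Diff_ge[of "line_pts A u v" A] lines[OF uvw(4)] fin m by simp
    then have "\<not> card A2 \<le> 1" using m by linarith
    then obtain e f where ef: "e \<in> A2" "f \<in> A2" "e \<noteq> f"
      by (metis card_le_Suc0_iff_eq One_nat_def A2_def fin finite_Diff)
    have D: "tri u v e \<noteq> 0" using ef by (auto simp: A2_def line_pts_def)
    obtain w0 where w0: "w0 \<noteq> 0" "C0 = {X. w0 \<bullet> tau u v e X = 0}"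
      using conic_through_three_points[OF D con(1)] uvw ef con(2) by (auto simp: A2_def)
    have "w0 \<bullet> tau u v e w = 0" using uvw con w0 by auto
    \<comment> \<open>The image of \<open>w\<close> is on the third axis. Once the third coefficient
      is gone, \<open>tri u v\<close> splits off from the equation and leaves the linear form of the
      second line.\<close>
    then have "w0$3 * (tri w v e * tri u w e) = 0" using uvw(7) by (simp add: inner_tau)
    moreover have "tri w v e \<noteq> 0" "tri u w e \<noteq> 0" using bary_vertex[OF D, of w] uvw by auto
    ultimately have w3: "w0$3 = 0" by simp
    then have w12: "w0$1 \<noteq> 0 \<or> w0$2 \<noteq> 0" using w0(1) by (auto simp: vec_eq_iff forall_3)
    have form: "w0$1 * tri u z e + w0$2 * tri z v e = 0" if "z \<in> A2" for z
    proof -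
      have "tri u v z \<noteq> 0" "z \<in> C0" using that con by (auto simp: A2_def line_pts_def)
      then have "(w0$1 * tri u z e + w0$2 * tri z v e) * tri u v z = 0"
        using w3 by (simp add: w0 inner_tau algebra_simps)
      then show ?thesis using \<open>tri u v z \<noteq> 0\<close> by simp
    qed
    have line: "tri e f z = 0" if "z \<in> A2" for z
    proof -
      have id: "tri u f e * tri z v e - tri u z e * tri f v e = - (tri u v e * tri e f z)"
        by (simp add: tri_def algebra_simps)
      have "w0$1 * (tri u f e * tri z v e - tri u z e * tri f v e) = 0"
        "w0$2 * (tri u f e * tri z v e - tri u z e * tri f v e) = 0"
        using form[OF that] form[OF ef(2)] by algebra+
      then show ?thesis using w12 D unfolding id by auto
    qed
    define A1 where "A1 = A - line_pts A e f"
    have A1: "real (card A1) \<ge> m + 3" unfolding A1_def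
      using card_Diff_ge[of "line_pts A e f" A] lines[OF ef(3)] fin m by simp
    have A1l: "tri u v z = 0" if "z \<in> A1" for z
      using that line[of z] by (auto simp: A1_def A2_def line_pts_def)
    have off1: "tri u v z \<noteq> 0" if "z \<in> A2" for z using that by (auto simp: A2_def line_pts_def)
    have off2: "tri e f z \<noteq> 0" if "z \<in> A1" for z using that by (auto simp: A1_def line_pts_def)
    have t1: "tri a b c \<noteq> 0" if "a \<in> A1" "b \<in> A1" "c \<in> A2" "a \<noteq> b" for a b c
    proof
      assume 0: "tri a b c = 0"
      have "tri u v a = 0" "tri u v b = 0" using A1l that by auto
      moreover have "tri u v u = 0" "tri u v v = 0" by simp_all
      ultimately have "tri a b u = 0" "tri a b v = 0" using tri_trans'[OF uvw(4)] by blast+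
      then have "tri u v c = 0" using tri_trans'[OF that(4)] 0 by blast
      then show False using off1 that by blast
    qed
    have t2: "tri a b c \<noteq> 0" if "a \<in> A2" "b \<in> A2" "c \<in> A1" "a \<noteq> b" for a b c
    proof
      assume 0: "tri a b c = 0"
      have "tri e f a = 0" "tri e f b = 0" using line that by auto
      moreover have "tri e f e = 0" "tri e f f = 0" by simp_all
      ultimately have "tri a b e = 0" "tri a b f = 0" using tri_trans'[OF ef(3)] by blast+
      then have "tri e f c = 0" using tri_trans'[OF that(4)] 0 by blast
      then show False using off2 that by blast
    qed
    let ?F = "Sigma A1 (\<lambda>a. Sigma (A1 - {a}) (\<lambda>b. Sigma A2 (\<lambda>c. A2 - {c})))"
    have sub: "?F \<subseteq> ?G"
    proof
      fix t assume t: "t \<in> ?F"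
      obtain a b c d where t': "t = (a, b, c, d)" by (cases t) auto
      have h: "a \<in> A1" "b \<in> A1" "a \<noteq> b" "c \<in> A2" "d \<in> A2" "c \<noteq> d" using t by (auto simp: t')
      have "tri a b c \<noteq> 0" "tri a b d \<noteq> 0" "tri c d a \<noteq> 0" "tri c d b \<noteq> 0"
        using t1[OF h(1,2) _ h(3)] t2[OF h(4,5) _ h(6)] h by blast+
      then have "gen_pos a b c d" unfolding gen_pos_def by (simp add: tri_permute_0)
      then show "t \<in> ?G" using h by (simp add: t' A1_def A2_def)
    qed
    have f12: "finite A1" "finite A2" using fin by (auto simp: A1_def A2_def)
    have ge: "m \<le> real (card (A1 - {a}))" "m \<le> real (card (A2 - {a}))" for a
      using card_Diff_ge[of "{a}" A1] card_Diff_ge[of "{a}" A2] A1 A2 by simp_all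
    have "m * (m * (m * m)) \<le> real (card ?F)"
      using ge A1 A2 f12 m by (intro card_Sigma_ge) auto
    then have "m ^ 4 \<le> real (card ?F)" by (simp add: power4_eq_xxxx mult.assoc)
    also have "\<dots> \<le> real (card ?G)" using card_mono[OF finG sub] by simp
    finally show ?thesis .
  qed
qed

text \<open>For given \<open>a\<close>, \<open>b\<close>, \<open>c\<close> with independent images
  of \<open>x\<close> and \<open>y\<close>, the conic through the five points meets
  \<open>C0\<close> in at most one further point \<open>d\<close>: this gives the cubic term.
  Dependent images occur only if two of \<open>a\<close>, \<open>b\<close>, \<open>c\<close> lie on
  the line \<open>xy\<close>. That line has at most two points of \<open>A\<close>, as
  \<open>C0\<close> would otherwise contain it. Three choices of the pair times 2 times 2 give the
  12.\<close>

lemma few_quadruples_through_extra_point: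
  assumes fin: "finite A" and con: "is_conic C0" "A \<subseteq> C0" and xy: "x \<notin> C0" "y \<notin> C0" "x \<noteq> y"
  shows "card {(a, b, c, d). a \<in> A \<and> b \<in> A \<and> c \<in> A \<and> d \<in> A \<and> gen_pos a b c d \<and>
      (tau a b c d \<times> tau a b c x) \<bullet> tau a b c y = 0} \<le> card A ^ 3 + 12 * card A ^ 2"
    (is "card ?B \<le> _")
proof -
  define L where "L = line_pts A x y"
  have finL: "finite L" using fin by (simp add: L_def)
  have L2: "card L \<le> 2"
  proof (rule ccontr)
    assume "\<not> ?thesis"
    then have "3 \<le> card L" by simp
    then obtain T where "T \<subseteq> L" "card T = 3" using obtain_subset_with_card_n by metis
    then obtain a b c where abc: "a \<in> L" "b \<in> L" "c \<in> L" "a \<noteq> b" "b \<noteq> c" "c \<noteq> a"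
      by (metis card_3_iff insertI1 insertI2 subset_iff)
    have l: "tri x y a = 0" "tri x y b = 0" "tri x y c = 0" "tri x y x = 0" using abc by (auto simp: L_def line_pts_def)
    have "tri a b c = 0" "tri a b x = 0" using tri_trans'[OF xy(3)] l by blast+
    then have "x \<in> C0" using conic_contains_line[OF con(1), of a b c x] abc con(2) by (auto simp: L_def line_pts_def)
    then show False using xy by blast
  qed
  have side: "s \<in> L \<and> t \<in> L" if "tri s t x = 0" "tri s t y = 0" "s \<noteq> t" "s \<in> A" "t \<in> A" for s t
  proof -
    have "tri x y s = 0" "tri x y t = 0" using tri_trans'[OF that(3), of x y] that by auto
    then show ?thesis using that by (auto simp: L_def line_pts_def)
  qed
  define B1 where "B1 = {(a, b, c, d). (a, b, c, d) \<in> ?B \<and> tau a b c x \<times> tau a b c y \<noteq> 0}"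
  have "?B \<subseteq> B1 \<union> (L \<otimes> L \<otimes> A \<otimes> A) \<union> (L \<otimes> A \<otimes> L \<otimes> A) \<union> (A \<otimes> L \<otimes> L \<otimes> A)"
  proof
    fix q assume q: "q \<in> ?B"
    obtain a b c d where q': "q = (a, b, c, d)" by (cases q) auto
    have h: "a \<in> A" "b \<in> A" "c \<in> A" "d \<in> A" "gen_pos a b c d" using q by (auto simp: q')
    then have D: "tri a b c \<noteq> 0" by (simp add: gen_pos_def)
    then have ne: "a \<noteq> b" "b \<noteq> c" "a \<noteq> c" by auto
    have notin: "x \<notin> {a, b, c}" "y \<notin> {a, b, c}" using h xy con by auto
    show "q \<in> B1 \<union> (L \<otimes> L \<otimes> A \<otimes> A) \<union> (L \<otimes> A \<otimes> L \<otimes> A) \<union> (A \<otimes> L \<otimes> L \<otimes> A)"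
    proof (cases "tau a b c x \<times> tau a b c y = 0")
      case False then show ?thesis using q by (simp add: B1_def q')
    next
      case par: True
      define \<alpha> \<beta> \<gamma> \<alpha>' \<beta>' \<gamma>' where g: "\<alpha> = tri x b c" "\<beta> = tri a x c" "\<gamma> = tri a b x"
        "\<alpha>' = tri y b c" "\<beta>' = tri a y c" "\<gamma>' = tri a b y"
      have v: "\<not> (\<alpha> = 0 \<and> \<beta> = 0)" "\<not> (\<alpha> = 0 \<and> \<gamma> = 0)" "\<not> (\<beta> = 0 \<and> \<gamma> = 0)"
        "\<not> (\<alpha>' = 0 \<and> \<beta>' = 0)" "\<not> (\<alpha>' = 0 \<and> \<gamma>' = 0)" "\<not> (\<beta>' = 0 \<and> \<gamma>' = 0)"
        using bary_vertex[OF D, of x] bary_vertex[OF D, of y] notin unfolding g by auto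
      have e: "\<alpha> * \<gamma> * (\<alpha>' * \<beta>') = \<alpha>' * \<gamma>' * (\<alpha> * \<beta>)" "\<alpha> * \<beta> * (\<beta>' * \<gamma>') = \<alpha>' * \<beta>' * (\<beta> * \<gamma>)"
        "\<beta> * \<gamma> * (\<alpha>' * \<gamma>') = \<beta>' * \<gamma>' * (\<alpha> * \<gamma>)"
        using par by (simp_all add: vec_eq_iff forall_3 cross_components g)
      have "\<not> (\<alpha> \<noteq> 0 \<and> \<beta> \<noteq> 0 \<and> \<gamma> \<noteq> 0 \<and> \<alpha>' \<noteq> 0 \<and> \<beta>' \<noteq> 0 \<and> \<gamma>' \<noteq> 0)"
        using tau_inj[OF D _ _ _ _ _ _ par] xy(3) unfolding g by blast
      then consider "\<alpha> = 0" | "\<beta> = 0" | "\<gamma> = 0" | "\<alpha>' = 0" | "\<beta>' = 0" | "\<gamma>' = 0" by blast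
      \<comment> \<open>If one point is on a side, proportionality of the images puts the other on a
        common side with it, since neither is a base point.\<close>
      then have "(\<alpha> = 0 \<and> \<alpha>' = 0) \<or> (\<beta> = 0 \<and> \<beta>' = 0) \<or> (\<gamma> = 0 \<and> \<gamma>' = 0)"
        using v e by cases (simp_all, blast+)
      then show ?thesis
        using side[of b c] side[of a c] side[of a b] h ne unfolding g q' by (auto simp: tri_permute_0)
    qed
  qed
  moreover have "card B1 \<le> card A ^ 3"
  proof -
    \<comment> \<open>\<open>C0\<close> and the conic through \<open>a\<close>, \<open>b\<close>,
      \<open>c\<close>, \<open>x\<close>, \<open>y\<close> are different image lines. Their single
      common point is the image of \<open>d\<close>, which determines \<open>d\<close>.\<close>
    have "inj_on (\<lambda>(a, b, c, d). (a, b, c)) B1"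
    proof (rule inj_onI)
      fix q q' assume q: "q \<in> B1" "q' \<in> B1" "(\<lambda>(a, b, c, d). (a, b, c)) q = (\<lambda>(a, b, c, d). (a, b, c)) q'"
      then obtain a b c d d' where q': "q = (a, b, c, d)" "q' = (a, b, c, d')" by (cases q, cases q') auto
      let ?t = "tau a b c"
      have h: "a \<in> A" "b \<in> A" "c \<in> A" "d \<in> A" "d' \<in> A" "gen_pos a b c d" "gen_pos a b c d'"
        "(?t d \<times> ?t x) \<bullet> ?t y = 0" "(?t d' \<times> ?t x) \<bullet> ?t y = 0" "?t x \<times> ?t y \<noteq> 0"
        using q unfolding q' by (auto simp: B1_def)
      have D: "tri a b c \<noteq> 0" using h by (simp add: gen_pos_def)
      obtain w0 where w0: "w0 \<noteq> 0" "C0 = {X. w0 \<bullet> ?t X = 0}"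
        using conic_through_three_points[OF D con(1)] h con(2) by blast
      define m where "m = ?t x \<times> ?t y"
      have m0: "m \<bullet> m \<noteq> 0" using h by (simp add: m_def)
      have "w0 \<times> m \<noteq> 0"
      proof
        assume "w0 \<times> m = 0"
        then have "m \<times> (w0 \<times> m) = 0" by simp
        then have "(m \<bullet> m) *\<^sub>R w0 = (m \<bullet> w0) *\<^sub>R m" using Lagrange[of m w0 m] by simp
        then have "(m \<bullet> m) * (w0 \<bullet> ?t x) = (m \<bullet> w0) * (m \<bullet> ?t x)" by (metis inner_scaleR_left)
        moreover have "m \<bullet> ?t x = 0" by (simp add: m_def inner_commute)
        ultimately show False using xy m0 w0 by simp
      qed
      moreover have "?t d \<bullet> w0 = 0" "?t d' \<bullet> w0 = 0" using h con w0 by (auto simp: inner_commute)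
      moreover have "?t d \<bullet> m = 0" "?t d' \<bullet> m = 0"
        using h cross_triple[of "?t d" "?t x" "?t y"] cross_triple[of "?t d'" "?t x" "?t y"]
        by (simp_all add: m_def inner_commute)
      ultimately obtain k k' where "?t d = k *\<^sub>R (w0 \<times> m)" "?t d' = k' *\<^sub>R (w0 \<times> m)"
        using orthogonal_imp_parallel_cross by metis
      then have "?t d \<times> ?t d' = 0" by (simp add: cross_mult_left cross_mult_right)
      then have "d = d'" using tau_inj[OF D] h by (simp add: gen_pos_def)
      then show "q = q'" by (simp add: q')
    qed
    then have "card B1 \<le> card (A \<otimes> A \<otimes> A)"
      by (rule card_inj_on_le) (auto simp: B1_def fin)
    then show ?thesis by (simp add: power3_eq_cube card_cartesian_product mult.assoc)
  qed
  moreover have "finite B1" by (rule finite_subset[of _ "A \<otimes> A \<otimes> A \<otimes> A"]) (auto simp: fin B1_def)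
  ultimately have "card ?B \<le> card (B1 \<union> (L \<otimes> L \<otimes> A \<otimes> A) \<union> (L \<otimes> A \<otimes> L \<otimes> A) \<union> (A \<otimes> L \<otimes> L \<otimes> A))"
    by (intro card_mono) (auto simp: fin finL)
  also have "\<dots> \<le> card B1 + card (L \<otimes> L \<otimes> A \<otimes> A) + card (L \<otimes> A \<otimes> L \<otimes> A) + card (A \<otimes> L \<otimes> L \<otimes> A)"
    by (intro order_trans[OF card_Un_le] add_mono order_refl)
  also have "\<dots> = card B1 + 3 * ((card L * card L) * (card A * card A))"
    by (simp add: card_cartesian_product algebra_simps)
  also have "\<dots> \<le> card A ^ 3 + 3 * ((2 * 2) * (card A * card A))"
    by (intro add_mono \<open>card B1 \<le> card A ^ 3\<close> mult_le_mono order_refl L2)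
  finally show ?thesis by (simp add: power2_eq_square)
qed

text \<open>Write \<open>k = 1 - c\<close>. There are at least \<open>(k * n / 2) ^ 4\<close>
  quadruples in general position. Each of the at most \<open>k ^ 4 / 10000 * n\<close> other points
  off \<open>C0\<close> spoils at most \<open>13 * n ^ 3\<close> of them. Since 1/16 - 13/10000
  exceeds 1/32 and a conic receives at most 625 quadruples, 1/20000 remains.\<close>

theorem many_ordinary_conics_near_conic:
  fixes c :: real
  assumes c: "0 < c" "c < 1" and fin: "finite S"
    and nc: "\<not> (\<exists>C. is_conic C \<and> S \<subseteq> C)"
    and lines: "\<And>a b. a \<noteq> b \<Longrightarrow> real (card (line_pts S a b)) \<le> c * real (card S)"
    and C0: "is_conic C0" "real (card (S - C0)) \<le> (1 - c) ^ 4 / 10000 * real (card S)"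
    and large: "real (card S) \<ge> 12 / (1 - c)"
  shows "real (card {C. ordinary_conic S C}) \<ge> (1 - c) ^ 4 / 20000 * real (card S) ^ 4"
proof -
  define n where "n = real (card S)"
  define k where "k = 1 - c"
  define A where "A = S \<inter> C0"
  have k: "0 < k" "k < 1" using c by (auto simp: k_def)
  have n1: "n * k \<ge> 12" using large k by (simp add: n_def k_def field_simps)
  have n0: "n > 0" using n1 k by (cases "n > 0") (auto simp: n_def)
  obtain x where x: "x \<in> S" "x \<notin> C0" using nc C0 by blast
  have finA: "finite A" using fin by (simp add: A_def)
  define G where "G = {(a, b, c, d). a \<in> A \<and> b \<in> A \<and> c \<in> A \<and> d \<in> A \<and> gen_pos a b c d}"
  define B where "B = (\<lambda>y. {(a, b, c, d). a \<in> A \<and> b \<in> A \<and> c \<in> A \<and> d \<in> A \<and> gen_pos a b c d \<and>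
      (tau a b c d \<times> tau a b c x) \<bullet> tau a b c y = 0})"
  define X where "X = S - C0 - {x}"
  have finG: "finite G" unfolding G_def
    by (rule finite_subset[of _ "A \<otimes> A \<otimes> A \<otimes> A"]) (auto simp: finA)
  have finX: "finite X" using fin by (simp add: X_def)
  have cA: "real (card A) \<ge> n - k ^ 4 / 10000 * n"
  proof -
    have "card S = card A + card (S - C0)" unfolding A_def
      using card_Int_Diff[OF fin] by simp
    then show ?thesis using C0(2) by (simp add: n_def k_def)
  qed
  have k4: "k ^ 4 \<le> k" using power_decreasing[of 1 4 k] k by simp
  have "real (card A) - c * n - 3 \<ge> k * n / 2"
  proof -
    have "k ^ 4 / 10000 * n \<le> k / 4 * n" using k4 n0 k by (intro mult_right_mono) auto
    moreover have "3 \<le> k * n / 4" using n1 by (simp add: mult.commute)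
    moreover have "c * n = n - k * n" by (simp add: k_def algebra_simps)
    ultimately show ?thesis using cA by (simp add: field_simps)
  qed
  then have "(k * n / 2) ^ 4 \<le> (real (card A) - c * n - 3) ^ 4" using k n0 by (intro power_mono) auto
  also have "\<dots> \<le> real (card G)"
    unfolding G_def
  proof (rule many_quadruples_in_general_position[OF finA C0(1) _ _ _ refl])
    show "A \<subseteq> C0" by (simp add: A_def)
    fix a b :: "real \<times> real" assume "a \<noteq> b"
    have "card (line_pts A a b) \<le> card (line_pts S a b)"
      using fin by (intro card_mono) (auto simp: line_pts_def A_def)
    then show "real (card (line_pts A a b)) \<le> c * n" using lines[OF \<open>a \<noteq> b\<close>] by (simp add: n_def)
  next
    show "0 \<le> c * n" using c n0 by simp
    show "0 \<le> real (card A) - c * n - 3"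
      using \<open>real (card A) - c * n - 3 \<ge> k * n / 2\<close> k n0 by (smt (verit) divide_nonneg_pos mult_nonneg_nonneg)
  qed
  finally have G: "k ^ 4 * n ^ 4 / 16 \<le> real (card G)" by (simp add: power_mult_distrib power_divide)
  have Bn: "real (card (B y)) \<le> 13 * n ^ 3" if "y \<in> X" for y
  proof -
    have "card (B y) \<le> card A ^ 3 + 12 * card A ^ 2" unfolding B_def
      by (rule few_quadruples_through_extra_point[OF finA C0(1)]) (use x that in \<open>auto simp: A_def X_def\<close>)
    also have "\<dots> \<le> card S ^ 3 + 12 * card S ^ 2"
      using card_mono[OF fin, of A] by (intro add_mono mult_le_mono power_mono order_refl) (auto simp: A_def)
    also have "\<dots> \<le> card S ^ 3 + 12 * card S ^ 3"
      using n0 by (intro add_mono mult_le_mono power_increasing order_refl) (auto simp: n_def)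
    finally have "card (B y) \<le> 13 * card S ^ 3" by simp
    then have "real (card (B y)) \<le> real (13 * card S ^ 3)" by (rule of_nat_mono)
    then show ?thesis by (simp add: n_def)
  qed
  have "real (card (\<Union>y\<in>X. B y)) \<le> (\<Sum>y\<in>X. real (card (B y)))"
    using card_UN_le[OF finX, of B] by (metis of_nat_mono of_nat_sum)
  also have "\<dots> \<le> (\<Sum>y\<in>X. 13 * n ^ 3)" by (intro sum_mono Bn)
  also have "\<dots> = real (card X) * (13 * n ^ 3)" by simp
  also have "\<dots> \<le> (k ^ 4 / 10000 * n) * (13 * n ^ 3)"
  proof (rule mult_right_mono)
    have "card X \<le> card (S - C0)" using fin by (intro card_mono) (auto simp: X_def)
    then show "real (card X) \<le> k ^ 4 / 10000 * n" using C0(2) by (simp add: n_def k_def)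
  qed (use n0 in simp)
  finally have Bad: "real (card (\<Union>y\<in>X. B y)) \<le> k ^ 4 * n ^ 4 * (13 / 10000)"
    by (simp add: power3_eq_cube power4_eq_xxxx)
  define F where "F = G - (\<Union>y\<in>X. B y)"
  have finB: "finite (\<Union>y\<in>X. B y)"
    by (rule finite_subset[OF _ finG]) (auto simp: B_def G_def)
  have "real (card F) \<ge> k ^ 4 * n ^ 4 / 16 - k ^ 4 * n ^ 4 * (13 / 10000)"
    unfolding F_def using card_Diff_ge[OF finB, of G] G Bad by linarith
  moreover have "0 \<le> k ^ 4 * n ^ 4" using k n0 by simp
  ultimately have F: "k ^ 4 * n ^ 4 / 32 \<le> real (card F)" by linarith
  have "card F \<le> 625 * card {C. ordinary_conic S C}"
  proof (rule card_le_ordinary_conics[OF fin, where K = "\<lambda>A. A \<otimes> A \<otimes> A \<otimes> A"])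
    show "F \<subseteq> (\<Union>C\<in>{C. ordinary_conic S C}. (S \<inter> C) \<otimes> (S \<inter> C) \<otimes> (S \<inter> C) \<otimes> (S \<inter> C))"
    proof
      fix q assume q: "q \<in> F"
      obtain a b c d where q': "q = (a, b, c, d)" by (cases q) auto
      have h: "{a, b, c, d} \<subseteq> S \<inter> C0" "gen_pos a b c d" using q by (auto simp: F_def G_def q' A_def)
      let ?C = "{X. (tau a b c d \<times> tau a b c x) \<bullet> tau a b c X = 0}"
      have only: "y \<notin> ?C" if "y \<in> S - C0" "y \<noteq> x" for y
        using q that h by (auto simp: F_def q' B_def X_def A_def)
      have gp: "tri a b c \<noteq> 0" "tri d b c \<noteq> 0" "tri a d c \<noteq> 0" "tri a b d \<noteq> 0" using h by (auto simp: gen_pos_def)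
      note oc = ordinary_conic_from_conic[OF C0(1) h(1) gp x only]
      show "q \<in> (\<Union>C\<in>{C. ordinary_conic S C}. (S \<inter> C) \<otimes> (S \<inter> C) \<otimes> (S \<inter> C) \<otimes> (S \<inter> C))"
      proof (rule UN_I)
        show "?C \<in> {C. ordinary_conic S C}" using oc(1) by simp
        show "q \<in> (S \<inter> ?C) \<otimes> (S \<inter> ?C) \<otimes> (S \<inter> ?C) \<otimes> (S \<inter> ?C)"
          using equalityD2[OF oc(2)] by (simp add: q')
      qed
    qed
  qed (auto simp: card_cartesian_product)
  then have "real (card F) \<le> real (625 * card {C. ordinary_conic S C})" by (rule of_nat_mono)
  then have "k ^ 4 * n ^ 4 / 32 \<le> 625 * real (card {C. ordinary_conic S C})" using F by simp
  then show ?thesis by (simp add: n_def k_def)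
qed

section \<open>Point sets far from all conics\<close>

text \<open>A coordinate of the cross product vanishes when the image line passes through that
  coordinate point. By these factorisations, for \<open>x\<close> and \<open>y\<close> off the sides
  this means that the line \<open>xy\<close> passes through the corresponding base point.\<close>

lemma cross_tau_nth:
  "(tau p q r x \<times> tau p q r y)$1 = - (tri x q r * tri y q r * (tri p q r * tri p x y))"
  "(tau p q r x \<times> tau p q r y)$2 = - (tri p x r * tri p y r * (tri p q r * tri q x y))"
  "(tau p q r x \<times> tau p q r y)$3 = - (tri p q x * tri p q y * (tri p q r * tri r x y))"
proof -
  have 1: "tri p x r * tri p q y - tri p q x * tri p y r = tri p q r * tri p x y"
    by (simp add: tri_def algebra_simps)
  have 2: "tri p q x * tri y q r - tri x q r * tri p q y = tri p q r * tri q x y"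
    by (simp add: tri_def algebra_simps)
  have 3: "tri x q r * tri p y r - tri p x r * tri y q r = tri p q r * tri r x y"
    by (simp add: tri_def algebra_simps)
  show "(tau p q r x \<times> tau p q r y)$1 = - (tri x q r * tri y q r * (tri p q r * tri p x y))"
    unfolding 1[symmetric] by (simp add: cross_components algebra_simps)
  show "(tau p q r x \<times> tau p q r y)$2 = - (tri p x r * tri p y r * (tri p q r * tri q x y))"
    unfolding 2[symmetric] by (simp add: cross_components algebra_simps)
  show "(tau p q r x \<times> tau p q r y)$3 = - (tri p q x * tri p q y * (tri p q r * tri r x y))"
    unfolding 3[symmetric] by (simp add: cross_components algebra_simps)
qed

lemma det3_expand:
  "det3 a b c = a$1 * (b \<times> c)$1 + b$1 * (c \<times> a)$1 + c$1 * (a \<times> b)$1"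
  "det3 a b c = a$2 * (b \<times> c)$2 + b$2 * (c \<times> a)$2 + c$2 * (a \<times> b)$2"
  "det3 a b c = a$3 * (b \<times> c)$3 + b$3 * (c \<times> a)$3 + c$3 * (a \<times> b)$3"
  by (simp_all add: cross_components inner_vec_def sum_3 algebra_simps)

lemma det3_axis: "det3 a b (axis i 1) = (a \<times> b)$i"
proof -
  have "det3 a b (axis i 1) = axis i 1 \<bullet> (a \<times> b)" using det3_rotate by metis
  then show ?thesis by (simp add: inner_axis' )
qed

definition off_sides :: "(real \<times> real) set \<Rightarrow> real \<times> real \<Rightarrow> real \<times> real \<Rightarrow> real \<times> real \<Rightarrow> (real \<times> real) set" where
  "off_sides S p q r = {x \<in> S. tri p q x \<noteq> 0 \<and> tri p r x \<noteq> 0 \<and> tri q r x \<noteq> 0}"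

text \<open>Points are counted and not lines: for \<open>a\<close> in \<open>S\<close>, a line
  through \<open>a\<close> with \<open>k\<close> points contributes \<open>k - 1\<close>.\<close>

definition degree_on :: "(real \<times> real) set \<Rightarrow> nat \<Rightarrow> real \<times> real \<Rightarrow> nat" where
  "degree_on S k a = card {x \<in> S. x \<noteq> a \<and> card (line_pts S a x) = k}"

definition completions :: "(real \<times> real) set \<Rightarrow> real \<times> real \<Rightarrow> real \<times> real \<Rightarrow> real \<times> real \<Rightarrow>
    ((real \<times> real) \<times> (real \<times> real)) set" where
  "completions S p q r = {(x, y). x \<in> S \<and> y \<in> S \<and> (\<exists>C. ordinary_conic S C \<and> S \<inter> C = {p, q, r, x, y})}"

lemma off_sides_permute:
  "off_sides S q p r = off_sides S p q r" "off_sides S r p q = off_sides S p q r"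
  by (auto simp: off_sides_def tri_permute_0)

text \<open>A line through \<open>p\<close> and a point off the sides meets \<open>pq\<close> and
  \<open>pr\<close> only in \<open>p\<close>. So it has just one point of \<open>S\<close> more than
  it has off the sides, unless it passes through a point of \<open>S\<close> on \<open>qr\<close>.
  Each point of \<open>S\<close> on \<open>qr\<close> accounts for at most one such line, with
  \<open>k\<close> points.\<close>

lemma card_off_sides_line_le:
  assumes fin: "finite S" and S: "p \<in> S" and D: "tri p q r \<noteq> 0"
  shows "card {x \<in> off_sides S p q r. card (line_pts (off_sides S p q r) p x) = k}
    \<le> degree_on S (Suc k) p + k * card (line_pts S q r)"
proof -
  define T where "T = off_sides S p q r"
  define E where "E = {x \<in> T. card (line_pts T p x) = k}"
  have finT: "finite T" using fin by (simp add: T_def off_sides_def)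
  have sub: "E \<subseteq> {x \<in> S. x \<noteq> p \<and> card (line_pts S p x) = Suc k} \<union> (\<Union>z\<in>line_pts S q r. {x \<in> E. tri p x z = 0})"
  proof
    fix x assume x: "x \<in> E"
    then have xT: "x \<in> T" "x \<in> S" "card (line_pts T p x) = k" by (auto simp: E_def T_def off_sides_def)
    have xs: "tri p q x \<noteq> 0" "tri p r x \<noteq> 0" "tri q r x \<noteq> 0" using xT by (auto simp: T_def off_sides_def)
    have xp: "x \<noteq> p" using xs by auto
    show "x \<in> {x \<in> S. x \<noteq> p \<and> card (line_pts S p x) = Suc k} \<union> (\<Union>z\<in>line_pts S q r. {x \<in> E. tri p x z = 0})"
    proof (cases "\<exists>z\<in>line_pts S q r. tri p x z = 0")
      case True then show ?thesis using x by blast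
    next
      case False
      have "line_pts S p x = insert p (line_pts T p x)"
      proof
        show "insert p (line_pts T p x) \<subseteq> line_pts S p x"
          using S by (auto simp: line_pts_def T_def off_sides_def)
        show "line_pts S p x \<subseteq> insert p (line_pts T p x)"
        proof
          fix z assume z: "z \<in> line_pts S p x"
          then have z': "z \<in> S" "tri p x z = 0" by (auto simp: line_pts_def)
          show "z \<in> insert p (line_pts T p x)"
          proof (cases "z = p")
            case zp: False
            have "tri q r z \<noteq> 0"
            proof
              assume "tri q r z = 0"
              then have "z \<in> line_pts S q r" using z' by (simp add: line_pts_def)
              then show False using False z' by blast
            qed
            moreover have "tri p q z \<noteq> 0"
            proof
              assume "tri p q z = 0"
              then have "tri p z q = 0" "tri p z x = 0" using z' by (auto simp: tri_permute_0)
              then have "tri p q x = 0" using tri_trans zp by metis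
              then show False using xs by simp
            qed
            moreover have "tri p r z \<noteq> 0"
            proof
              assume "tri p r z = 0"
              then have "tri p z r = 0" "tri p z x = 0" using z' by (auto simp: tri_permute_0)
              then have "tri p r x = 0" using tri_trans zp by metis
              then show False using xs by simp
            qed
            ultimately show ?thesis using z' by (simp add: line_pts_def T_def off_sides_def)
          qed simp
        qed
      qed
      moreover have "p \<notin> line_pts T p x" using D by (auto simp: line_pts_def T_def off_sides_def)
      ultimately have "card (line_pts S p x) = Suc k" using finT xT by simp
      then show ?thesis using xT xp by simp
    qed
  qed
  have fib: "card {x \<in> E. tri p x z = 0} \<le> k" if z: "z \<in> line_pts S q r" for z
  proof (cases "{x \<in> E. tri p x z = 0} = {}")
    case True
    show ?thesis unfolding True by simp
  next
    case False
    then obtain x0 where x0: "x0 \<in> E" "tri p x0 z = 0" by blast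
    have zp: "z \<noteq> p" using z D by (auto simp: line_pts_def tri_permute_0)
    have "{x \<in> E. tri p x z = 0} \<subseteq> line_pts T p x0"
    proof
      fix x assume x: "x \<in> {x \<in> E. tri p x z = 0}"
      then have "tri p z x0 = 0" "tri p z x = 0" using x0 by (auto simp: tri_permute_0)
      then have "tri p x0 x = 0" using tri_trans zp by metis
      then show "x \<in> line_pts T p x0" using x by (simp add: E_def line_pts_def)
    qed
    then have "card {x \<in> E. tri p x z = 0} \<le> card (line_pts T p x0)" using finT by (intro card_mono) auto
    then show ?thesis using x0 by (simp add: E_def)
  qed
  have finE: "finite E" using finT by (simp add: E_def)
  have "card E \<le> card ({x \<in> S. x \<noteq> p \<and> card (line_pts S p x) = Suc k} \<union> (\<Union>z\<in>line_pts S q r. {x \<in> E. tri p x z = 0}))"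
    using fin finE by (intro card_mono[OF _ sub]) auto
  also have "\<dots> \<le> degree_on S (Suc k) p + card (\<Union>z\<in>line_pts S q r. {x \<in> E. tri p x z = 0})"
    unfolding degree_on_def by (rule card_Un_le)
  also have "card (\<Union>z\<in>line_pts S q r. {x \<in> E. tri p x z = 0}) \<le> (\<Sum>z\<in>line_pts S q r. card {x \<in> E. tri p x z = 0})"
    using fin by (intro card_UN_le) auto
  also have "\<dots> \<le> (\<Sum>z\<in>line_pts S q r. k)" by (intro sum_mono fib)
  finally show ?thesis by (simp add: E_def T_def mult.commute)
qed

text \<open>Apply the linear bound on ordinary lines to the Cremona image of the points off the sides,
  once without and once with the three axes added. An ordinary line that avoids the axes is an
  ordinary conic through \<open>p\<close>, \<open>q\<close>, \<open>r\<close>. One through an axis comes from a line through a base point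
  containing exactly three (without axes) or exactly two (with axes) points of \<open>S\<close>, up to the few
  lines that meet the opposite side in \<open>S\<close>.\<close>

lemma triple_dichotomy:
  fixes S :: "(real \<times> real) set" and n :: real
  defines "n \<equiv> real (card S)"
  assumes fin: "finite S" and S: "p \<in> S" "q \<in> S" "r \<in> S" and D: "tri p q r \<noteq> 0"
    and poor: "real (card (line_pts S p q)) \<le> n / 96" "real (card (line_pts S p r)) \<le> n / 96"
      "real (card (line_pts S q r)) \<le> n / 96"
    and far: "\<And>C. is_conic C \<Longrightarrow> real (card (S - C)) >
      real (card (line_pts S p q)) + real (card (line_pts S p r)) + real (card (line_pts S q r))"
    and large: "n \<ge> 1000" and few: "real (card (completions S p q r)) < n / 60"
  shows "\<exists>a\<in>{p, q, r}. real (degree_on S 2 a) \<ge> n / 60" "\<exists>a\<in>{p, q, r}. real (degree_on S 3 a) \<ge> n / 60"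
proof -
  define T where "T = off_sides S p q r"
  define t where "t = tau p q r"
  define V where "V = t ` T"
  define E :: "(real^3) set" where "E = {axis 1 1, axis 2 1, axis 3 1}"
  define W where "W = V \<union> E"
  define G where "G = completions S p q r"
  have finT: "finite T" using fin by (simp add: T_def off_sides_def)
  have finG: "finite G" unfolding G_def completions_def
    by (rule finite_subset[of _ "S \<otimes> S"]) (auto simp: fin)
  have T: "tri x q r \<noteq> 0" "tri p x r \<noteq> 0" "tri p q x \<noteq> 0" "x \<in> S" if "x \<in> T" for x
    using that by (auto simp: T_def off_sides_def tri_permute_0)
  have ne: "p \<noteq> q" "q \<noteq> r" "p \<noteq> r" using D by auto
  have vert: "x \<noteq> p" "x \<noteq> q" "x \<noteq> r" if "x \<in> T" for x using T[OF that] by auto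
  have indep: "t x \<times> t y \<noteq> 0" if "x \<in> T" "y \<in> T" "x \<noteq> y" for x y
    using tau_inj[OF D T(1-3)[OF that(1)] T(1-3)[OF that(2)]] that unfolding t_def by blast
  have inj: "x = y" if "x \<in> T" "y \<in> T" "t x = t y" for x y
    using indep[OF that(1,2)] that(3) by auto
  have tnz: "t x $ i \<noteq> 0" if "x \<in> T" for x i
  proof -
    have "t x $ 1 \<noteq> 0" "t x $ 2 \<noteq> 0" "t x $ 3 \<noteq> 0" using T[OF that] by (simp_all add: t_def)
    then show ?thesis by (metis exhaust_3)
  qed
  have Eax: "e \<in> E \<Longrightarrow> \<exists>i. e = axis i 1" for e by (auto simp: E_def)
  have axE: "axis i 1 \<in> E" for i :: 3
    using exhaust_3[of i] unfolding E_def by auto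
  have tax: "t x \<times> axis i 1 \<noteq> 0" if "x \<in> T" for x i
  proof
    assume a: "t x \<times> axis i 1 = 0"
    consider "i = 1" | "i = 2" | "i = 3" using exhaust_3 by blast
    then show False
      using a tnz[OF that, of 1] tnz[OF that, of 2] tnz[OF that, of 3]
      by cases (simp_all add: vec_eq_iff forall_3 cross_components axis_def)
  qed
  have tnax: "t x \<noteq> axis i 1" if "x \<in> T" for x i using tax[OF that, of i] by auto
  have V: "pairwise_indep V" unfolding V_def pairwise_indep_def using indep by blast
  have W: "pairwise_indep W"
  proof -
    have "e \<times> e' \<noteq> 0" if "e \<in> E" "e' \<in> E" "e \<noteq> e'" for e e'
      using that by (auto simp: E_def cross_basis axis_eq_0_iff)
    moreover have "axis i 1 \<times> t x \<noteq> 0" if "x \<in> T" for x i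
      using tax[OF that, of i] cross_skew[of "axis i 1" "t x"] by simp
    moreover have "a \<times> b \<noteq> 0" if "a \<in> V" "b \<in> V" "a \<noteq> b" for a b
      using V that by (auto simp: pairwise_indep_def)
    moreover have "a \<times> b \<noteq> 0 \<and> b \<times> a \<noteq> 0" if "a \<in> V" "b \<in> E" for a b
      using that Eax[of b] tax calculation(2) by (auto simp: V_def)
    ultimately show ?thesis unfolding pairwise_indep_def W_def by blast
  qed
  have cT: "n - n / 32 \<le> real (card T)"
  proof -
    have "S \<subseteq> T \<union> line_pts S p q \<union> line_pts S p r \<union> line_pts S q r"
      by (auto simp: T_def off_sides_def line_pts_def)
    then have "card S \<le> card (T \<union> line_pts S p q \<union> line_pts S p r \<union> line_pts S q r)"
      using fin finT by (intro card_mono) auto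
    also have "\<dots> \<le> card T + card (line_pts S p q) + card (line_pts S p r) + card (line_pts S q r)"
      by (intro order_trans[OF card_Un_le] add_mono order_refl)
    finally show ?thesis using poor by (simp add: n_def)
  qed
  \<comment> \<open>A line containing all of \<open>V\<close> would be a conic that misses only
    points of \<open>S\<close> on the three sides, contrary to \<open>far\<close>.\<close>
  have span: "\<exists>v\<in>V. w \<bullet> v \<noteq> 0" if "w \<noteq> 0" for w
  proof (rule ccontr)
    assume a: "\<not> ?thesis"
    let ?C = "{X. w \<bullet> tau p q r X = 0}"
    have "S - ?C \<subseteq> line_pts S p q \<union> line_pts S p r \<union> line_pts S q r"
      using a by (auto simp: V_def T_def t_def off_sides_def line_pts_def)
    then have "card (S - ?C) \<le> card (line_pts S p q \<union> line_pts S p r \<union> line_pts S q r)"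
      using fin by (intro card_mono) auto
    also have "\<dots> \<le> card (line_pts S p q) + card (line_pts S p r) + card (line_pts S q r)"
      by (intro order_trans[OF card_Un_le] add_mono order_refl)
    finally show False using far[OF is_conic_tau[OF D that]] by linarith
  qed
  have finVW: "finite V" "finite W" using finT by (auto simp: V_def W_def E_def)
  have cV: "card V = card T" unfolding V_def by (rule card_image) (use inj in \<open>auto simp: inj_on_def\<close>)
  have cW: "card T \<le> card W" using card_mono[OF finVW(2), of V] cV by (simp add: W_def)
  have KV: "card T \<le> 6 * card (ordinary_lines V)" using card_le_6_ordinary_lines[OF finVW(1) V span] cV by simp
  have KW: "card T \<le> 6 * card (ordinary_lines W)"
    using card_le_6_ordinary_lines[OF finVW(2) W] span cW by (fastforce simp: W_def)
  have good: "(x, y) \<in> G"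
    if xy: "x \<in> T" "y \<in> T" "ordinary_pair V (t x) (t y)" and nz: "\<And>i. (t x \<times> t y)$i \<noteq> 0" for x y
  proof -
    have only: "z \<in> {p, q, r, x, y}" if z: "z \<in> S" "(tau p q r x \<times> tau p q r y) \<bullet> tau p q r z = 0" for z
    proof (cases "z \<in> T")
      case True
      have "det3 (t x) (t y) (t z) = 0"
        using z(2) cross_triple[of "t x" "t y" "t z"] by (simp add: t_def inner_commute)
      then have "t z = t x \<or> t z = t y" using xy(3) True by (auto simp: ordinary_pair_def V_def)
      then show ?thesis using inj[OF True xy(1)] inj[OF True xy(2)] by blast
    next
      case False
      then consider "tri z q r = 0" | "tri p z r = 0" | "tri p q z = 0"
        using z(1) by (auto simp: T_def off_sides_def tri_permute_0)
      then show ?thesis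
      proof cases
        case 1
        then have "tri p z r * tri p q z = 0" using z(2) nz[of 1] by (simp add: inner_tau t_def)
        then show ?thesis using bary_vertex[OF D, of z] 1 by auto
      next
        case 2
        then have "tri z q r * tri p q z = 0" using z(2) nz[of 2] by (simp add: inner_tau t_def)
        then show ?thesis using bary_vertex[OF D, of z] 2 by auto
      next
        case 3
        then have "tri z q r * tri p z r = 0" using z(2) nz[of 3] by (simp add: inner_tau t_def)
        then show ?thesis using bary_vertex[OF D, of z] 3 by auto
      qed
    qed
    have w: "tau p q r x \<times> tau p q r y \<noteq> 0" using nz[of 1] by (auto simp: t_def)
    then have "x \<noteq> y" by auto
    then have c5: "card {p, q, r, x, y} = 5" using ne vert[OF xy(1)] vert[OF xy(2)] by auto
    have sub: "{p, q, r, x, y} \<subseteq> S" using S T(4) xy by auto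
    show ?thesis using ordinary_conicI[OF D sub c5 w only] sub unfolding G_def completions_def by blast
  qed
  define c where "c = (\<lambda>i::3. if i = 1 then p else if i = 2 then q else r)"
  have c: "c 1 = p" "c 2 = q" "c 3 = r" by (simp_all add: c_def)
  have cr0: "(t x \<times> t y)$i = 0 \<longleftrightarrow> tri (c i) x y = 0" if "x \<in> T" "y \<in> T" for x y i
  proof -
    consider "i = 1" | "i = 2" | "i = 3" using exhaust_3 by blast
    then show ?thesis using T[OF that(1)] T[OF that(2)] D
      by cases (simp_all add: t_def cross_tau_nth c)
  qed
  have cx: "c i \<noteq> x" if "x \<in> T" for x i using vert[OF that] by (auto simp: c_def)
  \<comment> \<open>\<open>H 1\<close> captures the ordinary lines of \<open>W\<close> joining a
    point to an axis, and \<open>H 2\<close> the ordinary lines of \<open>V\<close> that pass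
    through an axis.\<close>
  define H where "H = (\<lambda>k i. {x \<in> T. card (line_pts T (c i) x) = k})"
  have H1: "x \<in> H 1 i" if x: "x \<in> T" "ordinary_pair W (t x) (axis i 1)" for x i
  proof -
    have "z = x" if z: "z \<in> T" "tri (c i) x z = 0" for z
    proof -
      have "(t x \<times> t z)$i = 0" using cr0 x z by blast
      then have "det3 (t x) (axis i 1) (t z) = 0" using det3_axis[of "t x" "t z" i] det3_swap'[of "t x" "axis i 1" "t z"] by linarith
      then have "t z = t x \<or> t z = axis i 1" using x(2) z by (auto simp: ordinary_pair_def W_def V_def)
      then show ?thesis using inj[OF z(1) x(1)] tnax[OF z(1)] by blast
    qed
    then have "line_pts T (c i) x = {x}" using x by (auto simp: line_pts_def)
    then show ?thesis using x by (simp add: H_def)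
  qed
  have H2: "x \<in> H 2 i" if x: "x \<in> T" "y \<in> T" "ordinary_pair V (t x) (t y)" "(t x \<times> t y)$i = 0" for x y i
  proof -
    have ci: "tri (c i) x y = 0" using cr0 x by blast
    have "z = x \<or> z = y" if z: "z \<in> T" "tri (c i) x z = 0" for z
    proof -
      have "tri (c i) y z = 0" using tri_trans[OF cx[OF x(1)]] ci z(2) by blast
      then have "(t y \<times> t z)$i = 0" "(t z \<times> t x)$i = 0"
        using cr0[of y z i] cr0[of z x i] x z by (auto simp: tri_permute_0)
      then have "t x $ i * (t y \<times> t z)$i + t y $ i * (t z \<times> t x)$i + t z $ i * (t x \<times> t y)$i = 0"
        using x(4) by simp
      then have "det3 (t x) (t y) (t z) = 0"
        using exhaust_3[of i] det3_expand[of "t x" "t y" "t z"] by metis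
      then have "t z = t x \<or> t z = t y" using x(3) z by (auto simp: ordinary_pair_def V_def)
      then show ?thesis using inj z x by blast
    qed
    then have "line_pts T (c i) x = {x, y}" using x ci by (auto simp: line_pts_def)
    moreover have "x \<noteq> y" using x(3) by (auto simp: ordinary_pair_def)
    ultimately show ?thesis using x by (simp add: H_def)
  qed
  have finH: "finite (H k i)" for k i using finT by (simp add: H_def)
  have Hle: "real (card (H k i)) \<le> real (degree_on S (Suc k) (c i)) + real k * (n / 96)" for k i
  proof -
    have *: "real k * real m \<le> real k * (n / 96)" if "real m \<le> n / 96" for m
      using that by (intro mult_left_mono) auto
    have D': "tri q p r \<noteq> 0" "tri r p q \<noteq> 0" using D by (simp_all add: tri_permute_0)
    have le: "real (card (H k i)) \<le> real (degree_on S (Suc k) (c i)) + real k * real m"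
      if "card (H k i) \<le> degree_on S (Suc k) (c i) + k * m" for m
      using that by (metis of_nat_add of_nat_mono of_nat_mult)
    consider "i = 1" | "i = 2" | "i = 3" using exhaust_3 by blast
    then show ?thesis
    proof cases
      case 1
      have "card (H k i) \<le> degree_on S (Suc k) (c i) + k * card (line_pts S q r)"
        using card_off_sides_line_le[OF fin S(1) D, of k] by (simp add: H_def T_def 1 c)
      then show ?thesis using le[of "card (line_pts S q r)"] *[OF poor(3)] poor(3) by linarith
    next
      case 2
      have "card (H k i) \<le> degree_on S (Suc k) (c i) + k * card (line_pts S p r)"
        using card_off_sides_line_le[OF fin S(2) D'(1), of k] by (simp add: H_def T_def 2 c off_sides_permute(1)[where p = p and q = q and r = r])
      then show ?thesis using le[of "card (line_pts S p r)"] *[OF poor(2)] poor(2) by linarith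
    next
      case 3
      have "card (H k i) \<le> degree_on S (Suc k) (c i) + k * card (line_pts S p q)"
        using card_off_sides_line_le[OF fin S(3) D'(2), of k] by (simp add: H_def T_def 3 c off_sides_permute(2)[where p = p and q = q and r = r])
      then show ?thesis using le[of "card (line_pts S p q)"] *[OF poor(1)] poor(1) by linarith
    qed
  qed
  have ex: "\<exists>a\<in>{p, q, r}. real (degree_on S k a) \<ge> n / 60"
    if "n / 20 \<le> real (degree_on S k p) + real (degree_on S k q) + real (degree_on S k r)" for k
    using that by (auto simp: not_le)
  have UNIV3: "(\<Sum>i\<in>UNIV. f i) = f 1 + f 2 + f 3" for f :: "3 \<Rightarrow> nat" by (simp add: sum_3)
  have imG: "card ((\<lambda>(x, y). {t x, t y}) ` G) \<le> card G" by (rule card_image_le[OF finG])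
  have sub2: "ordinary_lines W \<subseteq> Pow E \<union> (\<Union>i. (\<lambda>x. {t x, axis i 1}) ` H 1 i) \<union> (\<lambda>(x, y). {t x, t y}) ` G"
  proof
    fix l assume "l \<in> ordinary_lines W"
    then obtain a b where ab: "l = {a, b}" "ordinary_pair W a b" by (auto simp: ordinary_lines_def)
    have sym: "ordinary_pair W b a" using ab(2) det3_swap[of a b] by (auto simp: ordinary_pair_def)
    have "a \<in> W" "b \<in> W" using ab by (auto simp: ordinary_pair_def)
    then consider "a \<in> E" "b \<in> E" | x i where "x \<in> T" "a = t x" "b = axis i 1" | x i where "x \<in> T" "b = t x" "a = axis i 1"
      | x y where "x \<in> T" "y \<in> T" "a = t x" "b = t y"
      unfolding W_def V_def using Eax by blast
    then show "l \<in> Pow E \<union> (\<Union>i. (\<lambda>x. {t x, axis i 1}) ` H 1 i) \<union> (\<lambda>(x, y). {t x, t y}) ` G"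
    proof cases
      case 1 then show ?thesis by (simp add: ab)
    next
      case 2 then show ?thesis using H1[of x i] ab by auto
    next
      case 3 then show ?thesis using H1[of x i] ab sym by (auto simp: insert_commute)
    next
      case 4
      have "(t x \<times> t y)$i \<noteq> 0" for i
      proof
        assume "(t x \<times> t y)$i = 0"
        then have "det3 a b (axis i 1) = 0" using det3_axis 4 by simp
        moreover have "axis i 1 \<in> W" using axE by (simp add: W_def)
        ultimately have "axis i 1 = a \<or> axis i 1 = b" using ab(2) by (auto simp: ordinary_pair_def)
        then show False using tnax[OF 4(1), of i] tnax[OF 4(2), of i] 4 by auto
      qed
      moreover have "ordinary_pair V (t x) (t y)" using ab(2) 4 by (auto simp: ordinary_pair_def W_def V_def)
      ultimately have "(x, y) \<in> G" using good 4 by blast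
      then show ?thesis using ab 4 by (auto intro: image_eqI[of _ _ "(x, y)"])
    qed
  qed
  have cE: "card (Pow E) \<le> 8"
  proof -
    have "card E \<le> Suc (Suc (Suc 0))" unfolding E_def by (simp add: card_insert_if)
    moreover have "finite E" by (simp add: E_def)
    ultimately show ?thesis using power_increasing[of "card E" 3 "2::nat"] by (simp add: card_Pow numeral_3_eq_3)
  qed
  have fU1: "finite (\<Union>i. (\<lambda>x. {t x, axis i 1}) ` H 1 i)" using finH by simp
  have "card (ordinary_lines W) \<le> card (Pow E) + card (\<Union>i. (\<lambda>x. {t x, axis i 1}) ` H 1 i) + card ((\<lambda>(x, y). {t x, t y}) ` G)"
    by (rule order_trans[OF card_mono[OF _ sub2]], use fU1 finG in \<open>simp add: E_def\<close>)
       (intro order_trans[OF card_Un_le] add_mono order_refl)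
  also have "card (\<Union>i. (\<lambda>x. {t x, axis i 1}) ` H 1 i) \<le> (\<Sum>i\<in>UNIV. card (H 1 i))"
    by (rule order_trans[OF card_UN_le sum_mono]) (auto intro: card_image_le finH)
  finally have "card (ordinary_lines W) \<le> 8 + (card (H 1 1) + card (H 1 2) + card (H 1 3)) + card G"
    using cE imG unfolding UNIV3 by linarith
  then have "real (card (ordinary_lines W)) \<le> 8 + (real (card (H 1 1)) + real (card (H 1 2)) + real (card (H 1 3))) + real (card G)"
    by linarith
  moreover have "real (card T) \<le> 6 * real (card (ordinary_lines W))" using KW by linarith
  \<comment> \<open>The linear bound gives 31/192 of \<open>n\<close>. Losing 3/96 to the sides,
    1/60 to the conics and the 8 subsets of \<open>E\<close>, at most 1/125 of \<open>n\<close>,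
    leaves more than 1/20.\<close>
  ultimately have "n / 20 \<le> real (degree_on S 2 p) + real (degree_on S 2 q) + real (degree_on S 2 r)"
    using cT few large Hle[of 1 1] Hle[of 1 2] Hle[of 1 3] by (simp add: c G_def numeral_2_eq_2)
  then show "\<exists>a\<in>{p, q, r}. real (degree_on S 2 a) \<ge> n / 60" by (rule ex)
  have sub1: "ordinary_lines V \<subseteq> (\<Union>i. (\<lambda>x. t ` line_pts T (c i) x) ` H 2 i) \<union> (\<lambda>(x, y). {t x, t y}) ` G"
  proof
    fix l assume "l \<in> ordinary_lines V"
    then obtain a b where ab: "l = {a, b}" "ordinary_pair V a b" by (auto simp: ordinary_lines_def)
    then obtain x y where xy: "x \<in> T" "y \<in> T" "a = t x" "b = t y" by (auto simp: ordinary_pair_def V_def)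
    show "l \<in> (\<Union>i. (\<lambda>x. t ` line_pts T (c i) x) ` H 2 i) \<union> (\<lambda>(x, y). {t x, t y}) ` G"
    proof (cases "\<exists>i. (t x \<times> t y)$i = 0")
      case True
      then obtain i where i: "(t x \<times> t y)$i = 0" by blast
      have xH: "x \<in> H 2 i" using H2[OF xy(1,2) _ i] ab xy by simp
      have "{x, y} \<subseteq> line_pts T (c i) x" using xy cr0[OF xy(1,2)] i by (auto simp: line_pts_def)
      moreover have "x \<noteq> y" using ab xy by (auto simp: ordinary_pair_def)
      moreover have "card (line_pts T (c i) x) = 2" using xH by (simp add: H_def)
      ultimately have "{x, y} = line_pts T (c i) x"
        using card_subset_eq[of "line_pts T (c i) x" "{x, y}"] finT by simp
      then have "l = t ` line_pts T (c i) x" using ab xy by auto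
      then show ?thesis using xH by blast
    next
      case False
      then have "(x, y) \<in> G" using good[OF xy(1,2)] ab xy by blast
      then show ?thesis using ab xy by (auto intro: image_eqI[of _ _ "(x, y)"])
    qed
  qed
  have fU2: "finite (\<Union>i. (\<lambda>x. t ` line_pts T (c i) x) ` H 2 i)" using finH by simp
  have "card (ordinary_lines V) \<le> card (\<Union>i. (\<lambda>x. t ` line_pts T (c i) x) ` H 2 i) + card ((\<lambda>(x, y). {t x, t y}) ` G)"
    by (rule order_trans[OF card_mono[OF _ sub1] card_Un_le]) (use fU2 finG in simp)
  also have "card (\<Union>i. (\<lambda>x. t ` line_pts T (c i) x) ` H 2 i) \<le> (\<Sum>i\<in>UNIV. card (H 2 i))"
    by (rule order_trans[OF card_UN_le sum_mono]) (auto intro: card_image_le finH)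
  finally have "card (ordinary_lines V) \<le> (card (H 2 1) + card (H 2 2) + card (H 2 3)) + card G"
    using imG unfolding UNIV3 by linarith
  then have "real (card (ordinary_lines V)) \<le> (real (card (H 2 1)) + real (card (H 2 2)) + real (card (H 2 3))) + real (card G)"
    by linarith
  moreover have "real (card T) \<le> 6 * real (card (ordinary_lines V))" using KV by linarith
  \<comment> \<open>Now the sides cost 6/96, since \<open>k = 2\<close>, and there are no pairs of
    axes; again more than 1/20 of \<open>n\<close> is left.\<close>
  ultimately have "n / 20 \<le> real (degree_on S 3 p) + real (degree_on S 3 q) + real (degree_on S 3 r)"
    using cT few large Hle[of 2 1] Hle[of 2 2] Hle[of 2 3] by (simp add: c G_def numeral_3_eq_3 numeral_2_eq_2)
  then show "\<exists>a\<in>{p, q, r}. real (degree_on S 3 a) \<ge> n / 60" by (rule ex)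
qed

section \<open>Triangles with poor sides, and pairs of two-point and three-point lines\<close>

lemma line_pts_eq:
  assumes "a \<noteq> b" "x \<in> line_pts S a b" "y \<in> line_pts S a b" "x \<noteq> y"
  shows "line_pts S x y = line_pts S a b"
proof -
  have xy: "tri a b x = 0" "tri a b y = 0" using assms by (auto simp: line_pts_def)
  have "tri x y z = 0 \<longleftrightarrow> tri a b z = 0" for z
  proof
    assume "tri a b z = 0"
    then show "tri x y z = 0" using tri_trans'[OF assms(1)] xy by blast
  next
    assume z: "tri x y z = 0"
    have "tri x y a = 0" "tri x y b = 0" using tri_trans'[OF assms(1) xy, of a] tri_trans'[OF assms(1) xy, of b] by auto
    then show "tri a b z = 0" using tri_trans'[OF assms(4)] z by blast
  qed
  then show ?thesis by (simp add: line_pts_def)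
qed

lemma many_poor_triples:
  fixes S :: "(real \<times> real) set" and \<eta> \<delta> n :: real
  defines "n \<equiv> real (card S)" and "K \<equiv> (2 / \<delta>\<^sup>2)\<^sup>2"
  assumes fin: "finite S" and pos: "0 < \<delta>" "\<delta> \<le> \<eta> / 8" "\<eta> < 1"
    and far: "\<And>C. is_conic C \<Longrightarrow> real (card (S - C)) \<ge> \<eta> * n"
    and large: "\<delta> * n \<ge> 2" "\<eta> * n \<ge> 8 * (K + 1)"
  shows "(\<eta> / 2) ^ 3 * n ^ 3 \<le> real (card {(p, q, r). p \<in> S \<and> q \<in> S \<and> r \<in> S \<and> tri p q r \<noteq> 0 \<and>
      real (card (line_pts S p q)) \<le> \<delta> * n \<and> real (card (line_pts S p r)) \<le> \<delta> * n \<and>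
      real (card (line_pts S q r)) \<le> \<delta> * n})" (is "_ \<le> real (card ?Tr)")
proof -
  have n0: "n > 0" using large(1) pos by (cases "n > 0") (auto simp: n_def)
  define R where "R = {line_pts S a b | a b. a \<in> S \<and> b \<in> S \<and> a \<noteq> b \<and> real (card (line_pts S a b)) > \<delta> * n}"
  have finR: "finite R"
    by (rule finite_subset[of _ "Pow S"]) (auto simp: R_def line_pts_def fin)
  have Rsub: "l \<subseteq> S" "finite l" if "l \<in> R" for l using that fin by (auto simp: R_def line_pts_def)
  have Rmeet: "x = y" if ll: "l \<in> R" "l' \<in> R" "l \<noteq> l'" "x \<in> l \<inter> l'" "y \<in> l \<inter> l'" for l l' x y
  proof (rule ccontr)
    assume xy: "x \<noteq> y"
    obtain a b where ab: "l = line_pts S a b" "a \<noteq> b" using ll(1) by (auto simp: R_def)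
    obtain a' b' where ab': "l' = line_pts S a' b'" "a' \<noteq> b'" using ll(2) by (auto simp: R_def)
    show False using line_pts_eq[OF ab(2), of x S y] line_pts_eq[OF ab'(2), of x S y] ab ab' ll xy by auto
  qed
  \<comment> \<open>Rich lines have disjoint sets of ordered pairs of distinct points.\<close>
  have cR: "real (card R) \<le> 2 / \<delta>\<^sup>2"
  proof -
    define pr where "pr = (\<lambda>l :: (real \<times> real) set. Sigma l (\<lambda>x. l - {x}))"
    have finpr: "finite (pr l)" if "l \<in> R" for l using Rsub[OF that] by (simp add: pr_def)
    have "(\<Sum>l\<in>R. real (card (pr l))) = real (card (\<Union>l\<in>R. pr l))"
    proof -
      have "card (\<Union>l\<in>R. pr l) = (\<Sum>l\<in>R. card (pr l))"
      proof (rule card_UN_disjoint)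
        show "\<forall>i\<in>R. \<forall>j\<in>R. i \<noteq> j \<longrightarrow> pr i \<inter> pr j = {}"
        proof (intro ballI impI)
          fix i j assume "i \<in> R" "j \<in> R" "i \<noteq> j"
          then show "pr i \<inter> pr j = {}" using Rmeet[of i j] unfolding pr_def by blast
        qed
      qed (use finR finpr in auto)
      then show ?thesis by simp
    qed
    also have "\<dots> \<le> real (card (S \<otimes> S))"
      using Rsub fin by (intro of_nat_mono card_mono) (auto simp: pr_def)
    also have "\<dots> = n ^ 2" by (simp add: card_cartesian_product n_def power2_eq_square)
    finally have le: "(\<Sum>l\<in>R. real (card (pr l))) \<le> n ^ 2" .
    have "\<delta>\<^sup>2 * n\<^sup>2 / 2 \<le> real (card (pr l))" if l: "l \<in> R" for l
    proof -
      have c: "real (card l) > \<delta> * n" using l by (auto simp: R_def)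
      have "\<delta> * n / 2 \<le> \<delta> * n - 1" using large by simp
      then have "(\<delta> * n) * (\<delta> * n / 2) \<le> (\<delta> * n) * (\<delta> * n - 1)" using pos n0 by (intro mult_left_mono) auto
      also have "\<dots> \<le> real (card (pr l))"
        unfolding pr_def
      proof (rule card_Sigma_ge)
        fix x assume "x \<in> l"
        show "\<delta> * n - 1 \<le> real (card (l - {x}))" using card_Diff_ge[of "{x}" l] c by simp
      qed (use Rsub[OF l] c large in auto)
      finally show ?thesis by (simp add: power2_eq_square algebra_simps)
    qed
    then have "(\<Sum>l\<in>R. \<delta>\<^sup>2 * n\<^sup>2 / 2) \<le> (\<Sum>l\<in>R. real (card (pr l)))" by (intro sum_mono)
    then have "real (card R) * (\<delta>\<^sup>2 * n\<^sup>2 / 2) \<le> n\<^sup>2" using le by simp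
    then have "(real (card R) * \<delta>\<^sup>2) * n\<^sup>2 \<le> 2 * n\<^sup>2" by (simp add: algebra_simps)
    then have "real (card R) * \<delta>\<^sup>2 \<le> 2" using n0 by simp
    then show ?thesis using pos by (simp add: field_simps)
  qed
  define M where "M = (\<Union>(l, l')\<in>{(l, l'). l \<in> R \<and> l' \<in> R \<and> l \<noteq> l'}. l \<inter> l')"
  have finM: "finite M"
    by (rule finite_subset[of _ S]) (use Rsub fin in \<open>auto simp: M_def\<close>)
  have cM: "real (card M) \<le> K"
  proof -
    let ?P = "{(l, l'). l \<in> R \<and> l' \<in> R \<and> l \<noteq> l'}"
    have PR: "?P \<subseteq> R \<otimes> R" by auto
    have finP: "finite ?P" by (rule finite_subset[OF PR]) (simp add: finR)
    have "card M \<le> (\<Sum>(l, l')\<in>?P. card (l \<inter> l'))"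
      unfolding M_def using card_UN_le[OF finP, of "\<lambda>(l, l'). l \<inter> l'"] by (simp add: case_prod_unfold)
    also have "\<dots> \<le> (\<Sum>(l, l')\<in>?P. 1)"
    proof (rule sum_mono, clarify)
      fix l l' assume "l \<in> R" "l' \<in> R" "l \<noteq> l'"
      then have "\<forall>x\<in>l \<inter> l'. \<forall>y\<in>l \<inter> l'. x = y" using Rmeet[of l l'] by blast
      then show "card (l \<inter> l') \<le> 1" using Rsub[OF \<open>l \<in> R\<close>] card_le_Suc0_iff_eq[of "l \<inter> l'"] by simp
    qed
    also have "\<dots> = card ?P" by (simp add: case_prod_unfold)
    also have "\<dots> \<le> card (R \<otimes> R)" by (rule card_mono[OF _ PR]) (simp add: finR)
    also have "\<dots> = card R * card R" by (simp add: card_cartesian_product)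
    finally have "real (card M) \<le> real (card R) * real (card R)" by (metis of_nat_mono of_nat_mult)
    also have "\<dots> \<le> (2 / \<delta>\<^sup>2) * (2 / \<delta>\<^sup>2)" using cR pos by (intro mult_mono) auto
    finally show ?thesis by (simp add: K_def power2_eq_square)
  qed
  define S0 where "S0 = S - M"
  define Rich where "Rich = (\<lambda>p. \<Union>{l \<in> R. p \<in> l})"
  have finS0: "finite S0" using fin by (simp add: S0_def)
  have RichL: "\<exists>a b. a \<noteq> b \<and> Rich p \<subseteq> {z. tri a b z = 0}" if p: "p \<in> S0" for p
  proof (cases "\<exists>l\<in>R. p \<in> l")
    case True
    then obtain l where l: "l \<in> R" "p \<in> l" by blast
    have "l' = l" if "l' \<in> R" "p \<in> l'" for l'
    proof (rule ccontr)
      assume "l' \<noteq> l"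
      then have "p \<in> M" using l that unfolding M_def by blast
      then show False using p by (simp add: S0_def)
    qed
    then have "Rich p \<subseteq> l" by (auto simp: Rich_def)
    then show ?thesis using l(1) unfolding R_def line_pts_def by blast
  next
    case False
    then have "Rich p = {}" by (auto simp: Rich_def)
    \<comment> \<open>If \<open>p\<close> is on no rich line, any line will do.\<close>
    moreover have "(0, 0) \<noteq> (1 :: real, 0 :: real)" by simp
    ultimately show ?thesis by blast
  qed
  have rest: "\<eta> * n - K \<le> real (card (S0 - (Rich p \<union> Rich q)))" if pq: "p \<in> S0" "q \<in> S0" for p q
  proof -
    obtain a b where ab: "a \<noteq> b" "Rich p \<subseteq> {z. tri a b z = 0}" using RichL[OF pq(1)] by blast
    obtain c d where cd: "c \<noteq> d" "Rich q \<subseteq> {z. tri c d z = 0}" using RichL[OF pq(2)] by blast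
    let ?C = "{X. tri a b X = 0 \<or> tri c d X = 0}"
    have "\<eta> * n \<le> real (card (S - ?C))" by (rule far[OF is_conic_two_lines[OF ab(1) cd(1)]])
    moreover have "real (card (S - ?C)) - real (card M) \<le> real (card (S - ?C - M))" by (rule card_Diff_ge[OF finM])
    moreover have "card (S - ?C - M) \<le> card (S0 - (Rich p \<union> Rich q))"
      using ab(2) cd(2) finS0 by (intro card_mono) (auto simp: S0_def)
    ultimately show ?thesis using cM by linarith
  qed
  have poor: "real (card (line_pts S p q)) \<le> \<delta> * n" if "p \<in> S" "q \<in> S" "p \<noteq> q" "q \<notin> Rich p" for p q
  proof (rule ccontr)
    assume "\<not> ?thesis"
    then have "line_pts S p q \<in> R" using that unfolding R_def not_le by blast
    moreover have "p \<in> line_pts S p q" "q \<in> line_pts S p q" using that by (auto simp: line_pts_def)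
    ultimately show False using that by (auto simp: Rich_def)
  qed
  \<comment> \<open>\<open>q\<close> avoids the rich line of \<open>p\<close>, and \<open>r\<close>
    avoids the rich lines of \<open>p\<close> and \<open>q\<close> as well as the poor line
    \<open>pq\<close>. Thus all sides are poor, and every choice still has at least
    \<open>\<eta> / 2 * n\<close> candidates.\<close>
  let ?F = "Sigma S0 (\<lambda>p. Sigma (S0 - Rich p - {p}) (\<lambda>q. S0 - (Rich p \<union> Rich q) - line_pts S p q))"
  have sub: "?F \<subseteq> ?Tr"
  proof
    fix u assume u: "u \<in> ?F"
    obtain p q r where u': "u = (p, q, r)" by (cases u) auto
    have h: "p \<in> S" "q \<in> S" "r \<in> S" "q \<notin> Rich p" "p \<noteq> q" "r \<notin> Rich p" "r \<notin> Rich q" "r \<notin> line_pts S p q"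
      using u by (auto simp: u' S0_def)
    have tr: "tri p q r \<noteq> 0" using h by (simp add: line_pts_def)
    then have "p \<noteq> r" "q \<noteq> r" by auto
    then show "u \<in> ?Tr" using h tr poor[of p q] poor[of p r] poor[of q r] by (simp add: u')
  qed
  have K0: "K \<ge> 0" by (simp add: K_def)
  have dn: "\<delta> * n \<le> \<eta> * n / 8" using mult_right_mono[OF pos(2), of n] n0 by simp
  have "(\<eta> / 2 * n) * ((\<eta> / 2 * n) * (\<eta> / 2 * n)) \<le> real (card ?F)"
  proof (rule card_Sigma_ge)
    show "\<eta> / 2 * n \<le> real (card S0)"
    proof -
      have "n - K \<le> real (card S0)" unfolding S0_def n_def using card_Diff_ge[OF finM, of S] cM by linarith
      moreover obtain x where x: "x = \<eta> * n" by blast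
      moreover have "x \<le> n" unfolding x using pos n0 by simp
      ultimately have "x / 2 \<le> real (card S0)" using large(2) K0 unfolding x[symmetric] by (simp add: field_simps)
      then show ?thesis by (simp add: x)
    qed
    show "0 \<le> \<eta> / 2 * n * (\<eta> / 2 * n)" by simp
    fix p assume p: "p \<in> S0"
    show "\<eta> / 2 * n * (\<eta> / 2 * n) \<le> real (card (Sigma (S0 - Rich p - {p}) (\<lambda>q. S0 - (Rich p \<union> Rich q) - line_pts S p q)))"
    proof (rule card_Sigma_ge)
      show "\<eta> / 2 * n \<le> real (card (S0 - Rich p - {p}))"
        using rest[OF p p] card_Diff_ge[of "{p}" "S0 - Rich p"] large(2) K0 by simp
      show "0 \<le> \<eta> / 2 * n" using pos n0 by simp
      fix q assume q: "q \<in> S0 - Rich p - {p}"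
      have "real (card (line_pts S p q)) \<le> \<delta> * n" using poor[of p q] p q by (auto simp: S0_def)
      moreover have "real (card (S0 - (Rich p \<union> Rich q))) - real (card (line_pts S p q))
         \<le> real (card (S0 - (Rich p \<union> Rich q) - line_pts S p q))"
        by (rule card_Diff_ge) (simp add: fin)
      ultimately show "\<eta> / 2 * n \<le> real (card (S0 - (Rich p \<union> Rich q) - line_pts S p q))"
        using rest[of p q] p q large(2) K0 dn by (simp add: field_simps)
    qed (use finS0 in auto)
  qed (use finS0 in auto)
  then have "(\<eta> / 2) ^ 3 * n ^ 3 \<le> real (card ?F)" by (simp add: power3_eq_cube algebra_simps)
  also have "\<dots> \<le> real (card ?Tr)"
  proof -
    have "finite ?Tr" by (rule finite_subset[of _ "S \<otimes> S \<otimes> S"]) (auto simp: fin)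
    then show ?thesis using card_mono[OF _ sub] by simp
  qed
  finally show ?thesis .
qed

lemma card_triples_meeting_le:
  assumes "finite S" "H \<subseteq> S"
  shows "card {(p, q, r). p \<in> S \<and> q \<in> S \<and> r \<in> S \<and> (p \<in> H \<or> q \<in> H \<or> r \<in> H)} \<le> 3 * (card H * card S ^ 2)"
    (is "card ?X \<le> _")
proof -
  have finH: "finite H" using assms finite_subset by blast
  have "card ?X \<le> card ((H \<otimes> S \<otimes> S) \<union> (S \<otimes> H \<otimes> S) \<union> (S \<otimes> S \<otimes> H))"
    using assms finH by (intro card_mono) auto
  also have "\<dots> \<le> card (H \<otimes> S \<otimes> S) + card (S \<otimes> H \<otimes> S) + card (S \<otimes> S \<otimes> H)"
    by (intro order_trans[OF card_Un_le] add_mono order_refl)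
  finally show ?thesis by (simp add: card_cartesian_product power2_eq_square algebra_simps)
qed

text \<open>A point belongs to at most \<open>3 * n ^ 2\<close> of the triples, so at least
  \<open>b * n / 3\<close> points have degree \<open>n / 60\<close> or more. The product of these
  two numbers is the bound.\<close>

lemma many_rich_pairs:
  fixes S :: "(real \<times> real) set" and n b :: real
  defines "n \<equiv> real (card S)"
  assumes fin: "finite S" and n0: "n > 0" and b: "0 \<le> b"
    and X: "\<And>p q r. (p, q, r) \<in> X \<Longrightarrow> p \<in> S \<and> q \<in> S \<and> r \<in> S \<and> (\<exists>a\<in>{p, q, r}. real (degree_on S k a) \<ge> n / 60)"
    and cX: "b * n ^ 3 \<le> real (card X)"
  shows "b / 180 * n ^ 2 \<le> real (card {(a, x). a \<in> S \<and> x \<in> S \<and> x \<noteq> a \<and> card (line_pts S a x) = k})"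
    (is "_ \<le> real (card ?P)")
proof -
  define H where "H = {a \<in> S. real (degree_on S k a) \<ge> n / 60}"
  let ?Y = "{(p, q, r). p \<in> S \<and> q \<in> S \<and> r \<in> S \<and> (p \<in> H \<or> q \<in> H \<or> r \<in> H)}"
  have "X \<subseteq> ?Y"
  proof
    fix u assume u: "u \<in> X"
    obtain p q r where u': "u = (p, q, r)" by (cases u) auto
    show "u \<in> ?Y" using X[of p q r] u by (auto simp: u' H_def)
  qed
  moreover have "finite ?Y" by (rule finite_subset[of _ "S \<otimes> S \<otimes> S"]) (auto simp: fin)
  ultimately have "card X \<le> card ?Y" by (rule card_mono[rotated])
  also have "\<dots> \<le> 3 * (card H * card S ^ 2)" by (rule card_triples_meeting_le[OF fin]) (auto simp: H_def)
  finally have "real (card X) \<le> real (3 * (card H * card S ^ 2))" by (rule of_nat_mono)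
  then have "real (card X) \<le> 3 * (real (card H) * n ^ 2)" by (simp add: n_def)
  then have "b * n * n\<^sup>2 \<le> 3 * real (card H) * n\<^sup>2" using cX by (simp add: power3_eq_cube power2_eq_square algebra_simps)
  then have H: "b * n / 3 \<le> real (card H)" using n0 by (simp add: mult_le_cancel_right)
  have P: "?P = Sigma S (\<lambda>a. {x \<in> S. x \<noteq> a \<and> card (line_pts S a x) = k})" by auto
  have "(b * n / 3) * (n / 60) \<le> real (card (Sigma H (\<lambda>a. {x \<in> S. x \<noteq> a \<and> card (line_pts S a x) = k})))"
    by (rule card_Sigma_ge) (use H fin n0 in \<open>auto simp: H_def degree_on_def\<close>)
  also have "\<dots> \<le> real (card ?P)" unfolding P
    using fin by (intro of_nat_mono card_mono) (auto simp: H_def)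
  finally show ?thesis by (simp add: power2_eq_square)
qed

text \<open>An ordered pair spanning a three-point line and one spanning a two-point line without
  common points of \<open>S\<close> give an ordinary conic. At most \<open>6 * n\<close> pairs
  contain a point of a given three-point line, and a conic is charged at most 5^4 times.\<close>

lemma ordinary_conics_from_line_pairs:
  fixes S :: "(real \<times> real) set" and n b :: real
  defines "n \<equiv> real (card S)"
  assumes fin: "finite S" and b: "0 \<le> b"
    and 2: "b * n ^ 2 \<le> real (card {(a, x). a \<in> S \<and> x \<in> S \<and> x \<noteq> a \<and> card (line_pts S a x) = 2})"
    and 3: "b * n ^ 2 \<le> real (card {(a, x). a \<in> S \<and> x \<in> S \<and> x \<noteq> a \<and> card (line_pts S a x) = 3})"
  shows "b ^ 2 * n ^ 4 - 6 * n ^ 3 \<le> 625 * real (card {C. ordinary_conic S C})"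
proof -
  define P where "P = (\<lambda>k::nat. {(a, x). a \<in> S \<and> x \<in> S \<and> x \<noteq> a \<and> card (line_pts S a x) = k})"
  have finP: "finite (P k)" for k unfolding P_def by (rule finite_subset[of _ "S \<otimes> S"]) (auto simp: fin)
  have PS: "P k \<subseteq> S \<otimes> S" for k by (auto simp: P_def)
  define B1 where "B1 = (\<lambda>(c, d). Sigma (line_pts S c d) (\<lambda>_. S))"
  define B2 where "B2 = (\<lambda>(c, d). Sigma S (\<lambda>_. line_pts S c d))"
  define F where "F = Sigma (P 3) (\<lambda>cd. P 2 - B1 cd - B2 cd)"
  have cB: "real (card (B1 cd)) \<le> 3 * n" "real (card (B2 cd)) \<le> 3 * n" "finite (B1 cd)" "finite (B2 cd)"
    if "cd \<in> P 3" for cd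
    using that fin by (auto simp: B1_def B2_def P_def card_cartesian_product n_def)
  have "real (card (P 3)) * (b * n\<^sup>2 - 6 * n) \<le> real (card F)"
  proof -
    have "real (card (P 3)) * (b * n\<^sup>2 - 6 * n) = (\<Sum>cd\<in>P 3. b * n\<^sup>2 - 6 * n)" by simp
    also have "\<dots> \<le> (\<Sum>cd\<in>P 3. real (card (P 2 - B1 cd - B2 cd)))"
    proof (rule sum_mono)
      fix cd assume cd: "cd \<in> P 3"
      show "b * n\<^sup>2 - 6 * n \<le> real (card (P 2 - B1 cd - B2 cd))"
        using card_Diff_ge[OF cB(3)[OF cd], of "P 2"] card_Diff_ge[OF cB(4)[OF cd], of "P 2 - B1 cd"] cB(1,2)[OF cd] 2
        unfolding P_def by linarith
    qed
    also have "\<dots> = real (card F)" unfolding F_def using finP by (subst card_SigmaI) auto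
    finally show ?thesis .
  qed
  \<comment> \<open>The factor on the right may be negative. So \<open>card (P 3)\<close> is bounded
    from below in the term with \<open>b\<close>, and from above by the square of \<open>n\<close>
    in the subtracted term.\<close>
  moreover have "b\<^sup>2 * n ^ 4 - 6 * n ^ 3 \<le> real (card (P 3)) * (b * n\<^sup>2 - 6 * n)"
  proof -
    have p3: "b * n\<^sup>2 \<le> real (card (P 3))" using 3 by (simp add: P_def)
    have "card (P 3) \<le> card (S \<otimes> S)" by (rule card_mono[OF _ PS]) (simp add: fin)
    then have "card (P 3) \<le> card S * card S" by (simp add: card_cartesian_product)
    then have "real (card (P 3)) \<le> n\<^sup>2" by (metis n_def of_nat_mono of_nat_mult power2_eq_square)
    then have "real (card (P 3)) * (6 * n) \<le> n\<^sup>2 * (6 * n)" by (intro mult_right_mono) (auto simp: n_def)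
    moreover have "(b * n\<^sup>2) * (b * n\<^sup>2) \<le> real (card (P 3)) * (b * n\<^sup>2)" using p3 b by (intro mult_right_mono) auto
    ultimately have "(b * n\<^sup>2) * (b * n\<^sup>2) - n\<^sup>2 * (6 * n) \<le> real (card (P 3)) * (b * n\<^sup>2 - 6 * n)"
      by (simp add: right_diff_distrib)
    then show ?thesis by (simp add: power4_eq_xxxx power3_eq_cube power2_eq_square algebra_simps)
  qed
  moreover have "card F \<le> 625 * card {C. ordinary_conic S C}"
  proof (rule card_le_ordinary_conics[OF fin, where K = "\<lambda>A. (A \<otimes> A) \<otimes> (A \<otimes> A)"])
    show "F \<subseteq> (\<Union>C\<in>{C. ordinary_conic S C}. ((S \<inter> C) \<otimes> (S \<inter> C)) \<otimes> ((S \<inter> C) \<otimes> (S \<inter> C)))"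
    proof
      fix u assume u: "u \<in> F"
      obtain c d x y where u': "u = ((c, d), (x, y))" by (metis surj_pair)
      have h: "c \<in> S" "d \<in> S" "d \<noteq> c" "card (line_pts S c d) = 3" "x \<in> S" "y \<in> S" "y \<noteq> x" "card (line_pts S x y) = 2"
        "x \<notin> line_pts S c d" "y \<notin> line_pts S c d"
        using u by (auto simp: u' F_def P_def B1_def B2_def)
      have "{x, y} \<subseteq> line_pts S x y" "{c, d} \<subseteq> line_pts S c d" using h by (auto simp: line_pts_def)
      moreover have "card {x, y} = 2" "card {c, d} = 2" using h by auto
      ultimately have xy: "line_pts S x y = {x, y}" and "card (line_pts S c d - {c, d}) = 1"
        using h card_subset_eq[of "line_pts S x y" "{x, y}"] fin by (auto simp: card_Diff_subset)
      then obtain e where e: "line_pts S c d - {c, d} = {e}" by (auto simp: card_1_singleton_iff)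
      then have cde: "line_pts S c d = {c, d, e}" "e \<noteq> c" "e \<noteq> d" using \<open>{c, d} \<subseteq> line_pts S c d\<close> by auto
      have "e \<in> S" using e by (auto simp: line_pts_def)
      moreover have "card {x, y, c, d, e} = 5" using h cde by auto
      moreover have "z \<in> {x, y}" if "z \<in> S" "tri x y z = 0" for z
        using that xy unfolding line_pts_def by blast
      moreover have "tri c d z = 0 \<longleftrightarrow> z \<in> {c, d, e}" if "z \<in> S" for z
        using that cde(1) unfolding line_pts_def by blast
      ultimately obtain C where C: "ordinary_conic S C" "S \<inter> C = {x, y, c, d, e}"
        using ordinary_conic_two_lines[of x y c d e S] h by blast
      have "u \<in> ((S \<inter> C) \<otimes> (S \<inter> C)) \<otimes> ((S \<inter> C) \<otimes> (S \<inter> C))" unfolding C(2) u' by simp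
      then show "u \<in> (\<Union>C\<in>{C. ordinary_conic S C}. ((S \<inter> C) \<otimes> (S \<inter> C)) \<otimes> ((S \<inter> C) \<otimes> (S \<inter> C)))"
        using C(1) by blast
    qed
  qed (auto simp: card_cartesian_product)
  ultimately show ?thesis by linarith
qed

theorem many_ordinary_conics_far_from_conics:
  fixes \<eta> :: real
  assumes \<eta>: "0 < \<eta>" "\<eta> < 1"
  shows "\<exists>\<kappa>>0. \<exists>N. \<forall>S. finite S \<longrightarrow> real (card S) \<ge> N \<longrightarrow>
    (\<forall>C. is_conic C \<longrightarrow> real (card (S - C)) \<ge> \<eta> * real (card S)) \<longrightarrow>
    real (card {C. ordinary_conic S C}) \<ge> \<kappa> * real (card S) ^ 4"
proof -
  \<comment> \<open>The 96 makes each side at most \<open>n / 96\<close>, as the dichotomy requires,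
    and keeps three sides together below \<open>\<eta> * n\<close>.\<close>
  define \<delta> where "\<delta> = \<eta> / 96"
  define K where "K = (2 / \<delta>\<^sup>2)\<^sup>2"
  \<comment> \<open>Half of the supply of poor triples: they split into those with many completions
    and those with few, and one class contains half.\<close>
  define b where "b = (\<eta> / 2) ^ 3 / 2"
  define b' where "b' = b / 180"
  \<comment> \<open>The 3125 is 5^5, for a triple and an ordered pair on the same conic. The 1250 is
    twice 5^4, because \<open>N\<close> is so large that the cubic error takes at most half of the
    quartic term.\<close>
  define \<kappa> where "\<kappa> = min (b / (60 * 3125)) (b'\<^sup>2 / 1250)"
  define N where "N = max 1000 (max (2 / \<delta>) (max (8 * (K + 1) / \<eta>) (12 / b'\<^sup>2)))"
  have \<delta>: "\<delta> > 0" "\<delta> \<le> \<eta> / 8" "\<delta> \<le> 1 / 96" using \<eta> by (auto simp: \<delta>_def)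
  have b: "b > 0" "b' > 0" using \<eta> by (auto simp: b_def b'_def)
  have "\<kappa> > 0" using b by (simp add: \<kappa>_def)
  moreover have "real (card {C. ordinary_conic S C}) \<ge> \<kappa> * real (card S) ^ 4"
    if fin: "finite S" and large: "real (card S) \<ge> N"
      and far: "\<And>C. is_conic C \<Longrightarrow> real (card (S - C)) \<ge> \<eta> * real (card S)" for S
  proof -
    define n where "n = real (card S)"
    define Or where "Or = real (card {C. ordinary_conic S C})"
    have n: "n \<ge> 1000" "n \<ge> 2 / \<delta>" "n \<ge> 8 * (K + 1) / \<eta>" "n \<ge> 12 / b'\<^sup>2"
      using large by (simp_all add: N_def n_def)
    have n': "\<delta> * n \<ge> 2" "\<eta> * n \<ge> 8 * (K + 1)" "b'\<^sup>2 * n \<ge> 12"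
      using n \<delta> \<eta> b by (simp_all add: field_simps)
    define Tr where "Tr = {(p, q, r). p \<in> S \<and> q \<in> S \<and> r \<in> S \<and> tri p q r \<noteq> 0 \<and>
      real (card (line_pts S p q)) \<le> \<delta> * n \<and> real (card (line_pts S p r)) \<le> \<delta> * n \<and>
      real (card (line_pts S q r)) \<le> \<delta> * n}"
    have cTr: "2 * b * n ^ 3 \<le> real (card Tr)"
      using many_poor_triples[OF fin \<delta>(1,2) \<eta>(2) far] n' by (simp add: n_def K_def Tr_def b_def)
    have finTr: "finite Tr" unfolding Tr_def by (rule finite_subset[of _ "S \<otimes> S \<otimes> S"]) (auto simp: fin)
    define T1 where "T1 = {(p, q, r) \<in> Tr. real (card (completions S p q r)) \<ge> n / 60}"
    define T2 where "T2 = Tr - T1"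
    have "Tr = T1 \<union> T2" by (auto simp: T1_def T2_def)
    then have "real (card Tr) \<le> real (card T1) + real (card T2)" using card_Un_le[of T1 T2] by simp
    then consider "b * n ^ 3 \<le> real (card T1)" | "b * n ^ 3 \<le> real (card T2)" using cTr by linarith
    then have "\<kappa> * n ^ 4 \<le> Or"
    proof cases
      case 1
      define F where "F = Sigma T1 (\<lambda>(p, q, r). completions S p q r)"
      have finc: "finite (completions S p q r)" for p q r
        unfolding completions_def by (rule finite_subset[of _ "S \<otimes> S"]) (auto simp: fin)
      have "(b * n ^ 3) * (n / 60) \<le> real (card F)" unfolding F_def
        by (rule card_Sigma_ge) (use 1 n finTr finc in \<open>auto simp: T1_def intro: finite_subset[of _ Tr]\<close>)
      moreover have "card F \<le> 3125 * card {C. ordinary_conic S C}"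
      proof (rule card_le_ordinary_conics[OF fin, where K = "\<lambda>A. (A \<otimes> A \<otimes> A) \<otimes> (A \<otimes> A)"])
        show "F \<subseteq> (\<Union>C\<in>{C. ordinary_conic S C}. ((S \<inter> C) \<otimes> (S \<inter> C) \<otimes> (S \<inter> C)) \<otimes> ((S \<inter> C) \<otimes> (S \<inter> C)))"
        proof
          fix u assume u: "u \<in> F"
          obtain p q r x y where u': "u = ((p, q, r), (x, y))" by (metis surj_pair)
          have "(x, y) \<in> completions S p q r" using u by (simp add: F_def u')
          then obtain C where C: "ordinary_conic S C" "S \<inter> C = {p, q, r, x, y}" unfolding completions_def by blast
          have "u \<in> ((S \<inter> C) \<otimes> (S \<inter> C) \<otimes> (S \<inter> C)) \<otimes> ((S \<inter> C) \<otimes> (S \<inter> C))" unfolding C(2) u' by simp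
          then show "u \<in> (\<Union>C\<in>{C. ordinary_conic S C}. ((S \<inter> C) \<otimes> (S \<inter> C) \<otimes> (S \<inter> C)) \<otimes> ((S \<inter> C) \<otimes> (S \<inter> C)))"
            using C(1) by blast
        qed
      qed (auto simp: card_cartesian_product)
      then have "real (card F) \<le> 3125 * Or" unfolding Or_def by linarith
      ultimately have "b / (60 * 3125) * n ^ 4 \<le> Or" by (simp add: power3_eq_cube power4_eq_xxxx)
      moreover have "\<kappa> * n ^ 4 \<le> b / (60 * 3125) * n ^ 4" by (intro mult_right_mono) (auto simp: \<kappa>_def n_def)
      ultimately show ?thesis by linarith
    next
      case 2
      have T2: "p \<in> S \<and> q \<in> S \<and> r \<in> S \<and> (\<exists>a\<in>{p, q, r}. real (degree_on S 2 a) \<ge> n / 60)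
          \<and> (\<exists>a\<in>{p, q, r}. real (degree_on S 3 a) \<ge> n / 60)" if "(p, q, r) \<in> T2" for p q r
      proof -
        have h: "p \<in> S" "q \<in> S" "r \<in> S" "tri p q r \<noteq> 0" "real (card (line_pts S p q)) \<le> \<delta> * n"
          "real (card (line_pts S p r)) \<le> \<delta> * n" "real (card (line_pts S q r)) \<le> \<delta> * n"
          "real (card (completions S p q r)) < n / 60"
          using that by (auto simp: T2_def T1_def Tr_def)
        have d96: "\<delta> * n \<le> n / 96" using mult_right_mono[OF \<delta>(3), of n] n(1) by simp
        have "\<delta> * n * 3 < \<eta> * n" using \<eta> n(1) by (simp add: \<delta>_def)
        then have f: "real (card (S - C)) > real (card (line_pts S p q)) + real (card (line_pts S p r)) + real (card (line_pts S q r))"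
          if "is_conic C" for C using far[OF that] h(5-7) unfolding n_def[symmetric] by linarith
        show ?thesis
          using triple_dichotomy[OF fin h(1-4) _ _ _ f] h d96 n(1) unfolding n_def by (meson order_trans)
      qed
      have n0: "n > 0" using n by simp
      have P: "b' * n ^ 2 \<le> real (card {(a, x). a \<in> S \<and> x \<in> S \<and> x \<noteq> a \<and> card (line_pts S a x) = k})"
        if "k = 2 \<or> k = 3" for k
        unfolding b'_def n_def
      proof (rule many_rich_pairs[OF fin, of b T2])
        show "p \<in> S \<and> q \<in> S \<and> r \<in> S \<and> (\<exists>a\<in>{p, q, r}. real (card S) / 60 \<le> real (degree_on S k a))"
          if "(p, q, r) \<in> T2" for p q r
          using T2[OF that] \<open>k = 2 \<or> k = 3\<close> unfolding n_def by blast
      qed (use n0 b 2 in \<open>simp_all add: n_def\<close>)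
      have "b' ^ 2 * n ^ 4 - 6 * n ^ 3 \<le> 625 * Or"
        unfolding n_def Or_def
        by (rule ordinary_conics_from_line_pairs[OF fin]) (use b P[of 2] P[of 3] in \<open>auto simp: n_def\<close>)
      moreover have "12 * n ^ 3 \<le> (b'\<^sup>2 * n) * n ^ 3" using n' n0 by (intro mult_right_mono) auto
      then have "6 * n ^ 3 \<le> b'\<^sup>2 * n ^ 4 / 2" by (simp add: power3_eq_cube power4_eq_xxxx)
      ultimately have "b'\<^sup>2 / 1250 * n ^ 4 \<le> Or" by simp
      moreover have "\<kappa> * n ^ 4 \<le> b'\<^sup>2 / 1250 * n ^ 4" by (intro mult_right_mono) (auto simp: \<kappa>_def n_def)
      ultimately show ?thesis by linarith
    qed
    then show ?thesis by (simp add: n_def Or_def)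
  qed
  ultimately show ?thesis by blast
qed

section \<open>The lower bound\<close>

lemma line_pts_le_line:
  assumes fin: "finite S" and ab: "a \<noteq> b"
    and lines: "\<And>L. is_line L \<Longrightarrow> real (card (S \<inter> L)) \<le> m"
  shows "real (card (line_pts S a b)) \<le> m"
proof -
  have "is_line (affine hull {a, b})" using ab by (simp add: is_line_def aff_dim_2)
  moreover have "line_pts S a b \<subseteq> S \<inter> affine hull {a, b}"
  proof
    fix z assume "z \<in> line_pts S a b"
    then have z: "z \<in> S" "tri a b z = 0" by (auto simp: line_pts_def)
    obtain t where "z = (fst a + t * (fst b - fst a), snd a + t * (snd b - snd a))"
      using tri_eq_0_imp_on_line[OF ab z(2)] .
    then have "z = (1 - t) *\<^sub>R a + t *\<^sub>R b" by (simp add: prod_eq_iff algebra_simps)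
    moreover have "(1 - t) + t = 1" by simp
    ultimately have "z \<in> affine hull {a, b}" unfolding affine_hull_2 by blast
    then show "z \<in> S \<inter> affine hull {a, b}" using z by simp
  qed
  then have "card (line_pts S a b) \<le> card (S \<inter> affine hull {a, b})" using fin by (intro card_mono) auto
  ultimately show ?thesis using lines by (meson of_nat_mono order_trans)
qed

theorem theorem1p1:
  fixes c :: real
  assumes "0 < c" and "c < 1"
  shows "\<exists>\<kappa>::real. \<kappa> > 0 \<and>
    (\<forall>S :: (real \<times> real) set.
      finite S \<longrightarrow>
      \<not> (\<exists>C. is_conic C \<and> S \<subseteq> C) \<longrightarrow>
      (\<forall>L. is_line L \<longrightarrow> real (card (S \<inter> L)) \<le> c * real (card S)) \<longrightarrow>
      real (card {C. ordinary_conic S C}) \<ge> \<kappa> * real (card S) ^ 4)"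
proof -
  define \<eta> where "\<eta> = (1 - c) ^ 4 / 10000"
  have "(1 - c) ^ 4 \<le> 1" using assms by (intro power_le_one) auto
  then have \<eta>: "0 < \<eta>" "\<eta> < 1" using assms by (auto simp: \<eta>_def)
  obtain \<kappa>1 N where \<kappa>1: "\<kappa>1 > 0" and far: "\<And>S. finite S \<Longrightarrow> real (card S) \<ge> N \<Longrightarrow>
    (\<forall>C. is_conic C \<longrightarrow> real (card (S - C)) \<ge> \<eta> * real (card S)) \<Longrightarrow>
    real (card {C. ordinary_conic S C}) \<ge> \<kappa>1 * real (card S) ^ 4"
    using many_ordinary_conics_far_from_conics[OF \<eta>] by blast
  \<comment> \<open>Up to \<open>M\<close> points a single ordinary conic suffices, because the
    constant is at most \<open>1 / M ^ 4\<close>; beyond \<open>M\<close> both asymptotic estimates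
    are valid.\<close>
  define M where "M = max 1 (max N (12 / (1 - c)))"
  define \<kappa> where "\<kappa> = min (1 / M ^ 4) (min \<kappa>1 ((1 - c) ^ 4 / 20000))"
  have M: "M \<ge> 1" "M \<ge> N" "M \<ge> 12 / (1 - c)" by (auto simp: M_def)
  have "\<kappa> > 0" using \<kappa>1 M assms by (simp add: \<kappa>_def)
  moreover have "real (card {C. ordinary_conic S C}) \<ge> \<kappa> * real (card S) ^ 4"
    if fin: "finite S" and nc: "\<not> (\<exists>C. is_conic C \<and> S \<subseteq> C)"
      and lines: "\<forall>L. is_line L \<longrightarrow> real (card (S \<inter> L)) \<le> c * real (card S)" for S
  proof (cases "real (card S) \<le> M")
    case True
    obtain C where "ordinary_conic S C" using exists_ordinary_conic[OF fin nc] by blast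
    then have "card {C. ordinary_conic S C} \<noteq> 0" using finite_ordinary_conics[OF fin] by auto
    then have "1 \<le> real (card {C. ordinary_conic S C})" by simp
    moreover have "\<kappa> * real (card S) ^ 4 \<le> (1 / M ^ 4) * M ^ 4"
      using True M \<open>\<kappa> > 0\<close> by (intro mult_mono power_mono) (auto simp: \<kappa>_def)
    moreover have "(1 / M ^ 4) * M ^ 4 = 1" using M by simp
    ultimately show ?thesis by linarith
  next
    case False
    show ?thesis
    proof (cases "\<forall>C. is_conic C \<longrightarrow> real (card (S - C)) \<ge> \<eta> * real (card S)")
      case True
      have "\<kappa>1 * real (card S) ^ 4 \<le> real (card {C. ordinary_conic S C})"
        using far[OF fin _ True] False M by linarith
      moreover have "\<kappa> * real (card S) ^ 4 \<le> \<kappa>1 * real (card S) ^ 4"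
        by (intro mult_right_mono) (auto simp: \<kappa>_def)
      ultimately show ?thesis by linarith
    next
      case near: False
      then obtain C0 where C0: "is_conic C0" "real (card (S - C0)) < \<eta> * real (card S)" by (auto simp: not_le)
      have "(1 - c) ^ 4 / 20000 * real (card S) ^ 4 \<le> real (card {C. ordinary_conic S C})"
      proof (rule many_ordinary_conics_near_conic[OF assms fin nc _ C0(1)])
        show "real (card (line_pts S a b)) \<le> c * real (card S)" if "a \<noteq> b" for a b
          using line_pts_le_line[OF fin that] lines by blast
        show "real (card (S - C0)) \<le> (1 - c) ^ 4 / 10000 * real (card S)" using C0 by (simp add: \<eta>_def)
        show "12 / (1 - c) \<le> real (card S)" using False M by linarith
      qed
      moreover have "\<kappa> * real (card S) ^ 4 \<le> (1 - c) ^ 4 / 20000 * real (card S) ^ 4"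
        by (intro mult_right_mono) (auto simp: \<kappa>_def)
      ultimately show ?thesis by linarith
    qed
  qed
  ultimately show ?thesis by blast
qed

end
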